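(* Let $T>0$, $\Omega=\{x+i\tau\in\mathbb C:\ x\in\mathbb R,\ -T<\tau<T\}$, and let $K\ge 1$ be an integer. Let $$\mathcal L=-D\,P_2(z)\,D+P_1(z)\,D+P_0(z),\qquad D=\frac{d}{dz},$$ be a regular differential operator on $\overline\Omega$ with $2\pi$-periodic $K\times K$ matrix valued coefficients analytic in $\Omega$. Suppose that $\mathcal L$ is self adjoint and positive as an operator on $\oplus_K\mathbb L^2_{per}$, and that there is a constant $C_0>0$ such that $$\operatorname{Re}\,(V^*P_2(z)V)\ \ge\ C_0\,\|V\|_E^2\qquad\text{for all }V\in\mathbb C^K,\ z\in\overline\Omega .$$ Then the $2\pi$-periodic eigenfunctions of $\mathcal L$ have dense linear span in $\oplus_K\mathbb H^2$.
   Context: $V^*$ is the conjugate transpose of $V$ and $\|V\|_E=(V^*V)^{1/2}$ is the Euclidean norm. $\mathbb H^2$ is the Hilbert space of $2\pi$-periodic functions $f(z)=\sum_{n\in\mathbb Z}c_ne^{inz}$ analytic in $\Omega$ with $\|f\|_H^2=\sum_n|c_n|^2\cosh(2nT)<\infty$. Such functions have boundary values $f(x\pm iT)$ in $L^2$ over a period, and the inner product is $\langle f,g\rangle_H=\frac1{4\pi}\int_0^{2\pi}[f(x+iT)\overline{g(x+iT)}+f(x-iT)\overline{g(x-iT)}]\,dx$. $\oplus_K\mathbb H^2$ is the space of column vectors of length $K$ with entries in $\mathbb H^2$, with the direct sum inner product. $\oplus_K\mathbb L^2_{per}$ is the Hilbert space of $2\pi$-periodic $\mathbb C^K$-valued functions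 on $\mathbb R$ that are square integrable on $[0,2\pi]$, with $\langle f,g\rangle_L=\frac1{2\pi}\int_0^{2\pi}g^*(x)f(x)\,dx$. Regular: the coefficients have entries in $\mathbb H^2$; when the operator is written as $\sum_{j=0}^2A_j(z)D^j$, each $A_j$ has $j$ continuous derivatives on the closed strip $\overline\Omega$, and the leading coefficient satisfies $\det A_2(z)\ne0$ for all $z\in\overline\Omega$ (here $A_2=-P_2$, $A_1=P_1-P_2'$, $A_0=P_0$). On $\oplus_K\mathbb L^2_{per}$, $\mathcal L$ acts through the restriction of its coefficients to $\mathbb R$, on the domain of $D^2$ (periodic functions whose second derivative lies in $\oplus_K\mathbb L^2_{per}$). Positive means $\langle\mathcal Lf,f\rangle_L>0$ for all nonzero $f$ in this domain. On $\oplus_K\mathbb H^2$, $\mathcal L$ has as domain those $f\in\oplus_K\mathbb H^2$ with $f''\in\oplus_K\mathbb H^2$. A $2\pi$-periodic eigenfunction is a nonzero $2\pi$-periodic solution of $\mathcal L\psi=\lambda\psi$ for some $\lambda\in\mathbb C$; such solutions are analytic in $\Omega$ and lie in $\oplus_K\mathbb H^2$. *)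

theory Defs
  imports "HOL-Complex_Analysis.Complex_Analysis"
begin

definition strip :: "real \<Rightarrow> complex set" where
  "strip T = {z. - T < Im z \<and> Im z < T}"

definition closed_strip :: "real \<Rightarrow> complex set" where
  "closed_strip T = {z. - T \<le> Im z \<and> Im z \<le> T}"

text \<open>\<open>hdot V W\<close> is the product \<open>V\<^sup>* W\<close>; the library's \<open>norm\<close> on \<open>complex ^ 'k\<close> is the Euclidean norm.\<close>

definition hdot :: "complex ^ 'k \<Rightarrow> complex ^ 'k \<Rightarrow> complex" where
  "hdot V W = (\<Sum>i\<in>UNIV. cnj (V $ i) * W $ i)"

text \<open>Elements are total functions on the complex plane of which only the values on the open strip
  matter; two functions agreeing there are the same element, at distance 0.\<close>

definition fourier_coeff :: "(complex \<Rightarrow> complex) \<Rightarrow> int \<Rightarrow> complex" where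
  "fourier_coeff f n =
     1 / (2 * of_real pi) * integral {0..2*pi} (\<lambda>x. f (of_real x) * exp (- \<i> * of_int n * of_real x))"

definition H2 :: "real \<Rightarrow> (complex \<Rightarrow> complex) set" where
  "H2 T = {f. f holomorphic_on strip T
            \<and> (\<forall>z\<in>strip T. f (z + 2 * of_real pi) = f z)
            \<and> (\<forall>z\<in>strip T. ((\<lambda>n. fourier_coeff f n * exp (\<i> * of_int n * z)) has_sum f z) UNIV)
            \<and> (\<lambda>n. (cmod (fourier_coeff f n))\<^sup>2 * cosh (2 * of_int n * T)) summable_on UNIV}"

definition H2_norm :: "real \<Rightarrow> (complex \<Rightarrow> complex) \<Rightarrow> real" where
  "H2_norm T f = sqrt (\<Sum>\<^sub>\<infinity>n. (cmod (fourier_coeff f n))\<^sup>2 * cosh (2 * of_int n * T))"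

definition H2_vec :: "real \<Rightarrow> (complex \<Rightarrow> complex ^ 'k) set" where
  "H2_vec T = {f. \<forall>i. (\<lambda>z. f z $ i) \<in> H2 T}"

definition H2_vec_norm :: "real \<Rightarrow> (complex \<Rightarrow> complex ^ 'k) \<Rightarrow> real" where
  "H2_vec_norm T f = sqrt (\<Sum>i\<in>UNIV. (H2_norm T (\<lambda>z. f z $ i))\<^sup>2)"

definition dense_in_H2_vec :: "real \<Rightarrow> (complex \<Rightarrow> complex ^ 'k) set \<Rightarrow> bool" where
  "dense_in_H2_vec T S \<longleftrightarrow>
     S \<subseteq> H2_vec T \<and> (\<forall>f\<in>H2_vec T. \<forall>e>0. \<exists>g\<in>S. H2_vec_norm T (\<lambda>z. f z - g z) < e)"

definition complex_span :: "(complex \<Rightarrow> complex ^ 'k) set \<Rightarrow> (complex \<Rightarrow> complex ^ 'k) set" where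
  "complex_span E = {(\<lambda>z. \<Sum>\<psi>\<in>F. c \<psi> *s \<psi> z) | F c. finite F \<and> F \<subseteq> E}"

text \<open>Derivatives on the closed strip are complex derivatives relative to the closed strip, hence
  one-sided at boundary points.\<close>

primrec continuously_differentiable_on :: "nat \<Rightarrow> complex set \<Rightarrow> (complex \<Rightarrow> complex) \<Rightarrow> bool" where
  "continuously_differentiable_on 0 S f \<longleftrightarrow> continuous_on S f"
| "continuously_differentiable_on (Suc j) S f \<longleftrightarrow>
     (\<exists>f'. (\<forall>z\<in>S. (f has_field_derivative f' z) (at z within S))
           \<and> continuously_differentiable_on j S f')"

definition matrix_deriv_on ::
    "complex set \<Rightarrow> (complex \<Rightarrow> complex ^ 'k ^ 'k) \<Rightarrow> (complex \<Rightarrow> complex ^ 'k ^ 'k) \<Rightarrow> bool" where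
  "matrix_deriv_on S P P' \<longleftrightarrow>
     (\<forall>z\<in>S. \<forall>i j. ((\<lambda>w. P w $ i $ j) has_field_derivative P' z $ i $ j) (at z within S))"

definition matrix_continuously_differentiable_on ::
    "nat \<Rightarrow> complex set \<Rightarrow> (complex \<Rightarrow> complex ^ 'k ^ 'k) \<Rightarrow> bool" where
  "matrix_continuously_differentiable_on n S P \<longleftrightarrow>
     (\<forall>i j. continuously_differentiable_on n S (\<lambda>z. P z $ i $ j))"

definition regular_operator ::
    "real \<Rightarrow> (complex \<Rightarrow> complex ^ 'k ^ 'k) \<Rightarrow> (complex \<Rightarrow> complex ^ 'k ^ 'k)
       \<Rightarrow> (complex \<Rightarrow> complex ^ 'k ^ 'k) \<Rightarrow> bool" where
  "regular_operator T P2 P1 P0 \<longleftrightarrow>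
     (\<forall>P\<in>{P2, P1, P0}. \<forall>i j. (\<lambda>z. P z $ i $ j) \<in> H2 T)
     \<and> (\<exists>P2'. matrix_deriv_on (closed_strip T) P2 P2'
          \<and> (let A2 = (\<lambda>z. - P2 z); A1 = (\<lambda>z. P1 z - P2' z); A0 = P0 in
               matrix_continuously_differentiable_on 2 (closed_strip T) A2
             \<and> matrix_continuously_differentiable_on 1 (closed_strip T) A1
             \<and> matrix_continuously_differentiable_on 0 (closed_strip T) A0
             \<and> (\<forall>z\<in>closed_strip T. det (A2 z) \<noteq> 0)))"

definition L2_per :: "(real \<Rightarrow> complex ^ 'k) set" where
  "L2_per = {f. f \<in> borel_measurable lebesgue
              \<and> (\<forall>x. f (x + 2 * pi) = f x)
              \<and> set_integrable lebesgue {0..2*pi} (\<lambda>x. (norm (f x))\<^sup>2)}"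

definition L2_inner :: "(real \<Rightarrow> complex ^ 'k) \<Rightarrow> (real \<Rightarrow> complex ^ 'k) \<Rightarrow> complex" where
  "L2_inner f g = 1 / (2 * of_real pi) * (LINT x:{0..2*pi}|lebesgue. hdot (g x) (f x))"

text \<open>Operators on \<open>L2_per\<close> are represented by their graphs. As elements of \<open>L2_per\<close> are determined
  only almost everywhere, graphs are closed under almost everywhere equality in both components.
  \<open>D_graph\<close> is differentiation on the (classes of) periodic, locally absolutely continuous
  functions with square integrable derivative.\<close>

definition D_graph :: "((real \<Rightarrow> complex ^ 'k) \<times> (real \<Rightarrow> complex ^ 'k)) set" where
  "D_graph = {(f, g). f \<in> L2_per \<and> g \<in> L2_per
      \<and> (\<exists>F. (AE x in lebesgue. f x = F x)
           \<and> (\<forall>x y. x \<le> y \<longrightarrow> (g has_integral (F y - F x)) {x..y}))}"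

text \<open>The witness \<open>f2\<close> restricts the domain to that of the second derivative; \<open>q\<close> is the derivative
  of \<open>P2 f'\<close>.\<close>

definition L_graph ::
    "(complex \<Rightarrow> complex ^ 'k ^ 'k) \<Rightarrow> (complex \<Rightarrow> complex ^ 'k ^ 'k) \<Rightarrow> (complex \<Rightarrow> complex ^ 'k ^ 'k)
       \<Rightarrow> ((real \<Rightarrow> complex ^ 'k) \<times> (real \<Rightarrow> complex ^ 'k)) set" where
  "L_graph P2 P1 P0 = {(f, h). h \<in> L2_per
      \<and> (\<exists>f1 f2 q. (f, f1) \<in> D_graph \<and> (f1, f2) \<in> D_graph
           \<and> ((\<lambda>x. P2 (of_real x) *v f1 x), q) \<in> D_graph
           \<and> (AE x in lebesgue. h x = - q x + P1 (of_real x) *v f1 x + P0 (of_real x) *v f x))}"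

definition adjoint_graph ::
    "((real \<Rightarrow> complex ^ 'k) \<times> (real \<Rightarrow> complex ^ 'k)) set
       \<Rightarrow> ((real \<Rightarrow> complex ^ 'k) \<times> (real \<Rightarrow> complex ^ 'k)) set" where
  "adjoint_graph G =
     {(u, v). u \<in> L2_per \<and> v \<in> L2_per \<and> (\<forall>(f, h)\<in>G. L2_inner h u = L2_inner f v)}"

text \<open>Equality of the graphs includes equality of the domains. When \<open>G\<close> is the graph of an operator,
  it also forces the domain to be dense: if \<open>w\<close> is orthogonal to the domain, then \<open>(0, w)\<close> lies in
  the adjoint graph, so \<open>w = 0\<close> almost everywhere.\<close>

definition self_adjoint_graph :: "((real \<Rightarrow> complex ^ 'k) \<times> (real \<Rightarrow> complex ^ 'k)) set \<Rightarrow> bool" where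
  "self_adjoint_graph G \<longleftrightarrow> adjoint_graph G = G"

definition positive_graph :: "((real \<Rightarrow> complex ^ 'k) \<times> (real \<Rightarrow> complex ^ 'k)) set \<Rightarrow> bool" where
  "positive_graph G \<longleftrightarrow>
     (\<forall>(f, h)\<in>G. \<not> (AE x in lebesgue. f x = 0) \<longrightarrow> L2_inner h f \<in> \<real> \<and> Re (L2_inner h f) > 0)"

definition vec_deriv :: "(complex \<Rightarrow> complex ^ 'k) \<Rightarrow> complex \<Rightarrow> complex ^ 'k" where
  "vec_deriv f z = (\<chi> i. deriv (\<lambda>w. f w $ i) z)"

definition L_op ::
    "(complex \<Rightarrow> complex ^ 'k ^ 'k) \<Rightarrow> (complex \<Rightarrow> complex ^ 'k ^ 'k) \<Rightarrow> (complex \<Rightarrow> complex ^ 'k ^ 'k)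
       \<Rightarrow> (complex \<Rightarrow> complex ^ 'k) \<Rightarrow> complex \<Rightarrow> complex ^ 'k" where
  "L_op P2 P1 P0 f z =
     - vec_deriv (\<lambda>w. P2 w *v vec_deriv f w) z + P1 z *v vec_deriv f z + P0 z *v f z"

text \<open>Membership in \<open>H2_vec T\<close> is not part of the definition; it is part of what
  \<open>dense_in_H2_vec\<close> asserts.\<close>

definition periodic_eigenfunctions ::
    "real \<Rightarrow> (complex \<Rightarrow> complex ^ 'k ^ 'k) \<Rightarrow> (complex \<Rightarrow> complex ^ 'k ^ 'k)
       \<Rightarrow> (complex \<Rightarrow> complex ^ 'k ^ 'k) \<Rightarrow> (complex \<Rightarrow> complex ^ 'k) set" where
  "periodic_eigenfunctions T P2 P1 P0 = {\<psi>.
       (\<forall>i. (\<lambda>z. \<psi> z $ i) holomorphic_on strip T)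
     \<and> (\<forall>z\<in>strip T. \<psi> (z + 2 * of_real pi) = \<psi> z)
     \<and> (\<exists>z\<in>strip T. \<psi> z \<noteq> 0)
     \<and> (\<exists>\<mu>. \<forall>z\<in>strip T. L_op P2 P1 P0 \<psi> z = \<mu> *s \<psi> z)}"

end

theory Submission
  imports Defs "HOL-Real_Asymp.Real_Asymp"
begin

text \<open>  The operator acts on the Hardy space of the strip, which the Fourier coefficients, weighted by
  \<open>sqrt (cosh (2 n T))\<close>, identify with a space of square summable sequences. It is not symmetric there,
  but it is symmetric for the \<open>L\<^sup>2\<close> product on the real line, which is a weaker inner product on the same
  space. The proof combines this weak symmetry with ellipticity on every horizontal line.

  To show that the eigenfunctions span a dense subspace, let \<open>\<phi>\<close> be a bounded functional that vanishes on
  all of them, let \<open>f\<close> be a trigonometric polynomial, and put \<open>F z = \<phi> (R z f)\<close> with the resolvent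
  \<open>R z = (L - z)\<^bsup>-1\<^esup>\<close>. Weak symmetry and compactness make the eigenvalues real and isolated, and \<open>R z\<close> exists
  at all other points. The singularities of \<open>F\<close> are removable: a nonvanishing limit of \<open>(z - a) R z f\<close>
  would be an eigenvector, which \<open>\<phi>\<close> kills (\<open>resolvent_pole_removable\<close>). So \<open>F\<close> is entire, and three estimates
  force it to vanish.

  (1) Since \<open>Re (V\<^sup>* P2 V) \<ge> C0 \<parallel>V\<parallel>\<^sup>2\<close> on every line \<open>Im z = \<tau>\<close>, integration by parts on that line shows that the
  numerical range of \<open>L\<close> lies in a translated sector around the positive axis, uniformly in \<open>\<tau>\<close>. Hence
  \<open>\<parallel>R z\<parallel> \<le> C / \<bar>z\<bar>\<close> for large \<open>z\<close> with \<open>Re z \<le> 0\<close> (\<open>sector_energy_bound\<close>, \<open>op_left_half_plane\<close>).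

  (2) By weak symmetry the \<open>L\<^sup>2\<close> norm of \<open>R z f\<close> on the real line is at most \<open>1 / \<bar>Im z\<bar>\<close> times that of \<open>f\<close>.

  (3) In the vertical direction \<open>L u - z u = f\<close> is a second order differential equation with frequency of order
  \<open>sqrt \<bar>z\<bar>\<close>, so Gronwall's inequality bounds the norm of \<open>u\<close> in the Hardy space by \<open>exp (C sqrt \<bar>z\<bar>)\<close> times
  its size on the real line (\<open>vertical_growth\<close>, \<open>op_growth\<close>).

  From (2) and (3), \<open>\<bar>F z\<bar> \<le> C exp (C sqrt \<bar>z\<bar>) (1 + 1 / \<bar>Im z\<bar>)\<close>. This is growth of order \<open>1/2\<close>, below the
  critical order \<open>1\<close> of a half-plane, so by the Phragmen-Lindelof principle the bound (1) on the imaginary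
  axis extends to the right half-plane, and Liouville's theorem gives \<open>F = 0\<close>
  (\<open>Phragmen_Lindelof_vanishing\<close>). Letting \<open>f\<close> vary in a dense set, \<open>\<phi>\<close> vanishes on the domain of \<open>L\<close> and
  hence everywhere.

  Existence of the resolvent far to the left comes from the method of continuity along the deformation of
  \<open>L\<close> to \<open>- D\<^sup>2\<close> (\<open>op_onto_far_left\<close>). Functions holomorphic in the open strip enter the Hardy space only
  through bounds on the lines \<open>\<bar>\<tau>\<bar> < T\<close> (\<open>hardy_fun_exists\<close>); boundary values are never formed.\<close>

section \<open>A Phragmen-Lindelof argument\<close>

text \<open>Multiplying a function by \<open>1 - w\<^sup>2 / r\<^sup>2\<close> thus makes a singularity of size \<open>1 / \<bar>Im w\<bar>\<close> at the two
  points where the circle meets the real axis harmless, while for fixed \<open>w\<close> the factor tends to \<open>1\<close>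
  as \<open>r\<close> grows.\<close>

lemma cmod_square_minus_on_circle:
  assumes "cmod w = r"
  shows "cmod (w\<^sup>2 - of_real (r\<^sup>2)) = 2 * r * \<bar>Im w\<bar>"
proof -
  have r2: "of_real (r\<^sup>2) = w * cnj w"
    using assms by (metis complex_norm_square of_real_power)
  have "w\<^sup>2 - of_real (r\<^sup>2) = w * (w - cnj w)"
    unfolding r2 by (simp add: power2_eq_square algebra_simps)
  also have "w - cnj w = of_real (2 * Im w) * \<i>"
    by (simp add: complex_eq_iff)
  finally show ?thesis
    using assms by (simp add: norm_mult abs_mult)
qed

text \<open>On the closed right half-plane \<open>w powr (3/4)\<close> has argument at most \<open>3 \<pi> / 8 < \<pi> / 2\<close>, so
  \<open>exp (- e * w powr (3/4))\<close> decays there. The exponent is any number strictly between the growth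
  order \<open>1/2\<close> of the resolvent and the critical order \<open>1\<close> of the half-plane.\<close>

lemma Re_powr_three_quarters:
  assumes "Re w \<ge> 0"
  shows "Re (w powr (3/4)) \<ge> cos (3 * pi / 8) * cmod w powr (3/4)"
proof (cases "w = 0")
  case False
  have im: "\<bar>Im (Ln w)\<bar> \<le> pi / 2"
    using assms False Re_Ln_pos_le by blast
  have "w powr (3/4) = exp (of_real (3/4) * Ln w)"
    using False by (simp add: powr_def)
  hence "Re (w powr (3/4)) = exp (3/4 * Re (Ln w)) * cos (3/4 * Im (Ln w))"
    by (simp add: Re_exp)
  also have "exp (3/4 * Re (Ln w)) = cmod w powr (3/4)"
    using False by (simp add: powr_def)
  finally have eq: "Re (w powr (3/4)) = cmod w powr (3/4) * cos (3/4 * Im (Ln w))" .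
  have "cos (3 * pi / 8) \<le> cos \<bar>3/4 * Im (Ln w)\<bar>"
    by (rule cos_monotone_0_pi_le) (use im in \<open>auto simp: abs_mult\<close>)
  hence "cos (3 * pi / 8) \<le> cos (3/4 * Im (Ln w))" by (simp only: cos_abs_real)
  thus ?thesis unfolding eq by (subst mult.commute) (rule mult_left_mono, auto)
qed auto

text \<open>The decay in the left half-plane bounds \<open>F\<close> on the imaginary axis. In the right half-plane \<open>F\<close> has
  order at most \<open>1/2 < 1\<close> except near the positive real axis, where the growth bound is useless; as
  \<open>F\<close> is entire, the maximum principle on half discs still applies once the factor of
  \<open>cmod_square_minus_on_circle\<close> has absorbed the blow-up. Hence \<open>F\<close> is bounded, so constant by Liouville, and the constant
  is \<open>0\<close> by the decay to the left.\<close>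

lemma Phragmen_Lindelof_vanishing:
  assumes hol: "F holomorphic_on UNIV" and C: "C > 0"
    and growth: "\<And>z. Im z \<noteq> 0 \<Longrightarrow> cmod (F z) \<le> C * exp (C * sqrt (cmod z)) * (1 + 1 / \<bar>Im z\<bar>)"
    and left: "\<And>z. Re z \<le> 0 \<Longrightarrow> cmod z \<ge> C \<Longrightarrow> cmod (F z) \<le> C / cmod z"
  shows "F z = 0"
proof -
  have cont: "continuous_on A F" for A
    using hol holomorphic_on_imp_continuous_on continuous_on_subset by blast
  have "compact (F ` cball 0 C)"
    by (intro compact_continuous_image cont) auto
  then obtain M0 where M0: "\<And>z. z \<in> cball 0 C \<Longrightarrow> cmod (F z) \<le> M0"
    by (meson bounded_iff compact_imp_bounded imageI)
  define M where "M = max M0 1"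
  have M1: "M \<ge> 1" by (simp add: M_def)
  have leftM: "cmod (F z) \<le> M" if "Re z \<le> 0" for z
  proof (cases "cmod z \<le> C")
    case True thus ?thesis using M0[of z] by (simp add: M_def)
  next
    case False
    hence "cmod (F z) \<le> C / cmod z" using left that by auto
    also have "\<dots> \<le> 1" using False C by (simp add: divide_simps)
    finally show ?thesis using M1 by simp
  qed
  have damped: "cmod (F z * exp (- of_real e * (z powr (3/4)))) \<le> 2 * M"
    if rez: "Re z > 0" and e: "e > 0" for z e
  proof -
    define E where "E = (\<lambda>w::complex. exp (- of_real e * (w powr (3/4))))"
    define k where "k = e * cos (3 * pi / 8)"
    have k: "k > 0" unfolding k_def using e by (intro mult_pos_pos cos_gt_zero) auto
    have normE: "cmod (E w) \<le> exp (- k * cmod w powr (3/4))" if "Re w \<ge> 0" for w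
    proof -
      have "k * cmod w powr (3/4) \<le> e * Re (w powr (3/4))"
        using Re_powr_three_quarters[OF that] e by (simp add: k_def mult.assoc)
      thus ?thesis by (simp add: E_def norm_exp_eq_Re)
    qed
    \<comment> \<open>\<open>r powr (3/4)\<close> beats \<open>sqrt r\<close>, so the damped function is small on large circles.\<close>
    have "filterlim (\<lambda>r::real. C * exp (C * sqrt r) * 4 * exp (- k * r powr (3/4))) (nhds 0) at_top"
      using k C by real_asymp
    hence "eventually (\<lambda>r. C * exp (C * sqrt r) * 4 * exp (- k * r powr (3/4)) < 1) at_top"
      by (rule order_tendstoD(2)) simp
    moreover have "eventually (\<lambda>r::real. r > cmod z) at_top" by (rule eventually_gt_at_top)
    moreover have "eventually (\<lambda>r::real. r \<ge> 1) at_top" by (rule eventually_ge_at_top)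
    ultimately have "eventually (\<lambda>r::real. cmod (F z * E z * (1 - z\<^sup>2 / of_real (r\<^sup>2))) \<le> 2 * M) at_top"
    proof eventually_elim
      case (elim r)
      define S where "S = {w. 0 < Re w} \<inter> ball 0 r"
      define H where "H = (\<lambda>w. F w * E w * (1 - w\<^sup>2 / of_real (r\<^sup>2)))"
      have r: "r > 0" using elim by linarith
      have opS: "open S" unfolding S_def by (intro open_Int open_halfspace_Re_gt) auto
      have cl: "closure S \<subseteq> {w. 0 \<le> Re w} \<inter> cball 0 r"
        by (rule closure_minimal) (auto simp: S_def intro!: closed_Int closed_halfspace_Re_ge)
      have "H holomorphic_on interior S"
        unfolding H_def E_def using opS r
        unfolding interior_open[OF opS]
        by (auto simp: S_def complex_nonpos_Reals_iff intro!: holomorphic_intros holomorphic_on_subset[OF hol])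
      moreover have "continuous_on (closure S) H"
        unfolding H_def E_def using cl r
        by (intro continuous_intros cont continuous_on_powr_complex)
           (auto intro!: continuous_intros)
      moreover have "bounded S" unfolding S_def by (simp add: bounded_Int)
      moreover have "norm (H w) \<le> 2 * M" if "w \<in> frontier S" for w
      proof -
        have w: "w \<in> closure S" "w \<notin> S" using that opS by (auto simp: frontier_def interior_open)
        hence re: "Re w \<ge> 0" and mo: "cmod w \<le> r" using cl by auto
        have E1: "cmod (E w) \<le> 1"
          using normE[OF re] k by (smt (verit) exp_le_one_iff powr_ge_zero mult_nonneg_nonneg mult_minus_left)
        show ?thesis
        proof (cases "Re w = 0")
          case True
          have "cmod (1 - w\<^sup>2 / of_real (r\<^sup>2)) \<le> 1 + cmod (w\<^sup>2 / of_real (r\<^sup>2))"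
            by (metis norm_one norm_triangle_ineq4)
          also have "cmod (w\<^sup>2 / of_real (r\<^sup>2)) \<le> 1"
            using mo r by (simp add: norm_divide norm_power divide_simps)
          finally have "cmod (1 - w\<^sup>2 / of_real (r\<^sup>2)) \<le> 2" by simp
          moreover have "cmod (F w * E w) \<le> M * 1"
            unfolding norm_mult using leftM[of w] True E1 M1 by (intro mult_mono) auto
          ultimately have "cmod (H w) \<le> M * 1 * 2"
            unfolding H_def norm_mult[of "F w * E w"] using M1 by (intro mult_mono) auto
          thus ?thesis by simp
        next
          case False
          hence cw: "cmod w = r" using w(2) re mo by (auto simp: S_def)
          have fac: "1 - w\<^sup>2 / of_real (r\<^sup>2) = - (w\<^sup>2 - of_real (r\<^sup>2)) / of_real (r\<^sup>2)"
            using r by (simp add: field_simps)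
          have "cmod (1 - w\<^sup>2 / of_real (r\<^sup>2)) = (2 * r * \<bar>Im w\<bar>) / r\<^sup>2"
            unfolding fac norm_divide norm_minus_cancel cmod_square_minus_on_circle[OF cw]
            using r by (simp add: norm_power)
          hence c: "cmod (1 - w\<^sup>2 / of_real (r\<^sup>2)) = 2 * \<bar>Im w\<bar> / r"
            using r by (simp add: power2_eq_square field_simps)
          show ?thesis
          proof (cases "Im w = 0")
            case True
            thus ?thesis unfolding H_def norm_mult c using M1 by simp
          next
            case im: False
            have il: "\<bar>Im w\<bar> \<le> r" using abs_Im_le_cmod[of w] cw by simp
            have "cmod (F w) * (2 * \<bar>Im w\<bar> / r)
                \<le> C * exp (C * sqrt r) * (1 + 1 / \<bar>Im w\<bar>) * (2 * \<bar>Im w\<bar> / r)"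
              using growth[OF im] cw r by (intro mult_right_mono) auto
            also have "\<dots> = C * exp (C * sqrt r) * (2 * (\<bar>Im w\<bar> + 1) / r)"
              using im r by (simp add: field_simps)
            also have "\<dots> \<le> C * exp (C * sqrt r) * 4"
              using il elim C r by (intro mult_left_mono) (auto simp: field_simps)
            finally have 1: "cmod (F w) * (2 * \<bar>Im w\<bar> / r) \<le> C * exp (C * sqrt r) * 4" .
            have "cmod (H w) = cmod (F w) * (2 * \<bar>Im w\<bar> / r) * cmod (E w)"
              unfolding H_def norm_mult c by simp
            also have "\<dots> \<le> C * exp (C * sqrt r) * 4 * exp (- k * r powr (3/4))"
              using normE[OF re] cw C by (intro mult_mono[OF 1]) auto
            also have "\<dots> < 1" using elim by simp
            finally show ?thesis using M1 by simp
          qed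
        qed
      qed
      moreover have "z \<in> S" using elim rez by (auto simp: S_def)
      ultimately have "norm (H z) \<le> 2 * M" by (rule maximum_modulus_frontier)
      thus ?case by (simp add: H_def)
    qed
    moreover have "((\<lambda>r. cmod (F z * E z * (1 - z\<^sup>2 / of_real (r\<^sup>2)))) \<longlongrightarrow> cmod (F z * E z * (1 - 0))) at_top"
    proof (intro tendsto_intros)
      have "((\<lambda>r::real. cmod (z\<^sup>2) / r\<^sup>2) \<longlongrightarrow> 0) at_top" by real_asymp
      moreover have "(\<lambda>r::real. cmod (z\<^sup>2) / r\<^sup>2) = (\<lambda>r. cmod (z\<^sup>2 / of_real (r\<^sup>2)))"
        by (auto simp: norm_divide norm_power)
      ultimately show "((\<lambda>r::real. z\<^sup>2 / of_real (r\<^sup>2)) \<longlongrightarrow> 0) at_top"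
        by (simp add: tendsto_norm_zero_iff)
    qed
    ultimately have "cmod (F z * E z * (1 - 0)) \<le> 2 * M"
      by (intro tendsto_upperbound[OF _ _ trivial_limit_at_top_linorder]) auto
    thus ?thesis by (simp add: E_def)
  qed
  have right: "cmod (F z) \<le> 2 * M" if "Re z > 0" for z
  proof -
    have "((\<lambda>e. cmod (F z * exp (- of_real e * (z powr (3/4))))) \<longlongrightarrow> cmod (F z * exp (- of_real 0 * (z powr (3/4))))) (at_right 0)"
      by (intro tendsto_intros)
    hence "cmod (F z * exp (- of_real 0 * (z powr (3/4)))) \<le> 2 * M"
      by (rule tendsto_upperbound)
         (use damped[OF that] in \<open>auto simp: eventually_at_filter\<close>)
    thus ?thesis by simp
  qed
  have "cmod (F z) \<le> 2 * M" for z
    using leftM[of z] right[of z] M1 by (cases "Re z \<le> 0") auto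
  hence "bounded (range F)" by (auto simp: bounded_iff)
  then obtain c where c: "\<And>z. F z = c"
    using Liouville_theorem[OF hol] by (auto simp: constant_on_def)
  have "eventually (\<lambda>t::real. cmod c \<le> C / t) at_top"
    using eventually_ge_at_top[of C]
  proof eventually_elim
    case (elim t)
    thus ?case using left[of "- of_real t"] C by (simp add: c)
  qed
  moreover have "((\<lambda>t::real. C / t) \<longlongrightarrow> 0) at_top" by real_asymp
  ultimately have "cmod c \<le> 0"
    by (intro tendsto_lowerbound[OF _ _ trivial_limit_at_top_linorder]) auto
  thus ?thesis by (simp add: c)
qed

section \<open>Functionals and the method of continuity\<close>

text \<open>The projection theorem for an arbitrary complete inner product space: by the parallelogram law a
  minimizing sequence for the distance from \<open>x\<close> to \<open>S\<close> is Cauchy, and the difference between \<open>x\<close> and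
  its nearest point is orthogonal to \<open>S\<close>.\<close>

lemma closed_subspace_orthogonal_vector:
  fixes S :: "'a::{real_inner,complete_space} set"
  assumes sub: "subspace S" and cl: "closed S" and x: "x \<notin> S"
  obtains g where "g \<noteq> 0" "\<And>s. s \<in> S \<Longrightarrow> inner g s = 0"
proof -
  have ne: "S \<noteq> {}" using sub subspace_0 by blast
  define d where "d = infdist x S"
  have d_le: "d \<le> dist x s" if "s \<in> S" for s using that by (simp add: d_def infdist_le)
  have d0: "d \<ge> 0" by (simp add: d_def infdist_nonneg)
  have "\<exists>s\<in>S. dist x s < d + 1 / real (Suc n)" for n
  proof (rule ccontr)
    assume "\<not> ?thesis"
    hence "\<And>s. s \<in> S \<Longrightarrow> d + 1 / real (Suc n) \<le> dist x s" by force
    hence "d + 1 / real (Suc n) \<le> (INF s\<in>S. dist x s)" using ne by (intro cINF_greatest)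
    hence "d + 1 / real (Suc n) \<le> d" using ne by (simp add: d_def infdist_notempty)
    thus False by simp
  qed
  then obtain s where s: "\<And>n. s n \<in> S" and sd: "\<And>n. dist x (s n) < d + 1 / real (Suc n)" by metis
  have lim0: "(\<lambda>n. d + 1 / real (Suc n)) \<longlonglongrightarrow> d + 0"
    by (rule tendsto_add[OF tendsto_const LIMSEQ_Suc[OF lim_1_over_n]])
  have lim: "(\<lambda>n. dist x (s n)) \<longlonglongrightarrow> d"
    by (rule real_tendsto_sandwich[of "\<lambda>_. d" _ _ "\<lambda>n. d + 1 / real (Suc n)"])
       (use lim0 d_le s less_imp_le[OF sd] in \<open>auto intro: always_eventually\<close>)
  have par: "(dist (s m) (s n))\<^sup>2 \<le> 2 * (dist x (s m))\<^sup>2 + 2 * (dist x (s n))\<^sup>2 - 4 * d\<^sup>2" for m n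
  proof -
    have "(1/2) *\<^sub>R (s m + s n) \<in> S" using s sub by (simp add: subspace_add subspace_scale)
    hence "d\<^sup>2 \<le> (dist x ((1/2) *\<^sub>R (s m + s n)))\<^sup>2" using d_le d0 by (simp add: power_mono)
    moreover have "(dist (s m) (s n))\<^sup>2 = 2 * (dist x (s m))\<^sup>2 + 2 * (dist x (s n))\<^sup>2
        - 4 * (dist x ((1/2) *\<^sub>R (s m + s n)))\<^sup>2"
      by (simp add: dist_norm power2_norm_eq_inner inner_diff_left inner_diff_right inner_add_left
          inner_add_right inner_commute algebra_simps)
    ultimately show ?thesis by simp
  qed
  have "Cauchy s"
  proof (rule metric_CauchyI)
    fix e :: real assume e: "e > 0"
    have "(\<lambda>n. (dist x (s n))\<^sup>2) \<longlonglongrightarrow> d\<^sup>2" by (intro tendsto_intros lim)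
    hence "eventually (\<lambda>n. (dist x (s n))\<^sup>2 < d\<^sup>2 + e\<^sup>2 / 4) sequentially"
      by (rule order_tendstoD(2)) (use e in auto)
    then obtain N where N: "\<And>n. n \<ge> N \<Longrightarrow> (dist x (s n))\<^sup>2 < d\<^sup>2 + e\<^sup>2 / 4"
      by (auto simp: eventually_sequentially)
    have "dist (s m) (s n) < e" if "m \<ge> N" "n \<ge> N" for m n
    proof -
      have "(dist (s m) (s n))\<^sup>2 < e\<^sup>2" using par[of m n] N[OF that(1)] N[OF that(2)] by simp
      thus ?thesis using e by (simp add: power2_less_imp_less)
    qed
    thus "\<exists>M. \<forall>m\<ge>M. \<forall>n\<ge>M. dist (s m) (s n) < e" by blast
  qed
  then obtain p where p: "s \<longlonglongrightarrow> p" using Cauchy_convergent_iff convergent_def by blast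
  have pS: "p \<in> S" using closed_sequentially[OF cl] s p by blast
  have "(\<lambda>n. dist x (s n)) \<longlonglongrightarrow> dist x p" by (intro tendsto_intros p)
  hence dp: "dist x p = d" using lim LIMSEQ_unique by blast
  show ?thesis
  proof
    show "x - p \<noteq> 0" using pS x by auto
    fix v assume v: "v \<in> S"
    show "inner (x - p) v = 0"
    proof (cases "v = 0")
      case False
      define t where "t = inner (x - p) v / inner v v"
      have "p + t *\<^sub>R v \<in> S" using pS v sub by (simp add: subspace_add subspace_scale)
      hence "d\<^sup>2 \<le> (dist x (p + t *\<^sub>R v))\<^sup>2" using d_le d0 by (simp add: power_mono)
      also have "\<dots> = (dist x p)\<^sup>2 - 2 * t * inner (x - p) v + t * t * inner v v"
        by (simp add: dist_norm power2_norm_eq_inner inner_diff_left inner_diff_right inner_add_left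
          inner_add_right inner_commute algebra_simps)
      also have "\<dots> = d\<^sup>2 - (inner (x - p) v)\<^sup>2 / inner v v"
        using False by (simp add: dp t_def field_simps power2_eq_square)
      finally have "(inner (x - p) v)\<^sup>2 / inner v v \<le> 0" by simp
      thus ?thesis using False by (simp add: divide_le_0_iff) (smt (verit) inner_gt_zero_iff inner_ge_zero)
    qed simp
  qed
qed

text \<open>Solvability is carried from parameter \<open>\<theta>\<close> to \<open>\<theta> + 1 / N\<close> by a contraction on right-hand sides: with
  a right inverse \<open>R\<close> at \<open>\<theta>\<close>, the equation at the next parameter becomes the fixed point equation
  \<open>w = f - (A1 (R w) - A0 (R w)) / N\<close>. The a priori bound is uniform in \<open>\<theta>\<close>, so the same step length
  works throughout.\<close>

lemma method_of_continuity:
  fixes A0 A1 :: "'a::{real_normed_vector,complete_space} \<Rightarrow> 'a"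
  assumes diff: "\<And>u v. u \<in> Dom \<Longrightarrow> v \<in> Dom \<Longrightarrow> u - v \<in> Dom"
    and A0: "\<And>u v. u \<in> Dom \<Longrightarrow> v \<in> Dom \<Longrightarrow> A0 (u - v) = A0 u - A0 v"
    and A1: "\<And>u v. u \<in> Dom \<Longrightarrow> v \<in> Dom \<Longrightarrow> A1 (u - v) = A1 u - A1 v"
    and bound: "\<And>u \<theta>. u \<in> Dom \<Longrightarrow> 0 \<le> \<theta> \<Longrightarrow> \<theta> \<le> 1 \<Longrightarrow>
        norm (A1 u - A0 u) \<le> B * norm ((1 - \<theta>) *\<^sub>R A0 u + \<theta> *\<^sub>R A1 u)"
    and onto: "\<And>f. \<exists>u\<in>Dom. A0 u = f"
  shows "\<exists>u\<in>Dom. A1 u = f"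
proof -
  define N where "N = Suc (nat \<lceil>\<bar>B\<bar>\<rceil>)"
  have N: "\<bar>B\<bar> < real N" unfolding N_def by linarith
  define A where "A = (\<lambda>\<theta> u. (1 - \<theta>) *\<^sub>R A0 u + \<theta> *\<^sub>R A1 u)"
  have "\<forall>f. \<exists>u\<in>Dom. A (real j / real N) u = f" if "j \<le> N" for j
    using that
  proof (induction j)
    case 0 thus ?case using onto by (simp add: A_def)
  next
    case (Suc j)
    define \<theta> where "\<theta> = real j / real N"
    have \<theta>: "0 \<le> \<theta>" "\<theta> \<le> 1" using Suc.prems by (auto simp: \<theta>_def)
    have \<theta>': "real (Suc j) / real N = \<theta> + 1 / real N" by (simp add: \<theta>_def add_divide_distrib)
    obtain R where R: "\<And>f. R f \<in> Dom" "\<And>f. A \<theta> (R f) = f"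
      using Suc \<theta>_def by (metis Suc_leD)
    show ?case
    proof
      fix f
      define S where "S = (\<lambda>w. f - (1 / real N) *\<^sub>R (A1 (R w) - A0 (R w)))"
      have "\<exists>!w. w \<in> UNIV \<and> S w = w"
      proof (rule Banach_fix)
        show "complete (UNIV :: 'a set)" by (simp add: complete_UNIV)
        show "0 \<le> \<bar>B\<bar> / real N" "\<bar>B\<bar> / real N < 1" using N by auto
        fix w1 w2
        have AR: "A \<theta> (R w1 - R w2) = w1 - w2"
        proof -
          have "A \<theta> (R w1 - R w2) = A \<theta> (R w1) - A \<theta> (R w2)"
            by (simp add: A_def A0 A1 R(1) algebra_simps)
          thus ?thesis by (simp add: R(2))
        qed
        have "S w1 - S w2 = - (1 / real N) *\<^sub>R (A1 (R w1 - R w2) - A0 (R w1 - R w2))"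
          by (simp add: S_def A0 A1 R(1) algebra_simps)
        hence "dist (S w1) (S w2) = (1 / real N) * norm (A1 (R w1 - R w2) - A0 (R w1 - R w2))"
          by (simp add: dist_norm)
        also have "\<dots> \<le> (1 / real N) * (B * norm (A \<theta> (R w1 - R w2)))"
          unfolding A_def using bound[OF diff[OF R(1) R(1)] \<theta>] by (intro mult_left_mono) auto
        also have "\<dots> \<le> (1 / real N) * (\<bar>B\<bar> * dist w1 w2)"
          unfolding AR dist_norm by (intro mult_left_mono mult_right_mono) auto
        finally show "dist (S w1) (S w2) \<le> \<bar>B\<bar> / real N * dist w1 w2" by simp
      qed auto
      then obtain w where w: "S w = w" by auto
      have "A (\<theta> + 1 / real N) (R w) = A \<theta> (R w) + (1 / real N) *\<^sub>R (A1 (R w) - A0 (R w))"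
        by (simp add: A_def algebra_simps)
      also have "\<dots> = w + (f - S w)" by (simp add: R(2) S_def)
      also have "\<dots> = f" by (simp add: w)
      finally show "\<exists>u\<in>Dom. A (real (Suc j) / real N) u = f" unfolding \<theta>' using R(1) by blast
    qed
  qed
  from this[of N] have "\<forall>f. \<exists>u\<in>Dom. A (real N / real N) u = f" by simp
  moreover have "real N / real N = 1" using N by simp
  ultimately show ?thesis by (simp add: A_def)
qed

text \<open>The Hilbert space type carries a real inner product; complex scalars act by a separate operation
  that extends the real one and is compatible with the norm.\<close>

locale complex_hilbert = vector_space sc
  for sc :: "complex \<Rightarrow> 'h::{real_inner,complete_space} \<Rightarrow> 'h" (infixr "*c" 75) +
  assumes sc_of_real: "of_real r *c x = r *\<^sub>R x"
    and norm_sc: "norm (c *c x) = cmod c * norm x"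
begin

definition bounded_functional :: "('h \<Rightarrow> complex) \<Rightarrow> bool" where
  "bounded_functional \<phi> \<longleftrightarrow> (\<forall>x y. \<phi> (x + y) = \<phi> x + \<phi> y) \<and> (\<forall>c x. \<phi> (c *c x) = c * \<phi> x)
     \<and> (\<exists>K\<ge>0. \<forall>x. cmod (\<phi> x) \<le> K * norm x)"

lemma bounded_functional_diff:
  assumes "bounded_functional \<phi>" shows "\<phi> (x - y) = \<phi> x - \<phi> y"
  using assms unfolding bounded_functional_def by (metis add_diff_cancel_right' diff_add_cancel)

lemma bounded_functional_tendsto:
  assumes "bounded_functional \<phi>" and "(f \<longlongrightarrow> l) F"
  shows "((\<lambda>x. \<phi> (f x)) \<longlongrightarrow> \<phi> l) F"
proof -
  obtain K where K: "\<And>x. cmod (\<phi> x) \<le> K * norm x"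
    using assms(1) unfolding bounded_functional_def by blast
  have "((\<lambda>x. K * norm (f x - l)) \<longlongrightarrow> K * norm (l - l)) F" by (intro tendsto_intros assms)
  hence "((\<lambda>x. \<phi> (f x - l)) \<longlongrightarrow> 0) F"
    by (intro Lim_null_comparison[OF _ tendsto_eq_rhs]) (auto intro: K always_eventually)
  thus ?thesis using bounded_functional_diff[OF assms(1)] by (simp add: LIM_zero_iff)
qed

lemma bounded_bilinear_sc: "bounded_bilinear (*c)"
proof
  fix r :: real and a b
  show "(r *\<^sub>R a) *c b = r *\<^sub>R (a *c b)"
    by (simp add: scaleR_conv_of_real flip: sc_of_real scale_scale)
  show "a *c (r *\<^sub>R b) = r *\<^sub>R (a *c b)" by (simp add: mult.commute flip: sc_of_real)
  show "\<exists>K. \<forall>a b. norm (a *c b) \<le> norm a * norm b * K"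
    by (intro exI[of _ 1]) (simp add: norm_sc)
qed (auto simp: scale_left_distrib scale_right_distrib)

lemmas tendsto_sc = bounded_bilinear.tendsto[OF bounded_bilinear_sc]

text \<open>A vector \<open>g\<close> orthogonal to the closed span gives the complex functional
  \<open>y \<mapsto> \<langle>g, y\<rangle> - \<i> \<langle>g, \<i> y\<rangle>\<close>, which vanishes on \<open>E\<close> but not at \<open>g\<close>.\<close>

lemma density_by_functionals:
  assumes "\<And>\<phi>. bounded_functional \<phi> \<Longrightarrow> (\<And>e. e \<in> E \<Longrightarrow> \<phi> e = 0) \<Longrightarrow> (\<And>x. \<phi> x = 0)"
  shows "closure (span E) = UNIV"
proof (rule ccontr)
  assume "closure (span E) \<noteq> UNIV"
  then obtain x where x: "x \<notin> closure (span E)" by blast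
  have "real_vector.subspace (closure (span E))"
  proof (rule real_vector.subspaceI)
    show "0 \<in> closure (span E)" using span_zero closure_subset by blast
  next
    fix a b assume "a \<in> closure (span E)" "b \<in> closure (span E)"
    then obtain u v where "\<And>n. u n \<in> span E" "u \<longlonglongrightarrow> a" "\<And>n. v n \<in> span E" "v \<longlonglongrightarrow> b"
      unfolding closure_sequential by blast
    thus "a + b \<in> closure (span E)" unfolding closure_sequential
      by (intro exI[of _ "\<lambda>n. u n + v n"]) (auto intro: tendsto_add span_add)
  next
    fix r :: real and a assume "a \<in> closure (span E)"
    then obtain u where "\<And>n. u n \<in> span E" "u \<longlonglongrightarrow> a" unfolding closure_sequential by blast
    thus "r *\<^sub>R a \<in> closure (span E)" unfolding closure_sequential
      by (intro exI[of _ "\<lambda>n. r *\<^sub>R u n"])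
         (auto intro!: tendsto_intros intro: span_scale[where c = "of_real r", unfolded sc_of_real])
  qed
  then obtain g where g: "g \<noteq> 0" "\<And>s. s \<in> closure (span E) \<Longrightarrow> inner g s = 0"
    using closed_subspace_orthogonal_vector[OF _ closed_closure x] by blast
  define \<phi> where "\<phi> = (\<lambda>y. Complex (inner g y) (- inner g (\<i> *c y)))"
  have "bounded_functional \<phi>"
    unfolding bounded_functional_def
  proof (intro conjI allI exI[of _ "2 * norm g"])
    fix c y
    have c: "c *c y = Re c *\<^sub>R y + Im c *\<^sub>R (\<i> *c y)" for c y
    proof -
      have "c *c y = (of_real (Re c) + of_real (Im c) * \<i>) *c y" by (simp add: complex_eq_iff)
      also have "\<dots> = of_real (Re c) *c y + of_real (Im c) *c (\<i> *c y)"
        by (simp only: scale_left_distrib scale_scale)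
      finally show ?thesis by (simp only: sc_of_real)
    qed
    have ii: "\<i> *c (\<i> *c y) = - y" by simp
    have e: "\<i> *c (c *c y) = Re c *\<^sub>R (\<i> *c y) - Im c *\<^sub>R y"
      using c[of "\<i> * c" y] by (simp add: algebra_simps)
    show "\<phi> (c *c y) = c * \<phi> y"
      unfolding \<phi>_def e unfolding c[of c y]
      by (simp add: complex_eq_iff inner_add_right inner_diff_right algebra_simps)
  next
    fix y
    have "cmod (\<phi> y) \<le> \<bar>inner g y\<bar> + \<bar>inner g (\<i> *c y)\<bar>"
      using cmod_le[of "\<phi> y"] by (simp add: \<phi>_def)
    also have "\<dots> \<le> norm g * norm y + norm g * norm (\<i> *c y)"
      by (intro add_mono Cauchy_Schwarz_ineq2)
    finally show "cmod (\<phi> y) \<le> 2 * norm g * norm y" by (simp add: norm_sc)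
  qed (auto simp: \<phi>_def inner_add_right scale_right_distrib complex_eq_iff)
  moreover have "\<phi> e = 0" if "e \<in> E" for e
  proof -
    have "e \<in> closure (span E)" "\<i> *c e \<in> closure (span E)"
      using closure_subset span_base[OF that] span_scale[OF span_base[OF that]] by blast+
    thus ?thesis using g(2) by (simp add: \<phi>_def complex_eq_iff)
  qed
  ultimately have "\<phi> g = 0" using assms by blast
  thus False using g(1) by (simp add: \<phi>_def complex_eq_iff)
qed

end

section \<open>Completeness of eigenvectors for symmetrizable operators\<close>

text \<open>Turns the quadratic inequality for the norm of a resolvent vector into a bound.\<close>

lemma le_of_square_le_linear:
  fixes x P Q :: real
  assumes "x\<^sup>2 \<le> P * x + Q" "P \<ge> 0" "Q \<ge> 0"
  shows "x \<le> P + Q + 1"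
proof (rule ccontr)
  assume "\<not> ?thesis"
  hence x: "x > P + Q + 1" by simp
  have "Q * 1 \<le> Q * x" using x assms by (intro mult_left_mono) auto
  hence "P * x + Q < x * (P + Q + 1)" using x assms by (simp add: algebra_simps)
  also have "\<dots> \<le> x * x" using x assms by (intro mult_left_mono) auto
  finally show False using assms by (simp add: power2_eq_square)
qed

lemma null_sequence_by_inverse:
  fixes x :: "nat \<Rightarrow> 'a::real_normed_vector"
  assumes "\<And>n. norm (x n) \<le> 1 / real (Suc n)" shows "x \<longlonglongrightarrow> 0"
proof (rule Lim_null_comparison)
  show "\<forall>\<^sub>F n in sequentially. norm (x n) \<le> 1 / real (Suc n)" using assms by (rule always_eventually[OF allI])
  show "(\<lambda>n. 1 / real (Suc n)) \<longlonglongrightarrow> 0" by (rule LIMSEQ_Suc[OF lim_1_over_n])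
qed

text \<open>The abstract setting: a closed operator \<open>A\<close> with the compactness that makes resolvents compact,
  symmetric not for the inner product of the Hilbert space but for a second, weaker one, \<open>lip\<close>.
  In the application \<open>lip\<close> is the \<open>L\<^sup>2\<close> product on the real line and the Hilbert space is the Hardy space. Two
  quantitative properties replace self-adjointness for the strong norm: \<open>left_half_plane\<close> is a
  sectorial resolvent estimate, and \<open>growth\<close> controls the strong norm of a solution by its weak norm
  at the cost of an exponential of order \<open>1/2\<close> in the spectral parameter, for right-hand sides in a
  dense set \<open>D\<close>.\<close>

locale symmetrizable_operator = complex_hilbert sc
  for sc :: "complex \<Rightarrow> 'h::{real_inner,complete_space} \<Rightarrow> 'h" (infixr "*c" 75) +
  fixes Dom :: "'h set" and A :: "'h \<Rightarrow> 'h" and lip :: "'h \<Rightarrow> 'h \<Rightarrow> complex" and D :: "'h set"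
  assumes Dom_add: "u \<in> Dom \<Longrightarrow> v \<in> Dom \<Longrightarrow> u + v \<in> Dom"
    and Dom_sc: "u \<in> Dom \<Longrightarrow> c *c u \<in> Dom"
    and A_add: "u \<in> Dom \<Longrightarrow> v \<in> Dom \<Longrightarrow> A (u + v) = A u + A v"
    and A_sc: "u \<in> Dom \<Longrightarrow> A (c *c u) = c *c A u"
    and A_closed: "(\<And>n. U n \<in> Dom) \<Longrightarrow> U \<longlonglongrightarrow> u \<Longrightarrow> (\<lambda>n::nat. A (U n)) \<longlonglongrightarrow> h \<Longrightarrow> u \<in> Dom \<and> A u = h"
    and A_compact: "(\<And>n. U n \<in> Dom) \<Longrightarrow> bounded (range U) \<Longrightarrow> bounded (range (\<lambda>n::nat. A (U n))) \<Longrightarrow>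
        \<exists>r u. strict_mono r \<and> (\<lambda>n. U (r n)) \<longlonglongrightarrow> u"
    and lip_add: "lip (x + y) z = lip x z + lip y z"
    and lip_sc: "lip (c *c x) z = c * lip x z"
    and lip_cnj: "lip y x = cnj (lip x y)"
    and lip_pos: "x \<noteq> 0 \<Longrightarrow> Re (lip x x) > 0"
    and lip_bounded: "\<exists>K\<ge>0. \<forall>x y. cmod (lip x y) \<le> K * norm x * norm y"
    and A_sym: "u \<in> Dom \<Longrightarrow> v \<in> Dom \<Longrightarrow> lip (A u) v = lip u (A v)"
    and left_half_plane: "\<exists>C>0. \<forall>u\<in>Dom. \<forall>z. Re z \<le> 0 \<longrightarrow> C \<le> cmod z \<longrightarrow>
        cmod z * norm u \<le> C * norm (A u - z *c u)"
    and onto_far_left: "\<exists>m. \<forall>t\<ge>m. \<forall>f. \<exists>u\<in>Dom. A u + t *\<^sub>R u = f"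
    and D_dense: "closure D = UNIV" and D_Dom: "D \<subseteq> Dom"
    and growth: "f \<in> D \<Longrightarrow> \<exists>C>0. \<forall>u\<in>Dom. \<forall>z. A u - z *c u = f \<longrightarrow>
        (norm u)\<^sup>2 \<le> C * exp (C * sqrt (cmod z)) * (Re (lip u u) + 1)"
begin

definition eig :: "complex \<Rightarrow> bool" where
  "eig z \<longleftrightarrow> (\<exists>u\<in>Dom. u \<noteq> 0 \<and> A u = z *c u)"

lemma Dom_diff: "u \<in> Dom \<Longrightarrow> v \<in> Dom \<Longrightarrow> u - v \<in> Dom"
  using Dom_add[of u "(-1) *c v"] Dom_sc[of v "-1"] by simp

lemma A_diff: "u \<in> Dom \<Longrightarrow> v \<in> Dom \<Longrightarrow> A (u - v) = A u - A v"
  using A_add[of "u - v" v] Dom_diff by simp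

lemma lip_sc_right: "lip x (c *c y) = cnj c * lip x y"
  by (metis lip_sc lip_cnj complex_cnj_mult)

lemma bounded_functional_lip: "bounded_functional (\<lambda>x. lip x y)"
proof -
  obtain K where K: "K \<ge> 0" "\<And>x y. cmod (lip x y) \<le> K * norm x * norm y" using lip_bounded by blast
  show ?thesis unfolding bounded_functional_def
    using K by (auto simp: lip_add lip_sc intro!: exI[of _ "K * norm y"] simp: mult_ac)
qed

lemma lip_self_real: "lip x x = of_real (Re (lip x x))"
  using lip_cnj[of x x] by (simp add: complex_eq_iff)

lemma eig_real:
  assumes "eig z" shows "Im z = 0"
proof -
  obtain u where u: "u \<in> Dom" "u \<noteq> 0" "A u = z *c u" using assms by (auto simp: eig_def)
  have "z * lip u u = cnj z * lip u u"
    using A_sym[OF u(1) u(1)] by (simp add: u(3) lip_sc lip_sc_right)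
  moreover have "lip u u \<noteq> 0" using lip_pos[OF u(2)] by auto
  ultimately have "z = cnj z" by simp
  thus ?thesis by (simp add: complex_eq_iff)
qed

text \<open>The only use made of compactness: approximate unit eigenvectors subconverge to a unit eigenvector.\<close>

lemma unit_eigenvector_limit:
  assumes U: "\<And>n. U n \<in> Dom" and unit: "\<And>n. norm (U n) = 1"
    and z: "z \<longlonglongrightarrow> a" and res: "(\<lambda>n. A (U n) - z n *c U n) \<longlonglongrightarrow> 0"
  obtains r w where "strict_mono r" "(\<lambda>n. U (r n)) \<longlonglongrightarrow> w" "w \<in> Dom" "norm w = 1" "A w = a *c w"
proof -
  have bdd: "bounded (range z)" using z convergent_imp_bounded by blast
  have bdr: "bounded (range (\<lambda>n. A (U n) - z n *c U n))" using res convergent_imp_bounded by blast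
  obtain M1 where M1: "\<And>n. cmod (z n) \<le> M1" using bdd by (auto simp: bounded_iff)
  obtain M2 where M2: "\<And>n. norm (A (U n) - z n *c U n) \<le> M2" using bdr by (auto simp: bounded_iff)
  have "norm (A (U n)) \<le> M2 + M1" for n
  proof -
    have "norm (A (U n)) \<le> norm (A (U n) - z n *c U n) + norm (z n *c U n)"
      by (metis diff_add_cancel norm_triangle_ineq)
    thus ?thesis using M1[of n] M2[of n] by (simp add: norm_sc unit)
  qed
  hence "bounded (range (\<lambda>n. A (U n)))" by (auto simp: bounded_iff)
  moreover have "bounded (range U)" using unit by (auto simp: bounded_iff)
  ultimately obtain r w where r: "strict_mono r" and w: "(\<lambda>n. U (r n)) \<longlonglongrightarrow> w"
    using A_compact[of U] U by blast
  have zr: "(\<lambda>n. z (r n)) \<longlonglongrightarrow> a" using LIMSEQ_subseq_LIMSEQ[OF z r] by (simp add: o_def)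
  have rr: "(\<lambda>n. A (U (r n)) - z (r n) *c U (r n)) \<longlonglongrightarrow> 0"
    using LIMSEQ_subseq_LIMSEQ[OF res r] by (simp add: o_def)
  have "(\<lambda>n. (A (U (r n)) - z (r n) *c U (r n)) + z (r n) *c U (r n)) \<longlonglongrightarrow> 0 + a *c w"
    by (intro tendsto_add rr tendsto_sc zr w)
  hence "(\<lambda>n. A (U (r n))) \<longlonglongrightarrow> a *c w" by simp
  with A_closed[OF _ w this] U have "w \<in> Dom" "A w = a *c w" by auto
  moreover have "norm w = 1"
    using tendsto_norm[OF w] by (simp add: unit LIMSEQ_const_iff)
  ultimately show ?thesis using that r w by blast
qed

lemma normalize:
  assumes "u \<in> Dom" "u \<noteq> 0"
  shows "of_real (1 / norm u) *c u \<in> Dom" "norm (of_real (1 / norm u) *c u) = 1"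
    "A (of_real (1 / norm u) *c u) - z *c (of_real (1 / norm u) *c u)
      = of_real (1 / norm u) *c (A u - z *c u)"
  using assms by (simp_all add: Dom_sc norm_sc norm_divide A_sc scale_right_diff_distrib mult.commute)

text \<open>Eigenvectors for different (real) eigenvalues are orthogonal for \<open>lip\<close>. If eigenvalues accumulated
  at \<open>a\<close>, a limit \<open>w\<close> of unit eigenvectors would be an eigenvector for \<open>a\<close> orthogonal to all of them,
  hence to itself.\<close>

lemma eig_isolated: "\<exists>e>0. \<forall>z\<in>ball a e. z \<noteq> a \<longrightarrow> \<not> eig z"
proof (rule ccontr)
  assume "\<not> ?thesis"
  hence "\<forall>n. \<exists>z. z \<in> ball a (1 / real (Suc n)) \<and> z \<noteq> a \<and> eig z"
    by (metis of_nat_0_less_iff zero_less_Suc zero_less_divide_1_iff)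
  then obtain z where z: "\<And>n. dist a (z n) < 1 / real (Suc n)" "\<And>n. z n \<noteq> a" "\<And>n. eig (z n)"
    by (metis mem_ball)
  have "\<forall>n. \<exists>u. u \<in> Dom \<and> norm u = 1 \<and> A u - z n *c u = 0"
    using z(3) normalize unfolding eig_def by (metis eq_iff_diff_eq_0 scale_zero_right)
  then obtain U where U: "\<And>n. U n \<in> Dom" "\<And>n. norm (U n) = 1" "\<And>n. A (U n) - z n *c U n = 0"
    by metis
  have "(\<lambda>n. z n - a) \<longlonglongrightarrow> 0"
    by (rule null_sequence_by_inverse) (metis dist_norm dist_commute less_imp_le z(1))
  hence za: "z \<longlonglongrightarrow> a" by (simp only: LIM_zero_iff)
  have "(\<lambda>n. A (U n) - z n *c U n) \<longlonglongrightarrow> 0" by (simp only: U(3) tendsto_const)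
  then obtain r w where r: "strict_mono r"
    and w: "(\<lambda>n. U (r n)) \<longlonglongrightarrow> w" "w \<in> Dom" "norm w = 1" "A w = a *c w"
    using unit_eigenvector_limit[of U z a] U(1,2) za by blast
  have w0: "w \<noteq> 0" using w(3) by auto
  have "Im a = 0" using eig_real w w0 unfolding eig_def by blast
  hence ca: "cnj a = a" by (simp add: complex_eq_iff)
  have "lip (U n) w = 0" for n
  proof -
    have "z n * lip (U n) w = a * lip (U n) w"
      using A_sym[OF U(1)[of n] w(2)] U(3)[of n] by (simp add: w(4) lip_sc lip_sc_right ca)
    thus ?thesis using z(2)[of n] by simp
  qed
  hence "lip w w = 0"
    using bounded_functional_tendsto[OF bounded_functional_lip w(1), of w] by (simp add: LIMSEQ_const_iff)
  thus False using lip_pos[OF w0] by simp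
qed

text \<open>Otherwise normalized counterexamples would subconverge to an eigenvector for a point of \<open>K\<close>.\<close>

lemma resolvent_bound:
  assumes K: "compact K" and noeig: "\<And>z. z \<in> K \<Longrightarrow> \<not> eig z"
  shows "\<exists>C>0. \<forall>z\<in>K. \<forall>u\<in>Dom. norm u \<le> C * norm (A u - z *c u)"
proof (rule ccontr)
  assume "\<not> ?thesis"
  hence "\<forall>n. \<exists>z u. z \<in> K \<and> u \<in> Dom \<and> norm u > real (Suc n) * norm (A u - z *c u)"
    by (metis linorder_not_less of_nat_0_less_iff zero_less_Suc)
  then obtain z v where zv: "\<And>n. z n \<in> K" "\<And>n. v n \<in> Dom"
      "\<And>n. norm (v n) > real (Suc n) * norm (A (v n) - z n *c v n)" by metis
  have v0: "v n \<noteq> 0" for n using zv(3)[of n]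
    by (metis norm_zero norm_ge_zero mult_nonneg_nonneg of_nat_0_le_iff linorder_not_less)
  define U where "U = (\<lambda>n. of_real (1 / norm (v n)) *c v n)"
  have U: "U n \<in> Dom" "norm (U n) = 1" for n
    unfolding U_def by (rule normalize[OF zv(2) v0])+
  have small: "norm (A (U n) - z n *c U n) \<le> 1 / real (Suc n)" for n
  proof -
    have eq: "norm (A (U n) - z n *c U n) = norm (A (v n) - z n *c v n) / norm (v n)"
      unfolding U_def normalize(3)[OF zv(2) v0] by (simp add: norm_sc norm_divide)
    have "norm (A (v n) - z n *c v n) * real (Suc n) \<le> norm (v n)"
      using zv(3)[of n] by (simp add: mult.commute less_imp_le)
    thus ?thesis unfolding eq using v0[of n] by (simp add: divide_simps del: of_nat_Suc)
  qed
  obtain a r where a: "a \<in> K" "strict_mono r" "(z \<circ> r) \<longlonglongrightarrow> a"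
    using K zv(1) unfolding compact_def by blast
  have s: "(\<lambda>n. A (U n) - z n *c U n) \<longlonglongrightarrow> 0"
    by (rule null_sequence_by_inverse) (rule small)
  have s': "(\<lambda>n. A ((U \<circ> r) n) - (z \<circ> r) n *c (U \<circ> r) n) \<longlonglongrightarrow> 0"
    using LIMSEQ_subseq_LIMSEQ[OF s a(2)] by (simp add: o_def)
  obtain w where "w \<in> Dom" "norm w = 1" "A w = a *c w"
    using unit_eigenvector_limit[of "U \<circ> r", OF _ _ a(3) s'] U by (metis comp_apply)
  hence "eig a" unfolding eig_def by (intro bexI[of _ w]) auto
  thus False using noeig a(1) by blast
qed

definition onto :: "complex \<Rightarrow> bool" where
  "onto z \<longleftrightarrow> (\<forall>f. \<exists>u\<in>Dom. A u - z *c u = f)"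

lemma onto_along_segment:
  assumes on: "onto z0" and noeig: "\<And>z. z \<in> closed_segment z0 z1 \<Longrightarrow> \<not> eig z"
  shows "onto z1"
proof -
  obtain C where C: "C > 0" "\<And>z u. z \<in> closed_segment z0 z1 \<Longrightarrow> u \<in> Dom \<Longrightarrow> norm u \<le> C * norm (A u - z *c u)"
    using resolvent_bound[OF compact_segment noeig] by blast
  have "\<exists>u\<in>Dom. (A u - z1 *c u) = f" for f
  proof (rule method_of_continuity[where ?A0.0 = "\<lambda>u. A u - z0 *c u" and B = "cmod (z0 - z1) * C"])
    fix u \<theta> assume u: "u \<in> Dom" and \<theta>: "0 \<le> \<theta>" "\<theta> \<le> (1::real)"
    define z where "z = (1 - \<theta>) *\<^sub>R z0 + \<theta> *\<^sub>R z1"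
    have z: "z \<in> closed_segment z0 z1" using \<theta> by (auto simp: closed_segment_def z_def)
    have eq: "(1 - \<theta>) *\<^sub>R (A u - z0 *c u) + \<theta> *\<^sub>R (A u - z1 *c u) = A u - z *c u"
      by (simp add: z_def scaleR_conv_of_real scale_left_distrib scale_left_diff_distrib scale_right_diff_distrib
          algebra_simps flip: sc_of_real)
    have "norm (A u - z1 *c u - (A u - z0 *c u)) = cmod (z0 - z1) * norm u"
      by (simp add: scale_left_diff_distrib flip: norm_sc)
    also have "\<dots> \<le> cmod (z0 - z1) * (C * norm (A u - z *c u))"
      using C(2)[OF z u] by (intro mult_left_mono) auto
    finally show "norm (A u - z1 *c u - (A u - z0 *c u)) \<le> cmod (z0 - z1) * C *
         norm ((1 - \<theta>) *\<^sub>R (A u - z0 *c u) + \<theta> *\<^sub>R (A u - z1 *c u))"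
      unfolding eq by (simp add: mult.assoc)
  qed (use on in \<open>auto simp: onto_def Dom_diff A_diff scale_right_diff_distrib\<close>)
  thus ?thesis by (simp add: onto_def)
qed

text \<open>Surjectivity is known at points far to the left. It is transported first vertically along
  \<open>Re z = - t\<close>, where the sectorial estimate excludes eigenvalues, and then along a straight segment to
  \<open>z\<close> that avoids the real axis except possibly at \<open>z\<close>; eigenvalues are real.\<close>

lemma onto_if_not_eig:
  assumes "\<not> eig z" shows "onto z"
proof -
  obtain C where C: "C > 0" "\<And>u z. u \<in> Dom \<Longrightarrow> Re z \<le> 0 \<Longrightarrow> C \<le> cmod z \<Longrightarrow>
      cmod z * norm u \<le> C * norm (A u - z *c u)" using left_half_plane by blast
  obtain m where m: "\<And>t f. t \<ge> m \<Longrightarrow> \<exists>u\<in>Dom. A u + t *\<^sub>R u = f" using onto_far_left by blast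
  define t where "t = max m C"
  have far: "\<not> eig z" if "Re z \<le> 0" "C \<le> cmod z" for z
    using C(2)[OF _ that] C(1) that unfolding eig_def by (fastforce simp: mult_le_0_iff)
  have "onto (- of_real t)" unfolding onto_def using m[of t] by (simp add: t_def sc_of_real)
  hence o1: "onto (Complex (- t) y)" for y
  proof (rule onto_along_segment)
    fix w assume "w \<in> closed_segment (- of_real t) (Complex (- t) y)"
    then obtain s where "w = (1 - s) *\<^sub>R (- of_real t) + s *\<^sub>R Complex (- t) y"
      by (auto simp: closed_segment_def)
    hence "Re w = (1 - s) * (- t) + s * (- t)" by simp
    hence "Re w = - t" by (simp add: algebra_simps)
    thus "\<not> eig w" using far[of w] abs_Re_le_cmod[of w] C(1) by (auto simp: t_def)
  qed
  \<comment> \<open>Approach \<open>z\<close> from its own side of the real axis.\<close>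
  define y where "y = (if Im z < 0 then -1 else (1::real))"
  from o1 show ?thesis
  proof (rule onto_along_segment[where ?z0.0 = "Complex (- t) y"])
    fix w assume "w \<in> closed_segment (Complex (- t) y) z"
    then obtain s where s: "0 \<le> s" "s \<le> 1" and w: "w = (1 - s) *\<^sub>R Complex (- t) y + s *\<^sub>R z"
      by (auto simp: closed_segment_def)
    show "\<not> eig w"
    proof (cases "s = 1")
      case True thus ?thesis using assms w by simp
    next
      case False
      have im: "Im w = (1 - s) * y + s * Im z" by (simp add: w)
      have "Im w \<noteq> 0"
      proof (cases "Im z < 0")
        case True
        have "(1 - s) * y < 0" "s * Im z \<le> 0" using True s False by (auto simp: y_def mult_le_0_iff)
        thus ?thesis unfolding im by linarith
      next
        case F: False
        have "(1 - s) * y > 0" "s * Im z \<ge> 0" using F s False by (auto simp: y_def)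
        thus ?thesis unfolding im by linarith
      qed
      thus ?thesis using eig_real by blast
    qed
  qed
qed

definition resolvent :: "complex \<Rightarrow> 'h \<Rightarrow> 'h" where
  "resolvent z f = (SOME u. u \<in> Dom \<and> A u - z *c u = f)"

lemma resolvent:
  assumes "\<not> eig z"
  shows "resolvent z f \<in> Dom" "A (resolvent z f) - z *c resolvent z f = f"
proof -
  have "\<exists>u. u \<in> Dom \<and> A u - z *c u = f" using onto_if_not_eig[OF assms] by (auto simp: onto_def)
  from someI_ex[OF this] show "resolvent z f \<in> Dom" "A (resolvent z f) - z *c resolvent z f = f"
    by (auto simp: resolvent_def)
qed

lemma resolvent_unique:
  assumes "\<not> eig z" "u \<in> Dom" "A u - z *c u = f"
  shows "u = resolvent z f"
proof (rule ccontr)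
  assume ne: "u \<noteq> resolvent z f"
  let ?d = "u - resolvent z f"
  have "A ?d - z *c ?d = 0"
    using resolvent[OF assms(1)] assms by (simp add: A_diff scale_right_diff_distrib algebra_simps)
  hence "eig z" unfolding eig_def using ne assms resolvent(1)[OF assms(1)]
    by (intro bexI[of _ ?d]) (auto simp: Dom_diff)
  thus False using assms by blast
qed

lemma resolvent_add: "\<not> eig z \<Longrightarrow> resolvent z (f + g) = resolvent z f + resolvent z g"
  by (rule resolvent_unique[symmetric])
     (auto simp: resolvent Dom_add A_add scale_right_distrib add_diff_add)

lemma resolvent_sc: "\<not> eig z \<Longrightarrow> resolvent z (c *c f) = c *c resolvent z f"
  using arg_cong[OF resolvent(2)[of z f], of "\<lambda>x. c *c x"]
  by (intro resolvent_unique[symmetric])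
     (auto simp: resolvent(1) Dom_sc A_sc scale_right_diff_distrib mult.commute)

lemma resolvent_norm:
  assumes "\<not> eig z" shows "\<exists>C>0. \<forall>f. norm (resolvent z f) \<le> C * norm f"
proof -
  obtain C where "C > 0" "\<And>u. u \<in> Dom \<Longrightarrow> norm u \<le> C * norm (A u - z *c u)"
    using resolvent_bound[of "{z}"] assms by auto
  thus ?thesis using resolvent[OF assms] by metis
qed

lemma functional_resolvent:
  assumes "bounded_functional \<phi>" "\<not> eig z"
  shows "bounded_functional (\<lambda>f. \<phi> (resolvent z f))"
proof -
  obtain C where C: "C > 0" "\<And>f. norm (resolvent z f) \<le> C * norm f"
    using resolvent_norm[OF assms(2)] by blast
  obtain K where K: "K \<ge> 0" "\<And>x. cmod (\<phi> x) \<le> K * norm x"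
    using assms(1) unfolding bounded_functional_def by blast
  have "cmod (\<phi> (resolvent z f)) \<le> K * C * norm f" for f
  proof -
    have "cmod (\<phi> (resolvent z f)) \<le> K * norm (resolvent z f)" by (rule K)
    also have "\<dots> \<le> K * (C * norm f)" using C K by (intro mult_left_mono) auto
    finally show ?thesis by (simp add: mult.assoc)
  qed
  thus ?thesis using assms C K unfolding bounded_functional_def
    by (auto simp: resolvent_add resolvent_sc intro!: exI[of _ "K * C"])
qed

text \<open>By the resolvent identity, with the local bound on the resolvent from \<open>resolvent_bound\<close>.\<close>

lemma resolvent_holomorphic:
  assumes \<phi>: "bounded_functional \<phi>" and z: "\<not> eig z"
  shows "((\<lambda>z. \<phi> (resolvent z f)) has_field_derivative \<phi> (resolvent z (resolvent z f))) (at z)"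
proof -
  obtain e where e: "e > 0" "\<And>w. w \<in> ball z e \<Longrightarrow> w \<noteq> z \<Longrightarrow> \<not> eig w" using eig_isolated by blast
  have noeig: "\<not> eig w" if "w \<in> cball z (e/2)" for w using e that z by (cases "w = z") auto
  obtain C where C: "C > 0" "\<And>w u. w \<in> cball z (e/2) \<Longrightarrow> u \<in> Dom \<Longrightarrow> norm u \<le> C * norm (A u - w *c u)"
    using resolvent_bound[OF compact_cball noeig] by blast
  have bd: "norm (resolvent w g) \<le> C * norm g" if "w \<in> cball z (e/2)" for w g
    using C(2)[OF that, of "resolvent w g"] resolvent[OF noeig[OF that]] by simp
  have id: "resolvent w f - resolvent z f = (w - z) *c resolvent z (resolvent w f)" if "w \<in> cball z (e/2)" for w
  proof -
    note w = resolvent[OF noeig[OF that]]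
    have "resolvent w f - resolvent z f = resolvent z ((w - z) *c resolvent w f)"
    proof (rule resolvent_unique[OF z])
      show "resolvent w f - resolvent z f \<in> Dom" by (simp add: Dom_diff w resolvent[OF z])
      have "A (resolvent w f - resolvent z f) - z *c (resolvent w f - resolvent z f)
        = (A (resolvent w f) - w *c resolvent w f) - (A (resolvent z f) - z *c resolvent z f) + (w - z) *c resolvent w f"
        by (simp add: A_diff w(1) resolvent(1)[OF z] algebra_simps)
      thus "A (resolvent w f - resolvent z f) - z *c (resolvent w f - resolvent z f) = (w - z) *c resolvent w f"
        by (simp add: w(2) resolvent(2)[OF z])
    qed
    thus ?thesis by (simp add: resolvent_sc[OF z])
  qed
  have ev: "\<forall>\<^sub>F w in at z. w \<in> cball z (e/2) \<and> w \<noteq> z"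
    unfolding eventually_at using e by (intro exI[of _ "e/2"]) (auto simp: dist_commute)
  have lim0: "((\<lambda>w. resolvent w f - resolvent z f) \<longlongrightarrow> 0) (at z)"
  proof (rule Lim_null_comparison)
    show "\<forall>\<^sub>F w in at z. norm (resolvent w f - resolvent z f) \<le> cmod (w - z) * (C * (C * norm f))"
      using ev
    proof eventually_elim
      case (elim w)
      have "norm (resolvent z (resolvent w f)) \<le> C * norm (resolvent w f)" using bd e(1) by simp
      also have "\<dots> \<le> C * (C * norm f)" using bd elim C(1) by simp
      finally have "cmod (w - z) * norm (resolvent z (resolvent w f)) \<le> cmod (w - z) * (C * (C * norm f))"
        by (intro mult_left_mono) auto
      thus ?case using id elim by (simp add: norm_sc)
    qed
    show "((\<lambda>w. cmod (w - z) * (C * (C * norm f))) \<longlongrightarrow> 0) (at z)"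
      by (intro tendsto_mult_left_zero tendsto_norm_zero LIM_zero tendsto_ident_at)
  qed
  hence "((\<lambda>w. resolvent w f) \<longlongrightarrow> resolvent z f) (at z)" by (simp add: LIM_zero_iff)
  hence "((\<lambda>w. \<phi> (resolvent z (resolvent w f))) \<longlongrightarrow> \<phi> (resolvent z (resolvent z f))) (at z)"
    by (rule bounded_functional_tendsto[OF functional_resolvent[OF \<phi> z]])
  moreover have "\<forall>\<^sub>F w in at z. \<phi> (resolvent z (resolvent w f)) =
      (\<phi> (resolvent w f) - \<phi> (resolvent z f)) / (w - z)"
    using ev
  proof eventually_elim
    case (elim w)
    have "\<phi> (resolvent w f) - \<phi> (resolvent z f) = (w - z) * \<phi> (resolvent z (resolvent w f))"
      using id elim \<phi> bounded_functional_diff[OF \<phi>, symmetric] unfolding bounded_functional_def by simp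
    thus ?case using elim by simp
  qed
  ultimately show ?thesis unfolding has_field_derivative_iff by (rule Lim_transform_eventually)
qed

lemma lip_diff: "lip (x - y) z = lip x z - lip y z"
  using lip_add[of "x - y" y z] by simp

text \<open>The resolvent has a simple pole at an eigenvalue \<open>a\<close>, and its residue maps into the eigenspace, where
  \<open>\<phi>\<close> vanishes. Without Laurent expansions: if the limit failed, the normalized vectors
  \<open>U n = resolvent (z n) f / norm \<dots>\<close> would converge along a subsequence to an eigenvector \<open>w\<close>.
  Pairing the equation with \<open>w\<close> shows that \<open>norm (v n) * cmod (z n - a)\<close> tends to
  \<open>cmod (lip f w) / cmod (lip w w)\<close>, so the product in question behaves like a constant times
  \<open>\<phi> (U n)\<close>, which tends to \<open>\<phi> w = 0\<close>.\<close>

lemma resolvent_pole_removable: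
  assumes \<phi>: "bounded_functional \<phi>" and van: "\<And>u. u \<in> Dom \<Longrightarrow> A u = a *c u \<Longrightarrow> \<phi> u = 0"
  shows "((\<lambda>z. (z - a) * \<phi> (resolvent z f)) \<longlongrightarrow> 0) (at a)"
proof (rule ccontr)
  assume "\<not> ?thesis"
  then obtain e where e: "e > 0"
    and freq: "\<And>d. d > 0 \<Longrightarrow> \<exists>z. z \<noteq> a \<and> dist z a < d \<and> \<not> cmod ((z - a) * \<phi> (resolvent z f)) < e"
    unfolding Lim_at by auto
  obtain e' where e': "e' > 0" "\<And>z. z \<in> ball a e' \<Longrightarrow> z \<noteq> a \<Longrightarrow> \<not> eig z" using eig_isolated by blast
  obtain K where K: "K \<ge> 0" "\<And>x. cmod (\<phi> x) \<le> K * norm x"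
    using \<phi> unfolding bounded_functional_def by blast
  have "\<exists>z. z \<noteq> a \<and> dist z a < min e' (1 / real (Suc n)) \<and> \<not> cmod ((z - a) * \<phi> (resolvent z f)) < e" for n
    using e' by (intro freq) auto
  then obtain z where z: "\<And>n. z n \<noteq> a" "\<And>n. dist (z n) a < min e' (1 / real (Suc n))"
      "\<And>n. \<not> cmod ((z n - a) * \<phi> (resolvent (z n) f)) < e" by metis
  have noeig: "\<not> eig (z n)" for n using z(1,2)[of n] e'(2)[of "z n"] by (auto simp: dist_commute)
  have "norm (z n - a) \<le> 1 / real (Suc n)" for n using z(2)[of n] by (simp add: dist_norm)
  hence "(\<lambda>n. z n - a) \<longlonglongrightarrow> 0" by (rule null_sequence_by_inverse)
  hence za: "z \<longlonglongrightarrow> a" by (simp only: LIM_zero_iff)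
  define v where "v = (\<lambda>n. resolvent (z n) f)"
  have v: "v n \<in> Dom" "A (v n) - z n *c v n = f" for n
    unfolding v_def by (rule resolvent[OF noeig])+
  have big: "e \<le> cmod (z n - a) * cmod (\<phi> (v n))" for n
    using z(3)[of n] by (simp add: v_def norm_mult not_less)
  have v0: "v n \<noteq> 0" for n using big[of n] e \<phi> unfolding bounded_functional_def
    by (metis K(2) mult_zero_right norm_le_zero_iff norm_zero not_le)
  define U where "U = (\<lambda>n. of_real (1 / norm (v n)) *c v n)"
  have U: "U n \<in> Dom" "norm (U n) = 1" for n
    unfolding U_def by (rule normalize[OF v(1) v0])+
  have AU: "A (U n) - z n *c U n = of_real (1 / norm (v n)) *c f" for n
    unfolding U_def normalize(3)[OF v(1) v0] v(2) by simp
  have \<phi>U: "\<phi> (U n) = of_real (1 / norm (v n)) * \<phi> (v n)" for n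
    using \<phi> by (simp add: U_def bounded_functional_def)
  have inv: "1 / norm (v n) \<le> cmod (z n - a) * K / e" for n
  proof -
    have "e \<le> cmod (z n - a) * (K * norm (v n))"
      using big[of n] K(2)[of "v n"] by (meson mult_left_mono norm_ge_zero order_trans)
    thus ?thesis using v0[of n] e by (simp add: field_simps)
  qed
  have "(\<lambda>n. of_real (1 / norm (v n)) *c f) \<longlonglongrightarrow> 0"
  proof (rule Lim_null_comparison)
    show "\<forall>\<^sub>F n in sequentially. norm (of_real (1 / norm (v n)) *c f) \<le> cmod (z n - a) * K / e * norm f"
      using inv by (intro always_eventually allI) (simp only: norm_sc norm_of_real, metis abs_of_nonneg
          mult_right_mono norm_ge_zero zero_le_divide_1_iff)
    have "(\<lambda>n. cmod (z n - a) * K / e * norm f) \<longlonglongrightarrow> cmod (a - a) * K / e * norm f"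
      by (intro tendsto_intros za) (use e in auto)
    thus "(\<lambda>n. cmod (z n - a) * K / e * norm f) \<longlonglongrightarrow> 0" by simp
  qed
  hence res: "(\<lambda>n. A (U n) - z n *c U n) \<longlonglongrightarrow> 0" by (simp only: AU)
  obtain r w where r: "strict_mono r" and w: "(\<lambda>n. U (r n)) \<longlonglongrightarrow> w" "w \<in> Dom" "norm w = 1" "A w = a *c w"
    using unit_eigenvector_limit[of U z a] U za res by blast
  have w0: "w \<noteq> 0" using w(3) by auto
  have "Im a = 0" using eig_real w w0 unfolding eig_def by blast
  hence ca: "cnj a = a" by (simp add: complex_eq_iff)
  have key: "e * cmod (lip (U n) w) \<le> cmod (lip f w) * cmod (\<phi> (U n))" for n
  proof -
    have "lip (A (U n) - z n *c U n) w = (a - z n) * lip (U n) w"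
      using A_sym[OF U(1)[of n] w(2)]
      by (simp add: lip_diff w(4) lip_sc lip_sc_right ca algebra_simps)
    hence "of_real (1 / norm (v n)) * lip f w = (a - z n) * lip (U n) w"
      by (simp only: AU lip_sc)
    hence "cmod (of_real (1 / norm (v n)) * lip f w) = cmod ((a - z n) * lip (U n) w)" by simp
    hence "cmod (lip f w) / norm (v n) = cmod (a - z n) * cmod (lip (U n) w)"
      by (simp only: norm_mult norm_of_real) simp
    hence eq: "cmod (lip f w) = norm (v n) * cmod (z n - a) * cmod (lip (U n) w)"
      using v0[of n] by (simp add: norm_minus_commute divide_eq_eq mult_ac)
    have "cmod (\<phi> (v n)) = norm (v n) * cmod (\<phi> (U n))"
      using v0[of n] by (simp add: \<phi>U norm_mult norm_divide)
    hence "e * cmod (lip (U n) w) \<le> (cmod (z n - a) * (norm (v n) * cmod (\<phi> (U n)))) * cmod (lip (U n) w)"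
      using big[of n] by (intro mult_right_mono) auto
    thus ?thesis by (simp add: eq mult_ac)
  qed
  have "(\<lambda>n. e * cmod (lip (U (r n)) w)) \<longlonglongrightarrow> e * cmod (lip w w)"
    by (intro tendsto_mult tendsto_const tendsto_norm bounded_functional_tendsto[OF bounded_functional_lip] w)
  moreover have "(\<lambda>n. cmod (lip f w) * cmod (\<phi> (U (r n)))) \<longlonglongrightarrow> cmod (lip f w) * cmod (\<phi> w)"
    by (intro tendsto_mult tendsto_const tendsto_norm bounded_functional_tendsto[OF \<phi>] w)
  ultimately have "e * cmod (lip w w) \<le> cmod (lip f w) * cmod (\<phi> w)"
    by (rule LIMSEQ_le) (use key in auto)
  moreover have "\<phi> w = 0" using van w by blast
  ultimately have "cmod (lip w w) \<le> 0" using e by (simp add: mult_le_0_iff)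
  thus False using lip_pos[OF w0] by auto
qed

text \<open>Riemann's removable singularity theorem at each of the isolated eigenvalues.\<close>

lemma entire_extension:
  fixes F :: "complex \<Rightarrow> complex"
  assumes hol: "\<And>z. \<not> eig z \<Longrightarrow> F field_differentiable (at z)"
    and pole: "\<And>a. eig a \<Longrightarrow> ((\<lambda>z. (z - a) * F z) \<longlongrightarrow> 0) (at a)"
  obtains E where "E holomorphic_on UNIV" "\<And>z. \<not> eig z \<Longrightarrow> E z = F z"
proof
  define E where "E = (\<lambda>z. if eig z then Lim (at z) F else F z)"
  show "E z = F z" if "\<not> eig z" for z using that by (simp add: E_def)
  have "E field_differentiable (at a)" for a
  proof -
    obtain e where e: "e > 0" "\<And>z. z \<in> ball a e \<Longrightarrow> z \<noteq> a \<Longrightarrow> \<not> eig z" using eig_isolated by blast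
    have holF: "F holomorphic_on ball a e - {a}"
      unfolding holomorphic_on_def using e hol by (blast intro: field_differentiable_at_within)
    obtain g where g: "g holomorphic_on ball a e" "\<And>z. z \<in> ball a e \<Longrightarrow> z \<noteq> a \<Longrightarrow> g z = F z"
    proof (cases "eig a")
      case True
      thus ?thesis using holomorphic_on_extend_lim[OF holF] pole e(1) that by (auto simp: interior_open)
    next
      case False
      hence "F holomorphic_on ball a e" unfolding holomorphic_on_def using e hol
        by (metis field_differentiable_at_within)
      thus ?thesis using that by blast
    qed
    have "E z = g z" if z: "z \<in> ball a e" for z
    proof (cases "z = a")
      case True
      have "isCont g a" using g(1) e(1)
        by (metis holomorphic_on_imp_continuous_on continuous_on_eq_continuous_at open_ball centre_in_ball)
      hence "(g \<longlongrightarrow> g a) (at a)" by (simp add: isCont_def)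
      moreover have "eventually (\<lambda>z. g z = F z) (at a)"
        unfolding eventually_at using e(1) g(2) by (intro exI[of _ e]) (auto simp: dist_commute)
      ultimately have lim: "(F \<longlongrightarrow> g a) (at a)" by (rule Lim_transform_eventually)
      show ?thesis
      proof (cases "eig a")
        case True thus ?thesis using lim \<open>z = a\<close> by (simp add: E_def tendsto_Lim)
      next
        case False
        hence "isCont F a" using hol field_differentiable_imp_continuous_at by blast
        hence "(F \<longlongrightarrow> F a) (at a)" by (simp add: isCont_def)
        thus ?thesis using lim \<open>z = a\<close> False LIM_unique by (simp add: E_def) blast
      qed
    next
      case False thus ?thesis using z e g by (simp add: E_def)
    qed
    hence "E holomorphic_on ball a e" by (intro holomorphic_transform[OF g(1)]) simp
    thus ?thesis using e(1) by (auto simp: holomorphic_on_open field_differentiable_def)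
  qed
  thus "E holomorphic_on UNIV" by (simp add: holomorphic_on_def field_differentiable_at_within)
qed

text \<open>The function \<open>z \<mapsto> \<phi> (resolvent z f)\<close> extends to an entire function. Since \<open>lip (A u) u\<close> is real, the
  weak norm of \<open>u = resolvent z f\<close> satisfies \<open>\<bar>Im z\<bar> * lip u u \<le> cmod (lip f u)\<close>; together with \<open>growth\<close>
  this is a quadratic inequality for \<open>norm u\<close>, which yields the growth required by the
  Phragmen-Lindelof lemma. The decay to the left is \<open>left_half_plane\<close>.\<close>

lemma resolvent_functional_vanishes:
  assumes \<phi>: "bounded_functional \<phi>" and van: "\<And>z u. u \<in> Dom \<Longrightarrow> A u = z *c u \<Longrightarrow> \<phi> u = 0"
    and f: "f \<in> D" and z: "\<not> eig z"
  shows "\<phi> (resolvent z f) = 0"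
proof -
  obtain K where K: "K \<ge> 0" "\<And>x. cmod (\<phi> x) \<le> K * norm x"
    using \<phi> unfolding bounded_functional_def by blast
  obtain B where B: "B \<ge> 0" "\<And>x y. cmod (lip x y) \<le> B * norm x * norm y" using lip_bounded by blast
  obtain C1 where C1: "C1 > 0" "\<And>u z. u \<in> Dom \<Longrightarrow> A u - z *c u = f \<Longrightarrow>
        (norm u)\<^sup>2 \<le> C1 * exp (C1 * sqrt (cmod z)) * (Re (lip u u) + 1)" using growth[OF f] by blast
  obtain C2 where C2: "C2 > 0" "\<And>u z. u \<in> Dom \<Longrightarrow> Re z \<le> 0 \<Longrightarrow> C2 \<le> cmod z \<Longrightarrow>
      cmod z * norm u \<le> C2 * norm (A u - z *c u)" using left_half_plane by blast
  obtain E where E: "E holomorphic_on UNIV" "\<And>z. \<not> eig z \<Longrightarrow> E z = \<phi> (resolvent z f)"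
  proof (rule entire_extension[of "\<lambda>z. \<phi> (resolvent z f)"])
    show "(\<lambda>z. \<phi> (resolvent z f)) field_differentiable at z" if "\<not> eig z" for z
      using resolvent_holomorphic[OF \<phi> that] field_differentiable_def by blast
    show "((\<lambda>z. (z - a) * \<phi> (resolvent z f)) \<longlongrightarrow> 0) (at a)" for a
      using resolvent_pole_removable[OF \<phi>] van by blast
  qed blast
  define C3 where "C3 = K * (C1 * B * norm f + C1 + 1)"
  define C where "C = max (max C1 C2) (max C3 (K * C2 * norm f))"
  have C: "C1 \<le> C" "C2 \<le> C" "C3 \<le> C" "K * C2 * norm f \<le> C" by (auto simp: C_def)
  have noreal: "\<not> eig z" if "Im z \<noteq> 0" for z using that eig_real by blast
  have "E z = 0"
  proof (rule Phragmen_Lindelof_vanishing[OF E(1), of C])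
    show "C > 0" using C C1 by linarith
  next
    fix z :: complex assume im: "Im z \<noteq> 0"
    define u where "u = resolvent z f"
    have u: "u \<in> Dom" "A u - z *c u = f" unfolding u_def by (rule resolvent[OF noreal[OF im]])+
    define l where "l = Re (lip u u)"
    have real: "lip (A u) u \<in> \<real>"
      using A_sym[OF u(1) u(1)] lip_cnj[of u "A u"] by (simp add: complex_is_Real_iff complex_eq_iff)
    have "lip f u = lip (A u) u - z * lip u u"
      unfolding u(2)[symmetric] by (simp add: lip_diff lip_sc)
    also have "lip u u = of_real l" unfolding l_def by (rule lip_self_real)
    finally have "Im (lip f u) = - Im z * l" using real by (simp add: complex_is_Real_iff)
    hence "\<bar>Im z\<bar> * l \<le> \<bar>Im (lip f u)\<bar>"
      by (simp add: abs_mult) (metis abs_ge_self abs_ge_zero mult_left_mono)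
    also have "\<dots> \<le> B * norm f * norm u" using abs_Im_le_cmod B(2) order_trans by blast
    finally have l: "l \<le> B * norm f * norm u / \<bar>Im z\<bar>" using im by (simp add: field_simps)
    define X where "X = exp (C1 * sqrt (cmod z))"
    have X1: "X \<ge> 1" using C1(1) by (simp add: X_def)
    have "(norm u)\<^sup>2 \<le> C1 * X * (l + 1)" using C1(2)[OF u] by (simp add: X_def l_def)
    also have "\<dots> \<le> C1 * X * (B * norm f * norm u / \<bar>Im z\<bar> + 1)"
      using l C1(1) X1 by (intro mult_left_mono) auto
    also have "\<dots> = (C1 * X * B * norm f / \<bar>Im z\<bar>) * norm u + C1 * X" by (simp add: algebra_simps)
    finally have "norm u \<le> C1 * X * B * norm f / \<bar>Im z\<bar> + C1 * X + 1"
      by (rule le_of_square_le_linear) (use C1(1) X1 B in auto)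
    also have "\<dots> \<le> (C1 * B * norm f + C1 + 1) * X * (1 + 1 / \<bar>Im z\<bar>)"
    proof -
      have "0 \<le> C1 * B * norm f * X + (C1 + 1) * X / \<bar>Im z\<bar> + (X - 1)" using C1(1) B X1 by simp
      thus ?thesis by (simp add: algebra_simps add_divide_distrib)
    qed
    finally have nu: "norm u \<le> (C1 * B * norm f + C1 + 1) * X * (1 + 1 / \<bar>Im z\<bar>)" .
    have "cmod (E z) \<le> K * norm u" using E(2)[OF noreal[OF im]] K(2) by (simp add: u_def)
    also have "\<dots> \<le> K * ((C1 * B * norm f + C1 + 1) * X * (1 + 1 / \<bar>Im z\<bar>))"
      by (rule mult_left_mono[OF nu K(1)])
    also have "\<dots> = C3 * X * (1 + 1 / \<bar>Im z\<bar>)" by (simp add: C3_def)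
    also have "\<dots> \<le> C * exp (C * sqrt (cmod z)) * (1 + 1 / \<bar>Im z\<bar>)"
      unfolding X_def using C C1(1) by (intro mult_right_mono mult_mono) (auto intro!: mult_right_mono)
    finally show "cmod (E z) \<le> C * exp (C * sqrt (cmod z)) * (1 + 1 / \<bar>Im z\<bar>)" .
  next
    fix z assume z: "Re z \<le> 0" "C \<le> cmod z"
    have zp: "cmod z > 0" using z C C1 by linarith
    have z2: "C2 \<le> cmod z" using z C by linarith
    have noeig: "\<not> eig z"
      using C2(2)[OF _ z(1) z2] zp unfolding eig_def by (fastforce simp: mult_le_0_iff)
    have "cmod z * norm (resolvent z f) \<le> C2 * norm f"
      using C2(2)[OF _ z(1) z2] resolvent[OF noeig] by metis
    hence n: "norm (resolvent z f) \<le> C2 * norm f / cmod z" using zp by (simp add: field_simps)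
    have "cmod (E z) \<le> K * norm (resolvent z f)" using E(2)[OF noeig] K(2) by simp
    also have "\<dots> \<le> K * (C2 * norm f / cmod z)" by (rule mult_left_mono[OF n K(1)])
    also have "\<dots> \<le> C / cmod z" using C(4) zp by (simp add: divide_right_mono mult.assoc)
    finally show "cmod (E z) \<le> C / cmod z" .
  qed
  thus ?thesis using E(2)[OF z] by simp
qed

text \<open>A functional \<open>\<phi>\<close> that kills all eigenvectors kills \<open>resolvent \<i> f\<close> for \<open>f \<in> D\<close>, hence for all \<open>f\<close> by
  density, hence the whole domain, which is dense because it contains \<open>D\<close>.\<close>

theorem eigenvectors_complete: "closure (span {u \<in> Dom. \<exists>z. A u = z *c u}) = UNIV"
proof (rule density_by_functionals)
  fix \<phi> x assume \<phi>: "bounded_functional \<phi>" and van: "\<And>e. e \<in> {u \<in> Dom. \<exists>z. A u = z *c u} \<Longrightarrow> \<phi> e = 0"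
  have z: "\<not> eig \<i>" using eig_real by fastforce
  have vanish_on_UNIV: "\<psi> y = 0" if \<psi>: "bounded_functional \<psi>" and "\<And>f. f \<in> D \<Longrightarrow> \<psi> f = 0" for \<psi> y
  proof -
    have "y \<in> closure D" by (simp add: D_dense)
    then obtain X where X: "\<And>n. X n \<in> D" "X \<longlonglongrightarrow> y" unfolding closure_sequential by blast
    have "(\<lambda>n. \<psi> (X n)) \<longlonglongrightarrow> \<psi> y" by (rule bounded_functional_tendsto[OF \<psi> X(2)])
    thus ?thesis using that(2) X(1) by (simp add: LIMSEQ_const_iff)
  qed
  have res: "\<phi> (resolvent \<i> f) = 0" for f
    by (rule vanish_on_UNIV[OF functional_resolvent[OF \<phi> z]])
       (use resolvent_functional_vanishes[OF \<phi> _ _ z] van in blast)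
  have "\<phi> u = 0" if "u \<in> Dom" for u
    using res resolvent_unique[OF z that refl] by metis
  thus "\<phi> x = 0" using vanish_on_UNIV[OF \<phi>] D_Dom by blast
qed

end

section \<open>The space of square summable sequences\<close>

text \<open>Two-sided sequences, to be read as weighted Fourier coefficients: with the weights introduced below,
  the Hardy space of the strip is isometric to this space.\<close>

typedef (overloaded) ('b::euclidean_space) ell2 = "{a :: int \<Rightarrow> 'b. (\<lambda>n. (norm (a n))\<^sup>2) summable_on UNIV}"
  by (rule exI[of _ "\<lambda>_. 0"]) auto

setup_lifting type_definition_ell2

lemma square_summable_bound:
  fixes g :: "int \<Rightarrow> real"
  assumes nonneg: "\<And>n. g n \<ge> 0" and bound: "\<And>F. finite F \<Longrightarrow> (\<Sum>n\<in>F. g n) \<le> M"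
  shows "g summable_on UNIV" "infsum g UNIV \<le> M"
proof -
  show *: "g summable_on UNIV"
    by (rule nonneg_bdd_above_summable_on) (auto simp: nonneg bdd_above_def intro!: exI[of _ M] bound)
  show "infsum g UNIV \<le> M"
    by (rule infsum_le_finite_sums[OF *]) (use bound in auto)
qed

lemma square_summable_add:
  fixes a b :: "int \<Rightarrow> 'b::real_normed_vector"
  assumes "(\<lambda>n. (norm (a n))\<^sup>2) summable_on UNIV" "(\<lambda>n. (norm (b n))\<^sup>2) summable_on UNIV"
  shows "(\<lambda>n. (norm (a n + b n))\<^sup>2) summable_on UNIV"
proof (rule summable_on_comparison_test)
  show "(\<lambda>n. 2 * (norm (a n))\<^sup>2 + 2 * (norm (b n))\<^sup>2) summable_on UNIV"
    using assms by (intro summable_on_add summable_on_cmult_right)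
  fix n
  have "(norm (a n + b n))\<^sup>2 \<le> (norm (a n) + norm (b n))\<^sup>2" by (intro power_mono norm_triangle_ineq) auto
  also have "\<dots> \<le> 2 * (norm (a n))\<^sup>2 + 2 * (norm (b n))\<^sup>2"
    using sum_squares_bound[of "norm (a n)" "norm (b n)"] by (simp add: power2_sum)
  finally show "(norm (a n + b n))\<^sup>2 \<le> 2 * (norm (a n))\<^sup>2 + 2 * (norm (b n))\<^sup>2" .
qed auto

lemma inner_summable:
  fixes a b :: "int \<Rightarrow> 'b::real_inner"
  assumes "(\<lambda>n. (norm (a n))\<^sup>2) summable_on UNIV" "(\<lambda>n. (norm (b n))\<^sup>2) summable_on UNIV"
  shows "(\<lambda>n. inner (a n) (b n)) summable_on UNIV"
proof -
  have "(\<lambda>n. norm (inner (a n) (b n))) summable_on UNIV"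
  proof (rule summable_on_comparison_test)
    show "(\<lambda>n. (norm (a n))\<^sup>2 + (norm (b n))\<^sup>2) summable_on UNIV" using assms by (intro summable_on_add)
    fix n
    have "\<bar>inner (a n) (b n)\<bar> \<le> norm (a n) * norm (b n)" by (rule Cauchy_Schwarz_ineq2)
    also have "\<dots> \<le> (norm (a n))\<^sup>2 + (norm (b n))\<^sup>2"
    proof -
      have "0 \<le> norm (a n) * norm (b n)" by simp
      moreover have "2 * (norm (a n) * norm (b n)) \<le> (norm (a n))\<^sup>2 + (norm (b n))\<^sup>2"
        using sum_squares_bound[of "norm (a n)" "norm (b n)"] by (simp add: mult.assoc)
      ultimately show ?thesis by linarith
    qed
    finally show "norm (inner (a n) (b n)) \<le> (norm (a n))\<^sup>2 + (norm (b n))\<^sup>2" by simp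
  qed auto
  thus ?thesis by (rule abs_summable_summable)
qed

instantiation ell2 :: (euclidean_space) real_inner
begin

lift_definition zero_ell2 :: "'a ell2" is "\<lambda>_. 0" by simp
lift_definition plus_ell2 :: "'a ell2 \<Rightarrow> 'a ell2 \<Rightarrow> 'a ell2" is "\<lambda>a b n. a n + b n"
  by (rule square_summable_add)
lift_definition uminus_ell2 :: "'a ell2 \<Rightarrow> 'a ell2" is "\<lambda>a n. - a n" by simp
lift_definition minus_ell2 :: "'a ell2 \<Rightarrow> 'a ell2 \<Rightarrow> 'a ell2" is "\<lambda>a b n. a n - b n"
proof -
  fix a b :: "int \<Rightarrow> 'a"
  assume "(\<lambda>n. (norm (a n))\<^sup>2) summable_on UNIV" "(\<lambda>n. (norm (b n))\<^sup>2) summable_on UNIV"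
  thus "(\<lambda>n. (norm (a n - b n))\<^sup>2) summable_on UNIV" using square_summable_add[of a "\<lambda>n. - b n"] by simp
qed
lift_definition scaleR_ell2 :: "real \<Rightarrow> 'a ell2 \<Rightarrow> 'a ell2" is "\<lambda>r a n. r *\<^sub>R a n"
  by (simp add: power_mult_distrib summable_on_cmult_right)
definition inner_ell2 :: "'a ell2 \<Rightarrow> 'a ell2 \<Rightarrow> real" where
  "inner_ell2 x y = infsum (\<lambda>n. inner (Rep_ell2 x n) (Rep_ell2 y n)) UNIV"
definition norm_ell2 :: "'a ell2 \<Rightarrow> real" where "norm_ell2 x = sqrt (inner x x)"
definition sgn_ell2 :: "'a ell2 \<Rightarrow> 'a ell2" where "sgn_ell2 x = inverse (norm x) *\<^sub>R x"
definition dist_ell2 :: "'a ell2 \<Rightarrow> 'a ell2 \<Rightarrow> real" where "dist_ell2 x y = norm (x - y)"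
definition uniformity_ell2 :: "('a ell2 \<times> 'a ell2) filter" where
  "uniformity_ell2 = (INF e\<in>{0 <..}. principal {(x, y). dist x y < e})"
definition open_ell2 :: "'a ell2 set \<Rightarrow> bool" where
  "open_ell2 U = (\<forall>x\<in>U. \<forall>\<^sub>F (x', y) in uniformity. x' = x \<longrightarrow> y \<in> U)"

instance
proof
  fix x y z :: "'a ell2" and r s :: real
  note sq = Rep_ell2[simplified]
  show "x + y + z = x + (y + z)" "x + y = y + x" "0 + x = x" "- x + x = 0" "x - y = x + - y"
    "r *\<^sub>R (x + y) = r *\<^sub>R x + r *\<^sub>R y" "(r + s) *\<^sub>R x = r *\<^sub>R x + s *\<^sub>R x"
    "r *\<^sub>R s *\<^sub>R x = (r * s) *\<^sub>R x" "1 *\<^sub>R x = x"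
    by (transfer, auto simp: algebra_simps)+
  show "dist x y = norm (x - y)" by (simp add: dist_ell2_def)
  show "sgn x = inverse (norm x) *\<^sub>R x" by (simp add: sgn_ell2_def)
  show "uniformity = (INF e\<in>{0 <..}. principal {(x, y::'a ell2). dist x y < e})"
    by (simp add: uniformity_ell2_def)
  show "open U = (\<forall>x\<in>U. \<forall>\<^sub>F (x', y) in uniformity. x' = x \<longrightarrow> y \<in> U)" for U :: "'a ell2 set"
    by (simp add: open_ell2_def)
  show "inner x y = inner y x" by (simp add: inner_ell2_def inner_commute)
  show "inner (x + y) z = inner x z + inner y z"
    by (simp add: inner_ell2_def plus_ell2.rep_eq inner_add_left infsum_add inner_summable sq)
  show "inner (r *\<^sub>R x) y = r * inner x y"
    by (simp add: inner_ell2_def scaleR_ell2.rep_eq infsum_cmult_right inner_summable sq)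
  show "0 \<le> inner x x" by (simp add: inner_ell2_def infsum_nonneg)
  show "norm x = sqrt (inner x x)" by (simp add: norm_ell2_def)
  show "(inner x x = 0) = (x = 0)"
  proof
    assume "inner x x = 0"
    hence "inner (Rep_ell2 x n) (Rep_ell2 x n) = 0" for n
      unfolding inner_ell2_def
      by (intro nonneg_infsum_le_0D[where A = UNIV and f = "\<lambda>n. inner (Rep_ell2 x n) (Rep_ell2 x n)"])
         (auto simp: inner_summable sq)
    thus "x = 0" by (transfer, auto)
  qed (simp add: inner_ell2_def zero_ell2.rep_eq)
qed

end

lemma norm_ell2_square: "(norm x)\<^sup>2 = infsum (\<lambda>n. (norm (Rep_ell2 x n))\<^sup>2) UNIV"
  unfolding power2_norm_eq_inner by (simp add: inner_ell2_def)

lemma ell2_summable: "(\<lambda>n. (norm (Rep_ell2 x n))\<^sup>2) summable_on UNIV"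
  using Rep_ell2[of x] by simp

lemma ell2_sum_le: "finite F \<Longrightarrow> (\<Sum>n\<in>F. (norm (Rep_ell2 x n))\<^sup>2) \<le> (norm x)\<^sup>2"
  unfolding norm_ell2_square by (rule finite_sum_le_infsum[OF ell2_summable]) auto

lemma norm_Rep_ell2_le: "norm (Rep_ell2 x n) \<le> norm x"
  by (rule power2_le_imp_le) (use ell2_sum_le[of "{n}" x] in simp_all)

lemma norm_ell2_le:
  assumes "\<And>F. finite F \<Longrightarrow> (\<Sum>n\<in>F. (norm (Rep_ell2 x n))\<^sup>2) \<le> M\<^sup>2" "M \<ge> 0"
  shows "norm x \<le> M"
proof (rule power2_le_imp_le)
  show "(norm x)\<^sup>2 \<le> M\<^sup>2"
    unfolding norm_ell2_square by (rule square_summable_bound(2)) (use assms in auto)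
qed (rule assms)

text \<open>Coordinatewise convergence of a sequence that is Cauchy in norm, with the Cauchy condition stated on
  finite sets of indices; the common core of completeness and of the compact embedding.\<close>

lemma ell2_limit:
  fixes X :: "nat \<Rightarrow> 'b::euclidean_space ell2"
  assumes lim: "\<And>n. (\<lambda>k. Rep_ell2 (X k) n) \<longlonglongrightarrow> l n"
    and tail: "\<And>e. e > 0 \<Longrightarrow> \<exists>N. \<forall>k\<ge>N. \<forall>j\<ge>N. \<forall>F. finite F \<longrightarrow>
        (\<Sum>n\<in>F. (norm (Rep_ell2 (X k) n - Rep_ell2 (X j) n))\<^sup>2) \<le> e"
  shows "\<exists>x. X \<longlonglongrightarrow> x"
proof -
  have *: "\<exists>N. \<forall>k\<ge>N. \<forall>F. finite F \<longrightarrow> (\<Sum>n\<in>F. (norm (Rep_ell2 (X k) n - l n))\<^sup>2) \<le> e" if e: "e > 0" for e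
  proof -
    obtain N where N: "\<And>k j F. k \<ge> N \<Longrightarrow> j \<ge> N \<Longrightarrow> finite F \<Longrightarrow>
        (\<Sum>n\<in>F. (norm (Rep_ell2 (X k) n - Rep_ell2 (X j) n))\<^sup>2) \<le> e" using tail[OF e] by blast
    have "(\<Sum>n\<in>F. (norm (Rep_ell2 (X k) n - l n))\<^sup>2) \<le> e" if "k \<ge> N" "finite F" for k F
    proof (rule LIMSEQ_le_const2)
      show "(\<lambda>j. \<Sum>n\<in>F. (norm (Rep_ell2 (X k) n - Rep_ell2 (X j) n))\<^sup>2)
          \<longlonglongrightarrow> (\<Sum>n\<in>F. (norm (Rep_ell2 (X k) n - l n))\<^sup>2)"
        by (intro tendsto_intros lim)
      show "\<exists>N. \<forall>j\<ge>N. (\<Sum>n\<in>F. (norm (Rep_ell2 (X k) n - Rep_ell2 (X j) n))\<^sup>2) \<le> e"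
        using N[OF that(1) _ that(2)] by blast
    qed
    thus ?thesis by blast
  qed
  obtain N1 where N1: "\<And>F. finite F \<Longrightarrow> (\<Sum>n\<in>F. (norm (Rep_ell2 (X N1) n - l n))\<^sup>2) \<le> 1"
    using *[of 1] by (meson order_refl zero_less_one)
  have "(\<lambda>n. (norm (Rep_ell2 (X N1) n - l n))\<^sup>2) summable_on UNIV"
    by (rule square_summable_bound(1)[OF _ N1]) auto
  hence "(\<lambda>n. (norm (Rep_ell2 (X N1) n + - (Rep_ell2 (X N1) n - l n)))\<^sup>2) summable_on UNIV"
    by (intro square_summable_add) (simp_all add: ell2_summable norm_minus_commute)
  hence "(\<lambda>n. (norm (l n))\<^sup>2) summable_on UNIV" by simp
  then obtain x where x: "Rep_ell2 x = l" using Abs_ell2_inverse[of l] by auto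
  have "X \<longlonglongrightarrow> x"
  proof (rule metric_LIMSEQ_I)
    fix e :: real assume e: "e > 0"
    obtain N where N: "\<And>k F. k \<ge> N \<Longrightarrow> finite F \<Longrightarrow> (\<Sum>n\<in>F. (norm (Rep_ell2 (X k) n - l n))\<^sup>2) \<le> (e/2)\<^sup>2"
      using *[of "(e/2)\<^sup>2"] e by auto
    have "norm (X k - x) \<le> e / 2" if "k \<ge> N" for k
      by (rule norm_ell2_le) (use N[OF that] e in \<open>auto simp: minus_ell2.rep_eq x\<close>)
    thus "\<exists>N. \<forall>k\<ge>N. dist (X k) x < e" using e by (intro exI[of _ N]) (force simp: dist_norm)
  qed
  thus ?thesis by blast
qed

instance ell2 :: (euclidean_space) complete_space
proof
  fix X :: "nat \<Rightarrow> 'a ell2" assume X: "Cauchy X"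
  have "convergent (\<lambda>k. Rep_ell2 (X k) n)" for n
  proof (rule Cauchy_convergent, rule metric_CauchyI)
    fix e :: real assume "e > 0"
    then obtain N where N: "\<And>k j. k \<ge> N \<Longrightarrow> j \<ge> N \<Longrightarrow> dist (X k) (X j) < e" using metric_CauchyD[OF X] by blast
    have "dist (Rep_ell2 (X k) n) (Rep_ell2 (X j) n) \<le> dist (X k) (X j)" for k j
      using norm_Rep_ell2_le[of "X k - X j" n] by (simp add: dist_norm minus_ell2.rep_eq)
    thus "\<exists>M. \<forall>k\<ge>M. \<forall>j\<ge>M. dist (Rep_ell2 (X k) n) (Rep_ell2 (X j) n) < e"
      using N by (meson order_le_less_trans)
  qed
  then obtain l where l: "\<And>n. (\<lambda>k. Rep_ell2 (X k) n) \<longlonglongrightarrow> l n" unfolding convergent_def by metis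
  show "convergent X" unfolding convergent_def
  proof (rule ell2_limit[OF l])
    fix e :: real assume e: "e > 0"
    then obtain N where N: "\<And>k j. k \<ge> N \<Longrightarrow> j \<ge> N \<Longrightarrow> dist (X k) (X j) < sqrt e"
      using metric_CauchyD[OF X, of "sqrt e"] by auto
    have "(\<Sum>n\<in>F. (norm (Rep_ell2 (X k) n - Rep_ell2 (X j) n))\<^sup>2) \<le> e"
      if "k \<ge> N" "j \<ge> N" "finite F" for k j F
    proof -
      have "(\<Sum>n\<in>F. (norm (Rep_ell2 (X k) n - Rep_ell2 (X j) n))\<^sup>2) \<le> (norm (X k - X j))\<^sup>2"
        using ell2_sum_le[OF that(3), of "X k - X j"] by (simp add: minus_ell2.rep_eq)
      also have "\<dots> \<le> (sqrt e)\<^sup>2" using N[OF that(1,2)] by (intro power_mono) (auto simp: dist_norm)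
      finally show ?thesis using e by simp
    qed
    thus "\<exists>N. \<forall>k\<ge>N. \<forall>j\<ge>N. \<forall>F. finite F \<longrightarrow>
        (\<Sum>n\<in>F. (norm (Rep_ell2 (X k) n - Rep_ell2 (X j) n))\<^sup>2) \<le> e" by blast
  qed
qed

text \<open>The discrete form of Rellich's theorem: a bounded first derivative makes the tails uniformly small,
  and a diagonal subsequence converges in each of the remaining coordinates.\<close>

lemma ell2_compact_embedding:
  fixes X :: "nat \<Rightarrow> 'b::euclidean_space ell2"
  assumes bound: "\<And>k F. finite F \<Longrightarrow> (\<Sum>n\<in>F. (1 + (of_int n)\<^sup>2) * (norm (Rep_ell2 (X k) n))\<^sup>2) \<le> M"
  shows "\<exists>r x. strict_mono r \<and> (\<lambda>k. X (r k)) \<longlonglongrightarrow> x"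
proof -
  have single: "(norm (Rep_ell2 (X k) n))\<^sup>2 \<le> M" for k n
  proof -
    have "(norm (Rep_ell2 (X k) n))\<^sup>2 \<le> (1 + (of_int n)\<^sup>2) * (norm (Rep_ell2 (X k) n))\<^sup>2"
      by (simp add: algebra_simps)
    also have "\<dots> \<le> M" using bound[of "{n}" k] by simp
    finally show ?thesis .
  qed
  have M0: "M \<ge> 0" using bound[of "{}"] by simp
  have sq: "norm (Rep_ell2 (X k) n) \<le> sqrt M" for k n using single by (simp add: real_le_rsqrt)
  obtain r where r: "strict_mono r" and "\<And>n. n \<in> UNIV \<Longrightarrow> \<exists>l. (\<lambda>k. Rep_ell2 (X (r k)) n) \<longlonglongrightarrow> l"
    by (rule function_convergent_subsequence[of "UNIV::int set" "\<lambda>k n. Rep_ell2 (X k) n" "sqrt M"])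
       (use sq in simp_all)
  then obtain l where l: "\<And>n. (\<lambda>k. Rep_ell2 (X (r k)) n) \<longlonglongrightarrow> l n"
    by (metis UNIV_I)
  have "\<exists>x. (\<lambda>k. X (r k)) \<longlonglongrightarrow> x"
  proof (rule ell2_limit[OF l])
    fix e :: real assume e: "e > 0"
    obtain N :: nat where N: "8 * M / e < real N" using reals_Archimedean2 by blast
    define N' where "N' = Suc N"
    define I where "I = {- int N'..int N'}"
    have tailb: "(\<Sum>n\<in>F. (norm (Rep_ell2 (X k) n - Rep_ell2 (X j) n))\<^sup>2) \<le> e / 2"
      if F: "finite F" "F \<inter> I = {}" for F k j
    proof -
      have "(\<Sum>n\<in>F. (norm (Rep_ell2 (X k) n - Rep_ell2 (X j) n))\<^sup>2)
          \<le> (\<Sum>n\<in>F. (2 / real N') * ((1 + (of_int n)\<^sup>2) * (norm (Rep_ell2 (X k) n))\<^sup>2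
              + (1 + (of_int n)\<^sup>2) * (norm (Rep_ell2 (X j) n))\<^sup>2))"
      proof (rule sum_mono)
        fix n assume "n \<in> F"
        hence "n \<notin> I" using F by blast
        hence "real N' \<le> \<bar>of_int n\<bar>" unfolding I_def by auto
        also have "\<dots> \<le> 1 + (of_int n)\<^sup>2" 
          using sum_squares_bound[of 1 "\<bar>of_int n :: real\<bar>"] abs_ge_zero[of "of_int n :: real"]
          by (simp only: power2_abs power_one mult_1_right)
        finally have n: "1 \<le> (1 + (of_int n)\<^sup>2) / real N'" by (simp add: N'_def)
        define p where "p = (norm (Rep_ell2 (X k) n))\<^sup>2 + (norm (Rep_ell2 (X j) n))\<^sup>2"
        have p: "p \<ge> 0" by (simp add: p_def)
        have "(norm (Rep_ell2 (X k) n - Rep_ell2 (X j) n))\<^sup>2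
            \<le> (norm (Rep_ell2 (X k) n) + norm (Rep_ell2 (X j) n))\<^sup>2"
          by (intro power_mono norm_triangle_ineq4) auto
        also have "\<dots> \<le> 2 * p"
          using sum_squares_bound[of "norm (Rep_ell2 (X k) n)" "norm (Rep_ell2 (X j) n)"]
          by (simp add: power2_sum p_def)
        also have "\<dots> \<le> 2 * (p * ((1 + (of_int n)\<^sup>2) / real N'))" using mult_left_mono[OF n p] by simp
        finally show "(norm (Rep_ell2 (X k) n - Rep_ell2 (X j) n))\<^sup>2
          \<le> (2 / real N') * ((1 + (of_int n)\<^sup>2) * (norm (Rep_ell2 (X k) n))\<^sup>2
              + (1 + (of_int n)\<^sup>2) * (norm (Rep_ell2 (X j) n))\<^sup>2)"
          by (simp add: p_def algebra_simps add_divide_distrib)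
      qed
      also have "\<dots> = (2 / real N') * ((\<Sum>n\<in>F. (1 + (of_int n)\<^sup>2) * (norm (Rep_ell2 (X k) n))\<^sup>2)
              + (\<Sum>n\<in>F. (1 + (of_int n)\<^sup>2) * (norm (Rep_ell2 (X j) n))\<^sup>2))"
        by (simp only: sum.distrib flip: sum_distrib_left)
      also have "\<dots> \<le> (2 / real N') * (M + M)" using bound[OF F(1)] by (intro mult_left_mono add_mono) auto
      also have "\<dots> \<le> e / 2"
      proof -
        have "8 * M / e < real N'" using N by (simp add: N'_def)
        thus ?thesis using e by (simp add: field_simps N'_def)
      qed
      finally show ?thesis .
    qed
    define s where "s = (\<lambda>k. \<Sum>n\<in>I. 2 * (norm (Rep_ell2 (X (r k)) n - l n))\<^sup>2)"
    have "s \<longlonglongrightarrow> (\<Sum>n\<in>I. 2 * (norm (l n - l n))\<^sup>2)"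
      unfolding s_def by (intro tendsto_intros l)
    hence "s \<longlonglongrightarrow> 0" by simp
    hence "eventually (\<lambda>k. s k < e / 4) sequentially" by (rule order_tendstoD(2)) (use e in simp)
    then obtain K where K: "\<And>k. k \<ge> K \<Longrightarrow> s k < e / 4" by (auto simp: eventually_sequentially)
    have "(\<Sum>n\<in>F. (norm (Rep_ell2 (X (r k)) n - Rep_ell2 (X (r j)) n))\<^sup>2) \<le> e"
      if kj: "k \<ge> K" "j \<ge> K" and F: "finite F" for k j F
    proof -
      let ?g = "\<lambda>n. (norm (Rep_ell2 (X (r k)) n - Rep_ell2 (X (r j)) n))\<^sup>2"
      have "(\<Sum>n\<in>F. ?g n) = (\<Sum>n\<in>F \<inter> I. ?g n) + (\<Sum>n\<in>F - I. ?g n)"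
        using F by (subst sum.union_disjoint[symmetric]) (auto simp: Int_Diff_Un)
      also have "(\<Sum>n\<in>F - I. ?g n) \<le> e / 2" using F by (intro tailb) auto
      also have "(\<Sum>n\<in>F \<inter> I. ?g n) \<le> (\<Sum>n\<in>I. ?g n)" by (rule sum_mono2) (auto simp: I_def)
      also have "\<dots> \<le> (\<Sum>n\<in>I. 2 * (norm (Rep_ell2 (X (r k)) n - l n))\<^sup>2 + 2 * (norm (Rep_ell2 (X (r j)) n - l n))\<^sup>2)"
      proof (rule sum_mono)
        fix n
        have "?g n = (norm ((Rep_ell2 (X (r k)) n - l n) - (Rep_ell2 (X (r j)) n - l n)))\<^sup>2" by simp
        also have "\<dots> \<le> (norm (Rep_ell2 (X (r k)) n - l n) + norm (Rep_ell2 (X (r j)) n - l n))\<^sup>2"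
          by (intro power_mono norm_triangle_ineq4) auto
        also have "\<dots> \<le> 2 * (norm (Rep_ell2 (X (r k)) n - l n))\<^sup>2 + 2 * (norm (Rep_ell2 (X (r j)) n - l n))\<^sup>2"
          using sum_squares_bound[of "norm (Rep_ell2 (X (r k)) n - l n)" "norm (Rep_ell2 (X (r j)) n - l n)"]
          by (simp add: power2_sum)
        finally show "?g n \<le> 2 * (norm (Rep_ell2 (X (r k)) n - l n))\<^sup>2 + 2 * (norm (Rep_ell2 (X (r j)) n - l n))\<^sup>2" .
      qed
      also have "\<dots> = s k + s j" by (simp add: s_def sum.distrib)
      finally show ?thesis using K[OF kj(1)] K[OF kj(2)] by simp
    qed
    thus "\<exists>N. \<forall>k\<ge>N. \<forall>j\<ge>N. \<forall>F. finite F \<longrightarrow>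
        (\<Sum>n\<in>F. (norm (Rep_ell2 (X (r k)) n - Rep_ell2 (X (r j)) n))\<^sup>2) \<le> e" by blast
  qed
  thus ?thesis using r by blast
qed

text \<open>The coefficient sequences of trigonometric polynomials.\<close>

definition finite_support :: "'b::euclidean_space ell2 set" where
  "finite_support = {x. finite {n. Rep_ell2 x n \<noteq> 0}}"

lemma finite_support_dense: "closure finite_support = (UNIV :: 'b::euclidean_space ell2 set)"
proof (intro equalityI subset_UNIV subsetI)
  fix x :: "'b ell2"
  show "x \<in> closure finite_support" unfolding closure_approachable
  proof (intro allI impI)
    fix e :: real assume e: "e > 0"
    have "((\<lambda>n. (norm (Rep_ell2 x n))\<^sup>2) has_sum (norm x)\<^sup>2) UNIV"
      unfolding norm_ell2_square by (rule has_sum_infsum[OF ell2_summable])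
    then obtain F where F: "finite F" "dist (\<Sum>n\<in>F. (norm (Rep_ell2 x n))\<^sup>2) ((norm x)\<^sup>2) < (e/2)\<^sup>2"
      using e unfolding has_sum_def tendsto_iff eventually_finite_subsets_at_top
      by (metis half_gt_zero order_refl subset_UNIV zero_less_power)
    define a where "a = (\<lambda>n. if n \<in> F then Rep_ell2 x n else 0)"
    have "(\<lambda>n. (norm (a n))\<^sup>2) summable_on UNIV"
      by (rule summable_on_comparison_test[OF ell2_summable[of x]]) (auto simp: a_def)
    then obtain y where y: "Rep_ell2 y = a" using Abs_ell2_inverse[of a] by auto
    have "norm (x - y) \<le> e / 2"
    proof (rule norm_ell2_le)
      fix G :: "int set" assume G: "finite G"
      have "(\<Sum>n\<in>G. (norm (Rep_ell2 (x - y) n))\<^sup>2) = (\<Sum>n\<in>G - F. (norm (Rep_ell2 x n))\<^sup>2)"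
        using G by (intro sum.mono_neutral_cong_right) (auto simp: minus_ell2.rep_eq y a_def)
      also have "\<dots> = (\<Sum>n\<in>(G - F) \<union> F. (norm (Rep_ell2 x n))\<^sup>2) - (\<Sum>n\<in>F. (norm (Rep_ell2 x n))\<^sup>2)"
        using G F(1) by (subst sum.union_disjoint) auto
      also have "\<dots> \<le> (norm x)\<^sup>2 - (\<Sum>n\<in>F. (norm (Rep_ell2 x n))\<^sup>2)"
        using ell2_sum_le[of "(G - F) \<union> F" x] G F(1) by simp
      also have "\<dots> \<le> (e/2)\<^sup>2" using F(2) by (simp add: dist_real_def abs_if split: if_splits)
      finally show "(\<Sum>n\<in>G. (norm (Rep_ell2 (x - y) n))\<^sup>2) \<le> (e/2)\<^sup>2" .
    qed (use e in simp)
    moreover have "y \<in> finite_support"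
      unfolding finite_support_def using F(1) by (auto simp: y a_def)
    ultimately show "\<exists>y\<in>finite_support. dist y x < e" using e
      by (intro bexI[of _ y]) (auto simp: dist_norm norm_minus_commute)
  qed
qed

lemma norm_vector_scale: "norm (c *s v) = cmod c * norm (v :: complex ^ 'k)"
  by (simp add: norm_vec_def L2_set_def norm_mult power_mult_distrib real_sqrt_mult flip: sum_distrib_left)

lift_definition scaleC :: "complex \<Rightarrow> (complex ^ 'k) ell2 \<Rightarrow> (complex ^ 'k) ell2" is "\<lambda>c a n. c *s a n"
  by (simp add: norm_vector_scale power_mult_distrib summable_on_cmult_right)

interpretation ell2: complex_hilbert scaleC
proof
  fix c d :: complex and r :: real and x y :: "(complex ^ 'k) ell2"
  show "scaleC c (x + y) = scaleC c x + scaleC c y" by transfer (auto simp: vector_add_ldistrib)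
  show "scaleC (c + d) x = scaleC c x + scaleC d x" by transfer (auto simp: vector_sadd_rdistrib)
  show "scaleC c (scaleC d x) = scaleC (c * d) x" by transfer (auto simp: vector_smult_assoc)
  show "scaleC 1 x = x" by transfer auto
  show "scaleC (of_real r) x = r *\<^sub>R x"
    by transfer (auto simp: vec_eq_iff fun_eq_iff complex_eq_iff)
  have "(norm (scaleC c x))\<^sup>2 = (cmod c * norm x)\<^sup>2"
    by (simp add: norm_ell2_square scaleC.rep_eq norm_vector_scale power_mult_distrib infsum_cmult_right')
  thus "norm (scaleC c x) = cmod c * norm x" by (simp add: power2_eq_iff_nonneg)
qed

section \<open>Periodic holomorphic functions and their Fourier series\<close>

lemma open_strip: "open (strip T)"
proof -
  have "strip T = {z. Im z > - T} \<inter> {z. Im z < T}" by (auto simp: strip_def)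
  thus ?thesis by (auto intro!: open_Int open_halfspace_Im_gt open_halfspace_Im_lt)
qed

lemma convex_strip: "convex (strip T)"
proof -
  have "strip T = {z. Im z > - T} \<inter> {z. Im z < T}" by (auto simp: strip_def)
  thus ?thesis by (auto intro!: convex_Int convex_halfspace_Im_gt convex_halfspace_Im_lt)
qed

lemma Complex_in_strip [simp]: "Complex x \<tau> \<in> strip T \<longleftrightarrow> \<bar>\<tau>\<bar> < T"
  by (auto simp: strip_def)

lemma strip_shift: "z \<in> strip T \<Longrightarrow> z + 2 * of_real pi \<in> strip T"
  by (simp add: strip_def)

lemma periodic_int:
  assumes per: "\<And>z. z \<in> strip T \<Longrightarrow> f (z + 2 * of_real pi) = f z" and z: "z \<in> strip T"
  shows "f (z + of_int n * (2 * of_real pi)) = f z"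
proof -
  have nat: "f (z + of_nat m * (2 * of_real pi)) = f z" if "z \<in> strip T" for z m
  proof (induction m)
    case (Suc m)
    have "z + of_nat m * (2 * of_real pi) \<in> strip T" using that by (simp add: strip_def)
    from per[OF this] Suc show ?case by (simp add: algebra_simps)
  qed simp
  show ?thesis
  proof (cases n rule: int_cases2)
    case (nonneg m) thus ?thesis using nat[OF z, of m] by simp
  next
    case (nonpos m)
    have "z + of_int n * (2 * of_real pi) \<in> strip T" using z by (simp add: strip_def)
    from nat[OF this, of m] show ?thesis by (simp add: nonpos)
  qed
qed

definition per_hol :: "real \<Rightarrow> (complex \<Rightarrow> complex) \<Rightarrow> bool" where
  "per_hol T f \<longleftrightarrow> f holomorphic_on strip T \<and> (\<forall>z\<in>strip T. f (z + 2 * of_real pi) = f z)"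

lemma per_hol_deriv:
  assumes "per_hol T f" shows "per_hol T (deriv f)"
proof -
  have hol: "f holomorphic_on strip T" and per: "\<And>z. z \<in> strip T \<Longrightarrow> f (z + 2 * of_real pi) = f z"
    using assms by (auto simp: per_hol_def)
  have "deriv f (z + 2 * of_real pi) = deriv f z" if z: "z \<in> strip T" for z
  proof -
    have "(f has_field_derivative deriv f (z + 2 * of_real pi)) (at (z + 2 * of_real pi))"
      by (rule holomorphic_derivI[OF hol open_strip strip_shift[OF z]])
    hence "((\<lambda>z. f (z + 2 * of_real pi)) has_field_derivative deriv f (z + 2 * of_real pi)) (at z)"
      by (simp only: DERIV_shift)
    hence "(f has_field_derivative deriv f (z + 2 * of_real pi)) (at z)"
      using has_field_derivative_transform_within_open[OF _ open_strip z] per by blast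
    thus ?thesis by (simp add: DERIV_imp_deriv)
  qed
  thus ?thesis unfolding per_hol_def using holomorphic_deriv[OF hol open_strip] by blast
qed

lemma has_vector_derivative_horizontal:
  assumes "(f has_field_derivative d) (at (Complex x \<tau>))"
  shows "((\<lambda>x. f (Complex x \<tau>)) has_vector_derivative d) (at x)"
proof -
  have "((\<lambda>x. of_real x + \<i> * of_real \<tau>) has_vector_derivative 1) (at x)"
    by (auto intro!: derivative_eq_intros)
  hence "((\<lambda>x. Complex x \<tau>) has_vector_derivative 1) (at x)" by (simp add: Complex_eq)
  from field_vector_diff_chain_at[OF this assms] show ?thesis by (simp add: o_def)
qed

lemma has_vector_derivative_vertical:
  assumes "(f has_field_derivative d) (at (Complex x \<tau>))"
  shows "((\<lambda>\<tau>. f (Complex x \<tau>)) has_vector_derivative \<i> * d) (at \<tau>)"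
proof -
  have "((\<lambda>\<tau>. of_real x + \<i> * of_real \<tau>) has_vector_derivative \<i>) (at \<tau>)"
    by (auto intro!: derivative_eq_intros)
  hence "((\<lambda>\<tau>. Complex x \<tau>) has_vector_derivative \<i>) (at \<tau>)" by (simp add: Complex_eq)
  from field_vector_diff_chain_at[OF this assms] show ?thesis by (simp add: o_def)
qed

lemma continuous_on_line:
  assumes "f holomorphic_on strip T" "\<bar>\<tau>\<bar> < T"
  shows "continuous_on A (\<lambda>x. f (Complex x \<tau>))"
proof -
  have "continuous_on (strip T) f" using assms(1) by (rule holomorphic_on_imp_continuous_on)
  moreover have "continuous_on A (\<lambda>x. Complex x \<tau>)" by (simp add: Complex_eq continuous_intros)
  ultimately show ?thesis
    by (rule continuous_on_compose2) (use assms(2) in auto)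
qed

text \<open>Cauchy's theorem for a rectangle of width one period. A primitive \<open>g\<close> exists on the convex strip, and
  \<open>g (z + 2 \<pi>) - g z\<close> has derivative \<open>0\<close>, so the integral over a period is the same on all lines.\<close>

lemma per_hol_integral_shift:
  assumes f: "per_hol T f" and \<tau>: "\<bar>\<tau>\<bar> < T" and \<sigma>: "\<bar>\<sigma>\<bar> < T"
  shows "integral {0..2*pi} (\<lambda>x. f (Complex x \<tau>)) = integral {0..2*pi} (\<lambda>x. f (Complex x \<sigma>))"
proof -
  have hol: "f holomorphic_on strip T" and per: "\<And>z. z \<in> strip T \<Longrightarrow> f (z + 2 * of_real pi) = f z"
    using f by (auto simp: per_hol_def)
  obtain g where "\<And>z. z \<in> strip T \<Longrightarrow> (g has_field_derivative f z) (at z within strip T)"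
    using holomorphic_convex_primitive'[OF convex_strip open_strip hol] by blast
  hence g: "\<And>z. z \<in> strip T \<Longrightarrow> (g has_field_derivative f z) (at z)"
    using at_within_open[OF _ open_strip] by metis
  have int: "integral {0..2*pi} (\<lambda>x. f (Complex x \<tau>)) = g (Complex 0 \<tau> + 2 * of_real pi) - g (Complex 0 \<tau>)"
    if "\<bar>\<tau>\<bar> < T" for \<tau>
  proof -
    have "((\<lambda>x. f (Complex x \<tau>)) has_integral (g (Complex (2*pi) \<tau>) - g (Complex 0 \<tau>))) {0..2*pi}"
      by (rule fundamental_theorem_of_calculus)
         (auto intro!: has_vector_derivative_at_within has_vector_derivative_horizontal g that)
    moreover have "Complex (2*pi) \<tau> = Complex 0 \<tau> + 2 * of_real pi" by (simp add: complex_eq_iff)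
    ultimately show ?thesis by (simp add: integral_unique)
  qed
  have "\<exists>c. \<forall>z\<in>strip T. g (z + 2 * of_real pi) - g z = c"
  proof (rule has_field_derivative_zero_constant[OF convex_strip])
    fix z assume z: "z \<in> strip T"
    have "((\<lambda>z. g (z + 2 * of_real pi)) has_field_derivative f (z + 2 * of_real pi)) (at z)"
      using g[OF strip_shift[OF z]] by (simp only: DERIV_shift)
    hence "((\<lambda>z. g (z + 2 * of_real pi) - g z) has_field_derivative f (z + 2 * of_real pi) - f z) (at z)"
      by (rule DERIV_diff[OF _ g[OF z]])
    thus "((\<lambda>z. g (z + 2 * of_real pi) - g z) has_field_derivative 0) (at z within strip T)"
      using per[OF z] by (simp add: has_field_derivative_at_within)
  qed
  thus ?thesis unfolding int[OF \<tau>] int[OF \<sigma>] using \<tau> \<sigma> by (metis Complex_in_strip)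
qed

lemma exp_int_periodic: "exp (\<i> * of_int n * (z + 2 * of_real pi)) = exp (\<i> * of_int n * z)"
proof -
  have "exp (\<i> * of_int n * (z + 2 * of_real pi)) = exp (\<i> * of_int n * z) * exp (2 * of_int n * of_real pi * \<i>)"
    by (simp add: exp_add[symmetric] algebra_simps)
  also have "exp (2 * of_int n * of_real pi * \<i>) = 1"
    by (auto intro!: exI[of _ n] simp: exp_eq_1)
  finally show ?thesis by simp
qed

lemma per_hol_exp: "per_hol T (\<lambda>z. exp (\<i> * of_int n * z))"
  unfolding per_hol_def using exp_int_periodic by (auto intro!: holomorphic_intros)

lemma per_hol_exp_minus: "per_hol T (\<lambda>z. exp (- \<i> * of_int n * z))"
  using per_hol_exp[of T "-n"] by simp

lemma per_hol_mult: "per_hol T f \<Longrightarrow> per_hol T g \<Longrightarrow> per_hol T (\<lambda>z. f z * g z)"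
  and per_hol_add: "per_hol T f \<Longrightarrow> per_hol T g \<Longrightarrow> per_hol T (\<lambda>z. f z + g z)"
  and per_hol_diff: "per_hol T f \<Longrightarrow> per_hol T g \<Longrightarrow> per_hol T (\<lambda>z. f z - g z)"
  and per_hol_minus: "per_hol T f \<Longrightarrow> per_hol T (\<lambda>z. - f z)"
  and per_hol_const: "per_hol T (\<lambda>z. c)"
  by (auto simp: per_hol_def intro!: holomorphic_intros)

lemma per_hol_sum: "(\<And>i. i \<in> I \<Longrightarrow> per_hol T (f i)) \<Longrightarrow> per_hol T (\<lambda>z. \<Sum>i\<in>I. f i z)"
  by (auto simp: per_hol_def intro!: holomorphic_intros)

lemma per_hol_integrable:
  assumes "per_hol T f" "\<bar>\<tau>\<bar> < T"
  shows "(\<lambda>x. f (Complex x \<tau>)) integrable_on {0..2*pi}"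
  using assms by (auto simp: per_hol_def intro: integrable_continuous_interval continuous_on_line)

lemma fourier_coeff_on_line:
  assumes f: "per_hol T f" and \<tau>: "\<bar>\<tau>\<bar> < T"
  shows "fourier_coeff f n = 1 / (2 * of_real pi) *
    integral {0..2*pi} (\<lambda>x. f (Complex x \<tau>) * exp (- \<i> * of_int n * Complex x \<tau>))"
proof -
  have "\<bar>0\<bar> < T" using \<tau> by simp
  from per_hol_integral_shift[OF per_hol_mult[OF f per_hol_exp_minus] this \<tau>, of n]
  show ?thesis by (simp add: fourier_coeff_def complex_of_real_def)
qed

lemma norm_exp_line: "cmod (exp (\<i> * of_int n * Complex x \<tau>)) = exp (- of_int n * \<tau>)"
  "cmod (exp (- \<i> * of_int n * Complex x \<tau>)) = exp (of_int n * \<tau>)"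
  by (simp_all add: norm_exp_eq_Re)

lemma bounded_on_line:
  assumes "f holomorphic_on strip T" "\<bar>\<tau>\<bar> < T"
  obtains M where "M > 0" "\<And>x. x \<in> {0..2*pi} \<Longrightarrow> cmod (f (Complex x \<tau>)) \<le> M"
proof -
  have "compact ((\<lambda>x. f (Complex x \<tau>)) ` {0..2*pi})"
    by (intro compact_continuous_image continuous_on_line[OF assms]) auto
  hence "bounded ((\<lambda>x. f (Complex x \<tau>)) ` {0..2*pi})" by (rule compact_imp_bounded)
  thus ?thesis using that unfolding bounded_pos by auto
qed

lemma fourier_coeff_bound_line:
  assumes f: "per_hol T f" and \<tau>: "\<bar>\<tau>\<bar> < T"
    and M: "\<And>x. x \<in> {0..2*pi} \<Longrightarrow> cmod (f (Complex x \<tau>)) \<le> M"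
  shows "cmod (fourier_coeff f n) \<le> M * exp (of_int n * \<tau>)"
proof -
  have M0: "M \<ge> 0" using M[of 0] by (meson atLeastAtMost_iff norm_ge_zero order_trans pi_ge_zero order_refl mult_nonneg_nonneg zero_le_numeral)
  let ?g = "\<lambda>x. f (Complex x \<tau>) * exp (- \<i> * of_int n * Complex x \<tau>)"
  have "norm (integral {0..2*pi} ?g) \<le> M * exp (of_int n * \<tau>) * (2 * pi - 0)"
  proof (rule integral_bound)
    show "continuous_on {0..2*pi} ?g"
      using per_hol_mult[OF f per_hol_exp_minus] \<tau> continuous_on_line unfolding per_hol_def by blast
    fix x assume x: "x \<in> {0..2*pi}"
    show "norm (?g x) \<le> M * exp (of_int n * \<tau>)"
      unfolding norm_mult norm_exp_line using M[OF x] by (intro mult_right_mono) auto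
  qed auto
  thus ?thesis unfolding fourier_coeff_on_line[OF f \<tau>] norm_mult
    by (simp add: norm_divide field_simps)
qed

text \<open>Shift the line of integration to \<open>Im z = - s\<close> for \<open>n \<ge> 0\<close> and to \<open>Im z = s\<close> for \<open>n < 0\<close>.\<close>

lemma fourier_coeff_decay:
  assumes f: "per_hol T f" and s: "0 \<le> s" "s < T"
  obtains M where "M > 0" "\<And>n. cmod (fourier_coeff f n) \<le> M * exp (- \<bar>of_int n\<bar> * s)"
proof -
  have hol: "f holomorphic_on strip T" using f by (simp add: per_hol_def)
  obtain M1 where M1: "M1 > 0" "\<And>x. x \<in> {0..2*pi} \<Longrightarrow> cmod (f (Complex x s)) \<le> M1"
    using bounded_on_line[OF hol, of s] s by auto
  obtain M2 where M2: "M2 > 0" "\<And>x. x \<in> {0..2*pi} \<Longrightarrow> cmod (f (Complex x (-s))) \<le> M2"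
    using bounded_on_line[OF hol, of "-s"] s by auto
  show ?thesis
  proof
    show "max M1 M2 > 0" using M1 by simp
    fix n
    show "cmod (fourier_coeff f n) \<le> max M1 M2 * exp (- \<bar>of_int n\<bar> * s)"
    proof (cases "n \<ge> 0")
      case True
      have "cmod (fourier_coeff f n) \<le> max M1 M2 * exp (of_int n * (-s))"
        by (rule fourier_coeff_bound_line[OF f]) (use s M2 in \<open>auto simp: le_max_iff_disj\<close>)
      thus ?thesis using True by simp
    next
      case False
      have "cmod (fourier_coeff f n) \<le> max M1 M2 * exp (of_int n * s)"
        by (rule fourier_coeff_bound_line[OF f]) (use s M1 in \<open>auto simp: le_max_iff_disj\<close>)
      thus ?thesis using False by simp
    qed
  qed
qed

lemma summable_exp_int:
  assumes d: "d > (0::real)"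
  shows "(\<lambda>n::int. exp (- \<bar>of_int n\<bar> * d)) summable_on UNIV"
proof -
  have "summable (\<lambda>n::nat. exp (- d) ^ n)" using d by (intro summable_geometric) auto
  hence nat: "(\<lambda>n::nat. exp (- d) ^ n) summable_on UNIV"
    by (intro norm_summable_imp_summable_on) auto
  have e: "exp (- d) ^ n = exp (- real n * d)" for n by (simp add: exp_of_nat_mult[symmetric])
  have 1: "(\<lambda>n::int. exp (- \<bar>of_int n\<bar> * d)) summable_on range int"
    by (subst summable_on_reindex) (use nat in \<open>auto simp: o_def e inj_on_def\<close>)
  have 2: "(\<lambda>n::int. exp (- \<bar>of_int n\<bar> * d)) summable_on range (\<lambda>n. - int n)"
    by (subst summable_on_reindex) (use nat in \<open>auto simp: o_def e inj_on_def\<close>)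
  have 3: "(\<lambda>n::int. exp (- \<bar>of_int n\<bar> * d)) summable_on (range (\<lambda>n. - int n) - range int)"
    by (rule summable_on_subset_banach[OF 2]) auto
  have "n \<in> range int \<union> (range (\<lambda>n. - int n) - range int)" for n :: int
    by (cases n rule: int_cases2) auto
  hence "UNIV = range int \<union> (range (\<lambda>n. - int n) - range int)" by blast
  thus ?thesis using summable_on_Un_disjoint[OF 1 3] by auto
qed

abbreviation symm :: "nat \<Rightarrow> int set" where "symm N \<equiv> {- int N..int N}"

lemma filterlim_symm: "filterlim symm (finite_subsets_at_top UNIV) sequentially"
  unfolding filterlim_finite_subsets_at_top
proof (intro allI impI)
  fix X :: "int set" assume "finite X \<and> X \<subseteq> UNIV"
  hence X: "finite X" by simp
  have "eventually (\<lambda>N. N \<ge> Max (insert 0 ((\<lambda>n. nat \<bar>n\<bar>) ` X))) sequentially" by (rule eventually_ge_at_top)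
  thus "eventually (\<lambda>N. finite (symm N) \<and> X \<subseteq> symm N \<and> symm N \<subseteq> UNIV) sequentially"
    by eventually_elim (use X in \<open>force simp: abs_le_iff\<close>)
qed

lemma has_sum_imp_symm_limit: "(f has_sum s) UNIV \<Longrightarrow> (\<lambda>N. \<Sum>n\<in>symm N. f n) \<longlonglongrightarrow> s"
  unfolding has_sum_def by (rule filterlim_compose[OF _ filterlim_symm])

lemma removable_quotient:
  assumes "f holomorphic_on S" "q holomorphic_on S" "open S" "w \<in> S"
    and "f w = 0" "q w = 0" "\<And>z. z \<in> S \<Longrightarrow> z \<noteq> w \<Longrightarrow> q z \<noteq> 0" "deriv q w \<noteq> 0"
  shows "(\<lambda>z. if z = w then deriv f w / deriv q w else f z / q z) holomorphic_on S"
proof (rule removable_singularity[OF _ assms(3)])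
  show "(\<lambda>z. f z / q z) holomorphic_on S - {w}"
    using assms by (intro holomorphic_intros) (auto intro: holomorphic_on_subset)
  have "((\<lambda>z. (f z - f w) / (z - w)) \<longlongrightarrow> deriv f w) (at w)" "((\<lambda>z. (q z - q w) / (z - w)) \<longlongrightarrow> deriv q w) (at w)"
    using holomorphic_derivI[OF assms(1,3,4)] holomorphic_derivI[OF assms(2,3,4)]
    by (simp_all add: has_field_derivative_iff)
  from tendsto_divide[OF this assms(8)]
  have "((\<lambda>z. ((f z - f w) / (z - w)) / ((q z - q w) / (z - w))) \<longlongrightarrow> deriv f w / deriv q w) (at w)" .
  moreover have "eventually (\<lambda>z. ((f z - f w) / (z - w)) / ((q z - q w) / (z - w)) = f z / q z) (at w)"
    unfolding eventually_at_filter by (rule always_eventually) (simp add: assms(5,6))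
  ultimately show "((\<lambda>z. f z / q z) \<longlongrightarrow> deriv f w / deriv q w) (at w)" by (rule Lim_transform_eventually)
qed

text \<open>Both \<open>f - f z0\<close> and \<open>q = exp (\<i> (z - z0)) - 1\<close> are periodic, and the zeros of \<open>q\<close> are simple and
  lie at the translates of \<open>z0\<close> by periods, where \<open>f - f z0\<close> vanishes too; so the quotient is again
  holomorphic and periodic.\<close>

lemma chernoff_quotient:
  assumes f: "per_hol T f" and z0: "z0 \<in> strip T"
  obtains h where "per_hol T h" "\<And>z. z \<in> strip T \<Longrightarrow> f z - f z0 = (exp (\<i> * (z - z0)) - 1) * h z"
proof -
  have hol: "f holomorphic_on strip T" and per: "\<And>z. z \<in> strip T \<Longrightarrow> f (z + 2 * of_real pi) = f z"
    using f by (auto simp: per_hol_def)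
  define q where "q = (\<lambda>z. exp (\<i> * (z - z0)) - 1)"
  define g where "g = (\<lambda>z. f z - f z0)"
  \<comment> \<open>The value at a zero of \<open>q\<close> is the removable one.\<close>
  define h where "h = (\<lambda>z. if q z = 0 then deriv g z / deriv q z else g z / q z)"
  have qper: "q (z + 2 * of_real pi) = q z" for z
    using exp_int_periodic[of 1 "z - z0"] by (simp add: q_def algebra_simps)
  have qhol: "q holomorphic_on A" for A unfolding q_def by (intro holomorphic_intros)
  have ghol: "g holomorphic_on strip T" unfolding g_def by (intro holomorphic_intros hol)
  have q0: "q z = 0 \<longleftrightarrow> (\<exists>n::int. z = z0 + of_int n * (2 * of_real pi))" for z
  proof -
    have "q z = 0 \<longleftrightarrow> exp (\<i> * (z - z0)) = 1" by (simp add: q_def)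
    also have "\<dots> \<longleftrightarrow> (\<exists>n::int. Im (z - z0) = 0 \<and> Re (z - z0) = of_int (2 * n) * pi)"
      by (simp add: exp_eq_1 eq_commute[of "Im z" "Im z0"])
    also have "\<dots> \<longleftrightarrow> (\<exists>n::int. z = z0 + of_int n * (2 * of_real pi))" (is "?L \<longleftrightarrow> ?R")
    proof
      assume ?L
      then obtain n :: int where "Im (z - z0) = 0" "Re (z - z0) = of_int (2 * n) * pi" by blast
      thus ?R by (intro exI[of _ n]) (simp add: complex_eq_iff algebra_simps)
    next
      assume ?R
      then obtain n :: int where "z = z0 + of_int n * (2 * of_real pi)" by blast
      thus ?L by (intro exI[of _ n]) (simp add: algebra_simps)
    qed
    finally show ?thesis .
  qed
  have dq: "deriv q z \<noteq> 0" for z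
  proof -
    have "(q has_field_derivative exp (\<i> * (z - z0)) * \<i>) (at z)"
      unfolding q_def by (auto intro!: derivative_eq_intros)
    thus ?thesis by (simp add: DERIV_imp_deriv)
  qed
  have g0: "g z = 0" if qz: "q z = 0" for z
  proof -
    obtain n :: int where n: "z = z0 + of_int n * (2 * of_real pi)" using iffD1[OF q0 qz] by (rule exE)
    have "f z = f z0" unfolding n by (rule periodic_int[of T f]) (use per z0 in auto)
    thus ?thesis by (simp add: g_def)
  qed
  have "h field_differentiable (at w)" if w: "w \<in> strip T" for w
  proof (cases "q w = 0")
    case False
    have "open (strip T \<inter> q -` (- {0}))"
      by (intro continuous_open_preimage[OF holomorphic_on_imp_continuous_on[OF qhol] open_strip]) auto
    moreover have "w \<in> strip T \<inter> q -` (- {0})" using w False by simp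
    moreover have "h holomorphic_on (strip T \<inter> q -` (- {0}))"
      by (rule holomorphic_transform[of "\<lambda>z. g z / q z"])
         (auto simp: h_def intro!: holomorphic_intros qhol holomorphic_on_subset[OF ghol])
    ultimately show ?thesis by (metis holomorphic_on_imp_differentiable_at)
  next
    case True
    define S where "S = strip T \<inter> ball w 1"
    have S: "open S" "w \<in> S" using w open_strip by (auto simp: S_def)
    have nz: "q z \<noteq> 0" if z: "z \<in> S" "z \<noteq> w" for z
    proof
      assume zq: "q z = 0"
      obtain n m :: int where "z = z0 + of_int n * (2 * of_real pi)" "w = z0 + of_int m * (2 * of_real pi)"
        using iffD1[OF q0 True] iffD1[OF q0 zq] by (elim exE) (rule that)
      hence d: "w - z = of_int (m - n) * (2 * of_real pi)" by (simp add: algebra_simps)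
      hence "m \<noteq> n" using z(2) by auto
      hence "1 \<le> \<bar>real_of_int (m - n)\<bar>" by linarith
      hence "2 * pi \<le> cmod (w - z)" unfolding d using mult_right_mono[of 1 "\<bar>real_of_int (m - n)\<bar>" "2 * pi"]
        by (simp add: norm_mult flip: of_int_diff)
      moreover have "cmod (w - z) < 1" using z(1) by (simp add: S_def dist_norm)
      ultimately show False using pi_gt3 by simp
    qed
    have "(\<lambda>z. if z = w then deriv g w / deriv q w else g z / q z) holomorphic_on S"
      by (rule removable_quotient[OF _ qhol S])
         (use g0 True nz dq holomorphic_on_subset[OF ghol] in \<open>auto simp: S_def\<close>)
    hence "h holomorphic_on S"
      by (rule holomorphic_transform) (use True nz in \<open>auto simp: h_def\<close>)
    thus ?thesis using S by (metis holomorphic_on_imp_differentiable_at)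
  qed
  hence hhol: "h holomorphic_on strip T" by (simp add: holomorphic_on_def field_differentiable_at_within)
  have hper: "h (z + 2 * of_real pi) = h z" if z: "z \<in> strip T" for z
  proof -
    have "per_hol T g" "per_hol T q" using ghol qhol per qper by (auto simp: per_hol_def g_def)
    hence dg: "deriv g (z + 2 * of_real pi) = deriv g z" and "deriv q (z + 2 * of_real pi) = deriv q z"
      using per_hol_deriv z unfolding per_hol_def by blast+
    thus ?thesis using dg per[OF z] qper[of z] by (simp add: h_def g_def)
  qed
  have "g z = q z * h z" for z using g0 by (simp add: h_def)
  thus ?thesis using that[of h] hhol hper by (simp add: per_hol_def g_def q_def)
qed

lemma fourier_coeff_exp:
  "fourier_coeff (\<lambda>z. exp (\<i> * of_int m * z)) n = (if m = n then 1 else 0)"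
proof (cases "m = n")
  case True
  thus ?thesis by (simp add: fourier_coeff_def exp_add[symmetric] scaleR_conv_of_real)
next
  case False
  define k where "k = \<i> * of_int (m - n)"
  have k0: "k \<noteq> 0" using False by (simp add: k_def)
  have "((\<lambda>x. exp (k * of_real x)) has_integral (exp (k * of_real (2*pi)) / k - exp (k * of_real 0) / k)) {0..2*pi}"
  proof (rule fundamental_theorem_of_calculus)
    fix x :: real
    have "((\<lambda>z. exp (k * z) / k) has_field_derivative exp (k * of_real x)) (at (of_real x))"
      using k0 by (auto intro!: derivative_eq_intros)
    thus "((\<lambda>x. exp (k * of_real x) / k) has_vector_derivative exp (k * of_real x)) (at x within {0..2*pi})"
      by (rule has_vector_derivative_at_within[OF has_vector_derivative_real_field])
  qed auto
  moreover have "exp (k * of_real (2*pi)) = 1"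
    using exp_int_periodic[of "m - n" 0] by (simp add: k_def mult.assoc)
  ultimately have "integral {0..2*pi} (\<lambda>x. exp (k * of_real x)) = 0" by (simp add: integral_unique)
  moreover have "exp (\<i> * of_int m * of_real x) * exp (- \<i> * of_int n * of_real x) = exp (k * of_real x)" for x
    by (simp add: k_def exp_add[symmetric] algebra_simps)
  ultimately show ?thesis using False by (simp add: fourier_coeff_def)
qed

lemma fourier_coeff_add:
  assumes "per_hol T f" "per_hol T g" "T > 0"
  shows "fourier_coeff (\<lambda>z. f z + g z) n = fourier_coeff f n + fourier_coeff g n"
proof -
  have i: "(\<lambda>x. f (of_real x) * exp (- \<i> * of_int n * of_real x)) integrable_on {0..2*pi}" if "per_hol T f" for f
    using per_hol_integrable[OF per_hol_mult[OF that per_hol_exp_minus], of 0 n] assms(3)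
    by (simp add: complex_of_real_def)
  show ?thesis unfolding fourier_coeff_def distrib_right
    by (subst integral_add[OF i[OF assms(1)] i[OF assms(2)]]) (simp add: distrib_left)
qed

lemma fourier_coeff_cmult: "fourier_coeff (\<lambda>z. c * f z) n = c * fourier_coeff f n"
  unfolding fourier_coeff_def by (simp add: mult.assoc)

lemma fourier_coeff_diff:
  assumes "per_hol T f" "per_hol T g" "T > 0"
  shows "fourier_coeff (\<lambda>z. f z - g z) n = fourier_coeff f n - fourier_coeff g n"
  using fourier_coeff_add[OF assms(1) per_hol_minus[OF assms(2)] assms(3)] fourier_coeff_cmult[of "-1" g n] by simp

lemma fourier_coeff_cong:
  assumes "\<And>x. f (of_real x) = g (of_real x)" shows "fourier_coeff f n = fourier_coeff g n"
  using assms by (simp add: fourier_coeff_def)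

lemma fourier_coeff_trig_poly:
  assumes "finite F"
  shows "fourier_coeff (\<lambda>z. \<Sum>n\<in>F. c n * exp (\<i> * of_int n * z)) m = (if m \<in> F then c m else 0)"
  using assms
proof (induction F)
  case empty
  show ?case using fourier_coeff_cmult[of 0 "\<lambda>_. 0" m] by simp
next
  case (insert k F)
  have P: "per_hol 1 (\<lambda>z. \<Sum>n\<in>F. c n * exp (\<i> * of_int n * z))"
    by (intro per_hol_sum per_hol_mult per_hol_const per_hol_exp)
  have "fourier_coeff (\<lambda>z. \<Sum>n\<in>insert k F. c n * exp (\<i> * of_int n * z)) m =
      fourier_coeff (\<lambda>z. c k * exp (\<i> * of_int k * z) + (\<Sum>n\<in>F. c n * exp (\<i> * of_int n * z))) m"
    using insert by simp
  also have "\<dots> = c k * (if k = m then 1 else 0) + (if m \<in> F then c m else 0)"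
    by (subst fourier_coeff_add[OF per_hol_mult[OF per_hol_const per_hol_exp] P zero_less_one])
       (simp only: fourier_coeff_cmult fourier_coeff_exp insert.IH)
  finally show ?case using insert by auto
qed

lemma exp_term_bound:
  assumes c: "cmod c \<le> M * exp (- \<bar>of_int n\<bar> * s)" and y: "\<bar>Im z\<bar> \<le> y"
  shows "cmod (c * exp (\<i> * of_int n * z)) \<le> M * exp (- \<bar>of_int n\<bar> * (s - y))"
proof -
  have "- (of_int n * Im z) \<le> \<bar>of_int n\<bar> * \<bar>Im z\<bar>" by (metis abs_ge_minus_self abs_mult)
  also have "\<dots> \<le> \<bar>of_int n\<bar> * y" using y by (intro mult_left_mono) auto
  finally have ne: "cmod (exp (\<i> * of_int n * z)) \<le> exp (\<bar>of_int n\<bar> * y)"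
    by (simp add: norm_exp_eq_Re)
  have "cmod (c * exp (\<i> * of_int n * z)) \<le> (M * exp (- \<bar>of_int n\<bar> * s)) * exp (\<bar>of_int n\<bar> * y)"
    unfolding norm_mult by (rule mult_mono[OF c ne]) (use c norm_ge_zero order_trans in blast, simp)
  thus ?thesis by (simp add: mult.assoc exp_add[symmetric] algebra_simps)
qed

text \<open>Chernoff's proof of pointwise convergence. Multiplication by \<open>exp (\<i> w)\<close> shifts Fourier
  coefficients, so writing \<open>f - f z\<close> as in the preceding lemma makes the \<open>n\<close>-th term of the series of
  \<open>f - f z\<close> at \<open>z\<close> a difference \<open>H (n - 1) - H n\<close>. Symmetric partial sums telescope, and \<open>H\<close> tends to
  \<open>0\<close> because the coefficients of \<open>h\<close> decay exponentially.\<close>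

theorem fourier_series_converges:
  assumes f: "per_hol T f" and z: "z \<in> strip T"
  shows "((\<lambda>n. fourier_coeff f n * exp (\<i> * of_int n * z)) has_sum f z) UNIV"
proof -
  have T: "T > 0" using z by (simp add: strip_def)
  define y where "y = \<bar>Im z\<bar>"
  have y: "0 \<le> y" "y < T" using z by (auto simp: y_def strip_def)
  define s where "s = (y + T) / 2"
  have s: "0 \<le> s" "s < T" "y < s" using y by (auto simp: s_def)
  have single: "cmod (c * exp (\<i> * of_int n * z)) \<le> M * exp (- \<bar>of_int n\<bar> * (s - y))"
    if "cmod c \<le> M * exp (- \<bar>of_int n\<bar> * s)" for c M n
    by (rule exp_term_bound[OF that]) (simp add: y_def)
  have summ: "(\<lambda>n. fourier_coeff f n * exp (\<i> * of_int n * z)) summable_on UNIV"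
  proof -
    obtain M where M: "M > 0" "\<And>n. cmod (fourier_coeff f n) \<le> M * exp (- \<bar>of_int n\<bar> * s)"
      using fourier_coeff_decay[OF f s(1,2)] by blast
    show ?thesis
      by (rule abs_summable_summable, rule summable_on_comparison_test[OF summable_on_cmult_right[OF summable_exp_int]])
         (use single[OF M(2)] s in auto)
  qed
  obtain h where h: "per_hol T h" "\<And>w. w \<in> strip T \<Longrightarrow> f w - f z = (exp (\<i> * (w - z)) - 1) * h w"
    using chernoff_quotient[OF f z] by blast
  define H where "H = (\<lambda>n. fourier_coeff h n * exp (\<i> * of_int n * z))"
  have tele: "fourier_coeff f n * exp (\<i> * of_int n * z) - (if n = 0 then f z else 0) = H (n - 1) - H n" for n
  proof -
    have "fourier_coeff (\<lambda>w. f w - f z) n = fourier_coeff (\<lambda>w. exp (\<i> * (w - z)) * h w - h w) n"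
      by (rule fourier_coeff_cong) (use h(2) T in \<open>auto simp: strip_def algebra_simps\<close>)
    also have "\<dots> = fourier_coeff (\<lambda>w. exp (- \<i> * z) * (exp (\<i> * of_int 1 * w) * h w) - h w) n"
    proof (rule fourier_coeff_cong)
      have "exp (\<i> * (w - z)) = exp (- \<i> * z) * exp (\<i> * of_int 1 * w)" for w
        by (simp add: exp_add[symmetric] algebra_simps)
      thus "exp (\<i> * (of_real x - z)) * h (of_real x) - h (of_real x) =
          exp (- \<i> * z) * (exp (\<i> * of_int 1 * of_real x) * h (of_real x)) - h (of_real x)" for x
        by (simp only: mult.assoc)
    qed
    also have "\<dots> = exp (- \<i> * z) * fourier_coeff (\<lambda>w. exp (\<i> * of_int 1 * w) * h w) n - fourier_coeff h n"
      by (subst fourier_coeff_diff[of T])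
         (auto simp: fourier_coeff_cmult intro!: per_hol_mult per_hol_const h T per_hol_exp[of _ 1, simplified])
    also have "fourier_coeff (\<lambda>w. exp (\<i> * of_int 1 * w) * h w) n = fourier_coeff h (n - 1)"
      unfolding fourier_coeff_def
      by (intro arg_cong[where f = "\<lambda>x. _ * x"] integral_cong) (simp add: exp_add[symmetric] algebra_simps)
    also have "fourier_coeff (\<lambda>w. f w - f z) n = fourier_coeff f n - fourier_coeff (\<lambda>w. f z) n"
      by (rule fourier_coeff_diff[OF f per_hol_const T])
    also have "fourier_coeff (\<lambda>w. f z) n = f z * (if n = 0 then 1 else 0)"
      using fourier_coeff_cmult[of "f z" "\<lambda>w. exp (\<i> * of_int 0 * w)" n] fourier_coeff_exp[of 0 n] by simp
    finally have "fourier_coeff f n = f z * (if n = 0 then 1 else 0) +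
       exp (- \<i> * z) * fourier_coeff h (n - 1) - fourier_coeff h n" by (simp add: algebra_simps)
    hence "fourier_coeff f n * exp (\<i> * of_int n * z) =
        f z * ((if n = 0 then 1 else 0) * exp (\<i> * of_int n * z)) +
        fourier_coeff h (n - 1) * (exp (- \<i> * z) * exp (\<i> * of_int n * z)) - H n"
      by (simp only: H_def) (simp only: algebra_simps)
    moreover have "exp (- \<i> * z) * exp (\<i> * of_int n * z) = exp (\<i> * of_int (n - 1) * z)"
      by (simp add: exp_add[symmetric] algebra_simps)
    ultimately show ?thesis by (simp add: H_def)
  qed
  have part: "(\<Sum>n\<in>symm N. fourier_coeff f n * exp (\<i> * of_int n * z)) = f z + H (- int (Suc N)) - H (int N)" for N
  proof (induction N)
    case 0 show ?case using tele[of 0] by (simp add: algebra_simps)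
  next
    case (Suc N)
    have "symm (Suc N) = insert (int (Suc N)) (insert (- int (Suc N)) (symm N))" by auto
    moreover have "int (Suc N) \<notin> insert (- int (Suc N)) (symm N)" "- int (Suc N) \<notin> symm N" by auto
    ultimately have "(\<Sum>n\<in>symm (Suc N). fourier_coeff f n * exp (\<i> * of_int n * z)) =
       fourier_coeff f (int (Suc N)) * exp (\<i> * of_int (int (Suc N)) * z) +
       (fourier_coeff f (- int (Suc N)) * exp (\<i> * of_int (- int (Suc N)) * z) + (f z + H (- int (Suc N)) - H (int N)))"
      by (simp only: sum.insert finite_insert finite_atLeastAtMost_int Suc not_False_eq_True)
    also have "fourier_coeff f (int (Suc N)) * exp (\<i> * of_int (int (Suc N)) * z) = H (int N) - H (int (Suc N))"
      using tele[of "int (Suc N)"] by simp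
    also have "fourier_coeff f (- int (Suc N)) * exp (\<i> * of_int (- int (Suc N)) * z)
        = H (- int (Suc (Suc N))) - H (- int (Suc N))"
    proof -
      have e: "- int (Suc N) - 1 = - int (Suc (Suc N))" by simp
      show ?thesis using tele[of "- int (Suc N)"] unfolding e by (simp del: of_nat_Suc)
    qed
    finally show ?case by (simp del: of_nat_Suc)
  qed
  obtain M where M: "M > 0" "\<And>n. cmod (fourier_coeff h n) \<le> M * exp (- \<bar>of_int n\<bar> * s)"
    using fourier_coeff_decay[OF h(1) s(1,2)] by blast
  have Hb: "cmod (H n) \<le> M * exp (- \<bar>of_int n\<bar> * (s - y))" for n
    unfolding H_def by (rule single[OF M(2)])
  have elim: "(\<lambda>N::nat. M * exp (- real N * (s - y))) \<longlonglongrightarrow> 0"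
    using s M by real_asymp
  have "(\<lambda>N. H (int N)) \<longlonglongrightarrow> 0"
    by (rule Lim_null_comparison[OF _ elim]) (use Hb[of "int _"] in \<open>auto intro!: always_eventually\<close>)
  moreover have "(\<lambda>N. H (- int (Suc N))) \<longlonglongrightarrow> 0"
  proof (rule Lim_null_comparison[OF _ elim], rule always_eventually, rule allI)
    fix N :: nat
    have "\<bar>real_of_int (- int (Suc N))\<bar> \<ge> real N" by simp
    hence "- \<bar>real_of_int (- int (Suc N))\<bar> * (s - y) \<le> - real N * (s - y)" using s by (intro mult_right_mono) auto
    hence "M * exp (- \<bar>real_of_int (- int (Suc N))\<bar> * (s - y)) \<le> M * exp (- real N * (s - y))" using M(1) by simp
    thus "cmod (H (- int (Suc N))) \<le> M * exp (- real N * (s - y))" using Hb[of "- int (Suc N)"] by linarith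
  qed
  ultimately have "(\<lambda>N. f z + H (- int (Suc N)) - H (int N)) \<longlonglongrightarrow> f z + 0 - 0"
    by (intro tendsto_intros)
  moreover obtain S where S: "((\<lambda>n. fourier_coeff f n * exp (\<i> * of_int n * z)) has_sum S) UNIV"
    using summ by (auto simp: summable_on_def)
  ultimately have "S = f z" using has_sum_imp_symm_limit[OF S] LIMSEQ_unique by (fastforce simp: part)
  thus ?thesis using S by simp
qed

lemma has_sum_finite_sum:
  fixes f :: "'i \<Rightarrow> 'a \<Rightarrow> 'b::topological_comm_monoid_add"
  assumes "\<And>i. i \<in> I \<Longrightarrow> (f i has_sum s i) A"
  shows "((\<lambda>n. \<Sum>i\<in>I. f i n) has_sum (\<Sum>i\<in>I. s i)) A"
  using assms
proof (induction I rule: infinite_finite_induct)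
  case (insert x F)
  have "((\<lambda>n. f x n + (\<Sum>i\<in>F. f i n)) has_sum (s x + (\<Sum>i\<in>F. s i))) A"
    by (rule has_sum_add) (use insert in auto)
  thus ?case using insert by simp
qed auto

lemma cnj_exp_line: "cnj (exp (\<i> * of_int n * Complex x \<tau>)) =
    exp (- \<i> * of_int n * Complex x \<tau>) * of_real (exp (- 2 * of_int n * \<tau>))"
proof -
  have "cnj (\<i> * of_int n * Complex x \<tau>) = - \<i> * of_int n * Complex x \<tau> + of_real (- 2 * of_int n * \<tau>)"
    by (simp add: complex_eq_iff)
  thus ?thesis by (simp only: exp_cnj exp_add exp_of_real)
qed

text \<open>On the line \<open>Im z = \<tau>\<close> the exponentials \<open>exp (\<i> n z)\<close> are orthogonal with squared norm
  \<open>2 \<pi> exp (- 2 n \<tau>)\<close>; the partial sums converge uniformly on the line, and by Pythagoras (\<open>split\<close>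
  below) the missing energy is that of the remainder.\<close>

theorem parseval_line:
  assumes f: "per_hol T f" and \<tau>: "\<bar>\<tau>\<bar> < T"
  shows "((\<lambda>n. (cmod (fourier_coeff f n))\<^sup>2 * exp (- 2 * of_int n * \<tau>)) has_sum
     (1 / (2 * pi) * integral {0..2*pi} (\<lambda>x. (cmod (f (Complex x \<tau>)))\<^sup>2))) UNIV"
proof -
  have T: "T > 0" using \<tau> by linarith
  define c where "c = fourier_coeff f"
  define e where "e = (\<lambda>n z. exp (\<i> * of_int n * z))"
  define ip where "ip = (\<lambda>f g. integral {0..2*pi} (\<lambda>x. f (Complex x \<tau>) * cnj (g (Complex x \<tau>))))"
  define P where "P = (\<lambda>F z. \<Sum>n\<in>F. c n * e n z)"
  define S where "S = (\<lambda>F. \<Sum>n\<in>F. (cmod (c n))\<^sup>2 * exp (- 2 * of_int n * \<tau>))"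
  define I where "I = (\<lambda>g. integral {0..2*pi} (\<lambda>x. (cmod (g (Complex x \<tau>)))\<^sup>2))"
  have perP: "per_hol T (P F)" for F unfolding P_def e_def
    by (intro per_hol_sum per_hol_mult per_hol_const per_hol_exp)
  have cont: "continuous_on {0..2*pi} (\<lambda>x. g (Complex x \<tau>))" if "per_hol T g" for g
    using that \<tau> continuous_on_line unfolding per_hol_def by blast
  have ip_e: "ip g (e n) = 2 * of_real pi * fourier_coeff g n * of_real (exp (- 2 * of_int n * \<tau>))"
    if "per_hol T g" for g n
  proof -
    have "ip g (e n) = integral {0..2*pi} (\<lambda>x. (g (Complex x \<tau>) * exp (- \<i> * of_int n * Complex x \<tau>))
         * of_real (exp (- 2 * of_int n * \<tau>)))"
      unfolding ip_def e_def cnj_exp_line by (simp only: mult.assoc)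
    also have "\<dots> = integral {0..2*pi} (\<lambda>x. g (Complex x \<tau>) * exp (- \<i> * of_int n * Complex x \<tau>))
         * of_real (exp (- 2 * of_int n * \<tau>))"
      by (rule integral_mult_left)
    finally show ?thesis unfolding fourier_coeff_on_line[OF that \<tau>] by (simp add: mult_ac)
  qed
  have ip_P: "ip g (P F) = (\<Sum>n\<in>F. cnj (c n) * ip g (e n))" if g: "per_hol T g" and F: "finite F" for g F
  proof -
    have "ip g (P F) = integral {0..2*pi} (\<lambda>x. \<Sum>n\<in>F. cnj (c n) * (g (Complex x \<tau>) * cnj (e n (Complex x \<tau>))))"
      unfolding ip_def P_def by (simp add: sum_distrib_left mult_ac)
    also have "\<dots> = (\<Sum>n\<in>F. integral {0..2*pi} (\<lambda>x. cnj (c n) * (g (Complex x \<tau>) * cnj (e n (Complex x \<tau>)))))"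
    proof (rule integral_sum[OF F])
      fix n assume "n \<in> F"
      have "per_hol T (e n)" unfolding e_def by (rule per_hol_exp)
      thus "(\<lambda>x. cnj (c n) * (g (Complex x \<tau>) * cnj (e n (Complex x \<tau>)))) integrable_on {0..2*pi}"
        by (intro integrable_continuous_interval continuous_intros cont g)
    qed
    finally show ?thesis by (simp add: ip_def)
  qed
  have fc_P: "fourier_coeff (P F) n = (if n \<in> F then c n else 0)" if "finite F" for F n
    unfolding P_def e_def by (rule fourier_coeff_trig_poly[OF that])
  have split: "I f = I (\<lambda>z. f z - P F z) + 2 * pi * S F" if F: "finite F" for F
  proof -
    let ?d = "\<lambda>z. f z - P F z"
    have d: "per_hol T ?d" by (rule per_hol_diff[OF f perP])
    have "ip ?d (P F) = 0"
      unfolding ip_P[OF d F] ip_e[OF d] using F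
      by (intro sum.neutral) (simp add: fourier_coeff_diff[OF f perP T] fc_P c_def)
    moreover have "ip (P F) (P F) = of_real (2 * pi * S F)"
    proof -
      have "ip (P F) (P F) = (\<Sum>n\<in>F. of_real (2 * pi * ((cmod (c n))\<^sup>2 * exp (- 2 * of_int n * \<tau>))))"
        unfolding ip_P[OF perP F] ip_e[OF perP]
      proof (rule sum.cong[OF refl])
        fix n assume "n \<in> F"
        show "cnj (c n) * (2 * of_real pi * fourier_coeff (P F) n * of_real (exp (- 2 * of_int n * \<tau>)))
           = of_real (2 * pi * ((cmod (c n))\<^sup>2 * exp (- 2 * of_int n * \<tau>)))"
        proof -
          have "cnj (c n) * (2 * of_real pi * c n * of_real (exp (- 2 * of_int n * \<tau>)))
              = 2 * of_real pi * ((c n * cnj (c n)) * of_real (exp (- 2 * of_int n * \<tau>)))" by (simp only: mult_ac)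
          also have "c n * cnj (c n) = of_real ((cmod (c n))\<^sup>2)" by (simp only: complex_norm_square)
          finally show ?thesis using \<open>n \<in> F\<close> by (simp add: fc_P[OF F])
        qed
      qed
      thus ?thesis by (simp add: S_def sum_distrib_left)
    qed
    moreover have "(\<lambda>x. ?d (Complex x \<tau>) * cnj (P F (Complex x \<tau>))) integrable_on {0..2*pi}"
      "(\<lambda>x. P F (Complex x \<tau>) * cnj (P F (Complex x \<tau>))) integrable_on {0..2*pi}"
      by (intro integrable_continuous_interval continuous_intros cont d f perP)+
    ultimately have re: "integral {0..2*pi} (\<lambda>x. Re (?d (Complex x \<tau>) * cnj (P F (Complex x \<tau>)))) = 0"
      and PP: "integral {0..2*pi} (\<lambda>x. Re (P F (Complex x \<tau>) * cnj (P F (Complex x \<tau>)))) = 2 * pi * S F"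
      using integral_linear[OF _ bounded_linear_Re, unfolded o_def] unfolding ip_def by (metis Re_complex_of_real zero_complex.sel(1))+
    have cross: "integral {0..2*pi} (\<lambda>x. 2 * Re (?d (Complex x \<tau>) * cnj (P F (Complex x \<tau>)))) = 0"
      unfolding integral_mult_right re by simp
    have "I f = integral {0..2*pi} (\<lambda>x. (cmod (?d (Complex x \<tau>)))\<^sup>2 +
          (2 * Re (?d (Complex x \<tau>) * cnj (P F (Complex x \<tau>))) + Re (P F (Complex x \<tau>) * cnj (P F (Complex x \<tau>)))))"
    proof -
      have "(cmod a)\<^sup>2 = (cmod (a - b))\<^sup>2 + (2 * Re ((a - b) * cnj b) + Re (b * cnj b))" for a b
        unfolding cmod_power2 by (simp add: power2_eq_square algebra_simps)
      thus ?thesis unfolding I_def by (intro integral_cong)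
    qed
    also have "\<dots> = I ?d + (0 + 2 * pi * S F)"
    proof -
      have A1: "(\<lambda>x. (cmod (?d (Complex x \<tau>)))\<^sup>2) integrable_on {0..2*pi}"
        by (intro integrable_continuous_interval continuous_intros cont d f perP)
      have A2: "(\<lambda>x. 2 * Re (?d (Complex x \<tau>) * cnj (P F (Complex x \<tau>)))) integrable_on {0..2*pi}"
        by (intro integrable_continuous_interval continuous_intros cont d f perP)
      have A3: "(\<lambda>x. Re (P F (Complex x \<tau>) * cnj (P F (Complex x \<tau>)))) integrable_on {0..2*pi}"
        by (intro integrable_continuous_interval continuous_intros cont d f perP)
      show ?thesis unfolding integral_add[OF A1 integrable_add[OF A2 A3]] integral_add[OF A2 A3] cross PP I_def ..
    qed
    finally show ?thesis by simp
  qed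
  obtain M where M: "M > 0" "\<And>n. cmod (c n) \<le> M * exp (- \<bar>of_int n\<bar> * ((\<bar>\<tau>\<bar> + T) / 2))"
    unfolding c_def by (rule fourier_coeff_decay[OF f, of "(\<bar>\<tau>\<bar> + T) / 2"]) (use \<tau> in auto)
  have ul: "uniform_limit {z. \<bar>Im z\<bar> \<le> \<bar>\<tau>\<bar>} P f (finite_subsets_at_top UNIV)"
    unfolding P_def e_def
  proof (rule Weierstrass_m_test_general')
    fix n :: int and z assume "z \<in> {z. \<bar>Im z\<bar> \<le> \<bar>\<tau>\<bar>}"
    thus "cmod (c n * exp (\<i> * of_int n * z)) \<le> M * exp (- \<bar>of_int n\<bar> * ((\<bar>\<tau>\<bar> + T) / 2 - \<bar>\<tau>\<bar>))"
      by (intro exp_term_bound M) simp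
  next
    fix z assume "z \<in> {z. \<bar>Im z\<bar> \<le> \<bar>\<tau>\<bar>}"
    thus "((\<lambda>n. c n * exp (\<i> * of_int n * z)) has_sum f z) UNIV"
      unfolding c_def using \<tau> by (intro fourier_series_converges[OF f]) (auto simp: strip_def)
  next
    show "(\<lambda>n::int. M * exp (- \<bar>of_int n\<bar> * ((\<bar>\<tau>\<bar> + T) / 2 - \<bar>\<tau>\<bar>))) summable_on UNIV"
      by (intro summable_on_cmult_right summable_exp_int) (use \<tau> in \<open>simp add: field_simps\<close>)
  qed
  have "(S \<longlongrightarrow> 1 / (2 * pi) * I f) (finite_subsets_at_top UNIV)"
  proof (rule tendstoI)
    fix r :: real assume r: "r > 0"
    have "eventually (\<lambda>F. \<forall>z\<in>{z. \<bar>Im z\<bar> \<le> \<bar>\<tau>\<bar>}. dist (P F z) (f z) < sqrt (r/2)) (finite_subsets_at_top UNIV)"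
      by (rule uniform_limitD[OF ul]) (use r in simp)
    moreover have "eventually finite (finite_subsets_at_top (UNIV :: int set))"
      by (rule eventually_finite_subsets_at_top_weakI) auto
    ultimately show "eventually (\<lambda>F. dist (S F) (1 / (2 * pi) * I f) < r) (finite_subsets_at_top UNIV)"
    proof eventually_elim
      case (elim F)
      have b: "(cmod (f (Complex x \<tau>) - P F (Complex x \<tau>)))\<^sup>2 \<le> r / 2" for x
      proof -
        have "cmod (f (Complex x \<tau>) - P F (Complex x \<tau>)) \<le> sqrt (r/2)"
          using elim(1)[rule_format, of "Complex x \<tau>"] by (simp add: dist_norm norm_minus_commute)
        hence "(cmod (f (Complex x \<tau>) - P F (Complex x \<tau>)))\<^sup>2 \<le> (sqrt (r/2))\<^sup>2" by (intro power_mono) auto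
        thus ?thesis using r by simp
      qed
      have "norm (I (\<lambda>z. f z - P F z)) \<le> r / 2 * (2 * pi - 0)"
        unfolding I_def
        by (rule integral_bound) (use b in \<open>auto intro!: continuous_intros cont per_hol_diff[OF f perP]\<close>)
      moreover have "1 / (2 * pi) * I f - S F = 1 / (2 * pi) * I (\<lambda>z. f z - P F z)"
        unfolding split[OF elim(2)] by (simp add: field_simps)
      ultimately have "\<bar>1 / (2 * pi) * I f - S F\<bar> \<le> r / 2"
        by (simp add: abs_mult field_simps)
      thus ?case using r unfolding dist_real_def by linarith
    qed
  qed
  thus ?thesis unfolding has_sum_def S_def I_def c_def .
qed

lemma exp_series_per_hol:
  fixes c :: "int \<Rightarrow> complex"
  assumes T: "T > 0" and c: "\<And>n. cmod (c n) \<le> M * exp (- \<bar>of_int n\<bar> * T)"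
  defines "g \<equiv> \<lambda>z. \<Sum>\<^sub>\<infinity>n. c n * exp (\<i> * of_int n * z)"
  shows "per_hol T g" "\<And>z. z \<in> strip T \<Longrightarrow> ((\<lambda>n. c n * exp (\<i> * of_int n * z)) has_sum g z) UNIV"
    "fourier_coeff g n = c n"
proof -
  define P where "P = (\<lambda>F z. \<Sum>n\<in>F. c n * exp (\<i> * of_int n * z))"
  have perP: "per_hol T (P F)" for F unfolding P_def
    by (intro per_hol_sum per_hol_mult per_hol_const per_hol_exp)
  have M0: "M \<ge> 0" using c[of 0] by (simp add: order_trans[OF norm_ge_zero])
  have summ: "(\<lambda>n::int. M * exp (- \<bar>of_int n\<bar> * (T - y))) summable_on UNIV" if "y < T" for y
    by (intro summable_on_cmult_right summable_exp_int) (use that in simp)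
  have ul: "uniform_limit {z. \<bar>Im z\<bar> \<le> y} P g (finite_subsets_at_top UNIV)" if "y < T" for y
    unfolding P_def g_def
    by (rule Weierstrass_m_test_general[OF _ summ[OF that]], rule exp_term_bound[OF c]) simp
  show hs: "((\<lambda>n. c n * exp (\<i> * of_int n * z)) has_sum g z) UNIV" if "z \<in> strip T" for z
  proof -
    have y: "\<bar>Im z\<bar> < T" using that by (auto simp: strip_def)
    have "(\<lambda>n. c n * exp (\<i> * of_int n * z)) summable_on UNIV"
    proof (rule abs_summable_summable, rule summable_on_comparison_test[OF summ[OF y]])
      fix n
      show "cmod (c n * exp (\<i> * of_int n * z)) \<le> M * exp (- \<bar>of_int n\<bar> * (T - \<bar>Im z\<bar>))"
        by (rule exp_term_bound[OF c]) simp
    qed auto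
    thus ?thesis unfolding g_def by (rule has_sum_infsum)
  qed
  have uls: "uniform_limit {z. \<bar>Im z\<bar> \<le> y} (\<lambda>N. P (symm N)) g sequentially" if "y < T" for y
    by (rule filterlim_compose[OF ul[OF that] filterlim_symm])
  have "g holomorphic_on strip T"
  proof (rule holomorphic_uniform_sequence[OF open_strip])
    show "P (symm N) holomorphic_on strip T" for N using perP by (simp add: per_hol_def)
    fix z assume z: "z \<in> strip T"
    define y where "y = (\<bar>Im z\<bar> + T) / 2"
    have y: "\<bar>Im z\<bar> < y" "y < T" using z by (auto simp: y_def strip_def abs_if)
    have sub: "cball z (y - \<bar>Im z\<bar>) \<subseteq> {z. \<bar>Im z\<bar> \<le> y}"
    proof
      fix w assume "w \<in> cball z (y - \<bar>Im z\<bar>)"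
      hence "cmod (z - w) \<le> y - \<bar>Im z\<bar>" by (simp add: dist_norm)
      moreover have "\<bar>Im z - Im w\<bar> \<le> cmod (z - w)" using abs_Im_le_cmod[of "z - w"] by simp
      ultimately show "w \<in> {z. \<bar>Im z\<bar> \<le> y}" by auto
    qed
    show "\<exists>d>0. cball z d \<subseteq> strip T \<and> uniform_limit (cball z d) (\<lambda>N. P (symm N)) g sequentially"
      by (rule exI[of _ "y - \<bar>Im z\<bar>"])
         (use y sub uniform_limit_on_subset[OF uls[OF y(2)] sub] in \<open>force simp: strip_def\<close>)
  qed
  moreover have "g (z + 2 * of_real pi) = g z" for z unfolding g_def exp_int_periodic ..
  ultimately show g: "per_hol T g" by (simp add: per_hol_def)
  show "fourier_coeff g n = c n"
  proof -
    have "(\<lambda>N. fourier_coeff (P (symm N)) n) \<longlonglongrightarrow> fourier_coeff g n"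
    proof (rule tendstoI)
      fix r :: real assume r: "r > 0"
      have "eventually (\<lambda>N. \<forall>z\<in>{z. \<bar>Im z\<bar> \<le> 0}. dist (P (symm N) z) (g z) < r/2) sequentially"
        by (rule uniform_limitD[OF uls[OF T]]) (use r in simp)
      thus "eventually (\<lambda>N. dist (fourier_coeff (P (symm N)) n) (fourier_coeff g n) < r) sequentially"
      proof eventually_elim
        case (elim N)
        have "cmod (fourier_coeff (\<lambda>z. P (symm N) z - g z) n) \<le> (r/2) * exp (of_int n * 0)"
          by (rule fourier_coeff_bound_line[OF per_hol_diff[OF perP g]])
             (use elim T in \<open>auto simp: dist_norm less_imp_le\<close>)
        thus ?case using r by (simp add: dist_norm fourier_coeff_diff[OF perP g T])
      qed
    qed
    moreover have fcP: "fourier_coeff (P F) n = (if n \<in> F then c n else 0)" if "finite F" for F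
      unfolding P_def by (rule fourier_coeff_trig_poly[OF that])
    moreover have "(\<lambda>N. if n \<in> symm N then c n else 0) \<longlonglongrightarrow> c n"
    proof (rule tendsto_eventually)
      have "eventually (\<lambda>N. N \<ge> nat \<bar>n\<bar>) sequentially" by (rule eventually_ge_at_top)
      thus "eventually (\<lambda>N. (if n \<in> symm N then c n else 0) = c n) sequentially"
        by eventually_elim auto
    qed
    ultimately show ?thesis using LIMSEQ_unique by (simp add: fcP) blast
  qed
qed

section \<open>The Hardy space of the strip as a sequence space\<close>

definition vper_hol :: "real \<Rightarrow> (complex \<Rightarrow> complex ^ 'k) \<Rightarrow> bool" where
  "vper_hol T w \<longleftrightarrow> (\<forall>i. per_hol T (\<lambda>z. w z $ i))"

definition vcoef :: "(complex \<Rightarrow> complex ^ 'k) \<Rightarrow> int \<Rightarrow> complex ^ 'k" where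
  "vcoef w n = (\<chi> i. fourier_coeff (\<lambda>z. w z $ i) n)"

text \<open>The square of the \<open>L\<^sup>2\<close> norm over one period of the line \<open>Im z = \<tau>\<close>. All estimates in the strip are
  made on such lines with constants independent of \<open>\<tau>\<close>, so that boundary values at \<open>\<bar>\<tau>\<bar> = T\<close> never
  have to be considered.\<close>

definition line_energy :: "real \<Rightarrow> (complex \<Rightarrow> complex ^ 'k) \<Rightarrow> real" where
  "line_energy \<tau> w = integral {0..2*pi} (\<lambda>x. (norm (w (Complex x \<tau>)))\<^sup>2)"

lemma norm_vec_square: "(norm (v :: complex ^ 'k))\<^sup>2 = (\<Sum>i\<in>UNIV. (cmod (v $ i))\<^sup>2)"
  by (simp add: norm_vec_def L2_set_def sum_nonneg)

lemma continuous_on_line_vec: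
  assumes "vper_hol T w" "\<bar>\<tau>\<bar> < T"
  shows "continuous_on A (\<lambda>x. w (Complex x \<tau>))"
proof -
  have "continuous_on A (\<lambda>x. \<chi> i. w (Complex x \<tau>) $ i)"
  proof (rule continuous_on_vec_lambda)
    fix i
    have "(\<lambda>z. w z $ i) holomorphic_on strip T" using assms(1) by (simp add: vper_hol_def per_hol_def)
    thus "continuous_on A (\<lambda>x. w (Complex x \<tau>) $ i)" using assms(2) by (rule continuous_on_line)
  qed
  thus ?thesis by simp
qed

lemma line_energy_nonneg: "line_energy \<tau> w \<ge> 0"
  unfolding line_energy_def by (cases "(\<lambda>x. (norm (w (Complex x \<tau>)))\<^sup>2) integrable_on {0..2*pi}")
    (auto intro: integral_nonneg simp: not_integrable_integral)

lemma parseval_line_vec: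
  assumes w: "vper_hol T w" and \<tau>: "\<bar>\<tau>\<bar> < T"
  shows "((\<lambda>n. (norm (vcoef w n))\<^sup>2 * exp (- 2 * of_int n * \<tau>)) has_sum (line_energy \<tau> w / (2 * pi))) UNIV"
proof -
  have "((\<lambda>n. \<Sum>i\<in>UNIV. (cmod (fourier_coeff (\<lambda>z. w z $ i) n))\<^sup>2 * exp (- 2 * of_int n * \<tau>)) has_sum
     (\<Sum>i\<in>UNIV. 1 / (2 * pi) * integral {0..2*pi} (\<lambda>x. (cmod (w (Complex x \<tau>) $ i))\<^sup>2))) UNIV"
    using w \<tau> by (intro has_sum_finite_sum parseval_line) (auto simp: vper_hol_def)
  moreover have "(\<Sum>i\<in>UNIV. 1 / (2 * pi) * integral {0..2*pi} (\<lambda>x. (cmod (w (Complex x \<tau>) $ i))\<^sup>2))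
      = line_energy \<tau> w / (2 * pi)"
  proof -
    have "line_energy \<tau> w = (\<Sum>i\<in>UNIV. integral {0..2*pi} (\<lambda>x. (cmod (w (Complex x \<tau>) $ i))\<^sup>2))"
      unfolding line_energy_def norm_vec_square
      by (rule integral_sum) (auto intro!: integrable_continuous_interval continuous_intros continuous_on_line_vec[OF w \<tau>])
    thus ?thesis by (simp add: sum_divide_distrib)
  qed
  ultimately show ?thesis by (simp add: vcoef_def norm_vec_square sum_distrib_right)
qed

text \<open>The square is the weight in the norm of the Hardy space.\<close>

definition weight :: "real \<Rightarrow> int \<Rightarrow> real" where
  "weight T n = sqrt (cosh (2 * of_int n * T))"

lemma weight_pos: "weight T n > 0"
  by (simp add: weight_def)

lemma weight_square: "(weight T n)\<^sup>2 = cosh (2 * of_int n * T)"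
  by (simp add: weight_def)

lemma exp_abs_le_cosh: "exp \<bar>x::real\<bar> \<le> 2 * cosh x"
  by (cases "x \<ge> 0") (auto simp: cosh_def)

lemma exp_le_weight:
  assumes "T \<ge> 0" shows "exp (\<bar>of_int n\<bar> * T) \<le> sqrt 2 * weight T n"
proof -
  have "(exp (\<bar>of_int n\<bar> * T))\<^sup>2 = exp \<bar>2 * of_int n * T\<bar>"
    using assms by (simp add: exp_double[symmetric] abs_mult)
  also have "\<dots> \<le> 2 * cosh (2 * of_int n * T)" by (rule exp_abs_le_cosh)
  also have "\<dots> = (sqrt 2 * weight T n)\<^sup>2" by (simp add: power_mult_distrib weight_square)
  finally show ?thesis by (rule power2_le_imp_le) (simp add: weight_pos less_imp_le)
qed

lemma exp_line_le_weight:
  assumes "\<bar>\<tau>\<bar> < T" shows "exp (- 2 * of_int n * \<tau>) \<le> 2 * (weight T n)\<^sup>2"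
proof -
  have "- 2 * of_int n * \<tau> \<le> \<bar>2 * of_int n * \<tau>\<bar>" by (simp add: abs_if)
  also have "\<dots> = \<bar>2 * of_int n\<bar> * \<bar>\<tau>\<bar>" by (rule abs_mult)
  also have "\<dots> \<le> \<bar>2 * of_int n\<bar> * T" using assms by (intro mult_left_mono) auto
  also have "\<dots> = \<bar>2 * of_int n * T\<bar>" using assms by (simp add: abs_mult)
  finally have "exp (- 2 * of_int n * \<tau>) \<le> exp \<bar>2 * of_int n * T\<bar>" by simp
  also have "\<dots> \<le> 2 * (weight T n)\<^sup>2" unfolding weight_square by (rule exp_abs_le_cosh)
  finally show ?thesis .
qed

text \<open>The isometry from square summable sequences onto the Hardy space. It fixes values outside the strip
  arbitrarily; identities for it are therefore always stated on the strip.\<close>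

definition hardy_fun :: "real \<Rightarrow> (complex ^ 'k) ell2 \<Rightarrow> complex \<Rightarrow> complex ^ 'k" where
  "hardy_fun T u z = (\<chi> i. \<Sum>\<^sub>\<infinity>n. Rep_ell2 u n $ i / of_real (weight T n) * exp (\<i> * of_int n * z))"

lemma hardy_coeff_bound:
  assumes "T \<ge> 0"
  shows "cmod (Rep_ell2 u n $ i / of_real (weight T n)) \<le> sqrt 2 * norm u * exp (- \<bar>of_int n\<bar> * T)"
proof -
  have "cmod (Rep_ell2 u n $ i) \<le> norm (Rep_ell2 u n)" by (rule Finite_Cartesian_Product.norm_nth_le)
  also have "\<dots> \<le> norm u" by (rule norm_Rep_ell2_le)
  finally have 1: "cmod (Rep_ell2 u n $ i) \<le> norm u" .
  have "1 / weight T n \<le> sqrt 2 * exp (- \<bar>of_int n\<bar> * T)"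
    using exp_le_weight[OF assms, of n] weight_pos[of T n] by (simp add: exp_minus field_simps)
  hence "cmod (Rep_ell2 u n $ i) * (1 / weight T n) \<le> norm u * (sqrt 2 * exp (- \<bar>of_int n\<bar> * T))"
    using 1 weight_pos[of T n] by (intro mult_mono) auto
  thus ?thesis using weight_pos[of T n] by (simp add: norm_divide mult_ac)
qed

lemma hardy_fun_props:
  fixes u :: "(complex ^ 'k) ell2"
  assumes T: "T > 0"
  shows "vper_hol T (hardy_fun T u)"
    "z \<in> strip T \<Longrightarrow> ((\<lambda>n. Rep_ell2 u n $ i / of_real (weight T n) * exp (\<i> * of_int n * z)) has_sum hardy_fun T u z $ i) UNIV"
    "vcoef (hardy_fun T u) n = (1 / weight T n) *\<^sub>R Rep_ell2 u n"
proof -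
  note e = exp_series_per_hol[OF T hardy_coeff_bound[OF less_imp_le[OF T], of u]]
  show "vper_hol T (hardy_fun T u)" unfolding vper_hol_def hardy_fun_def vec_lambda_beta
    by (rule allI) (rule e(1))
  show "((\<lambda>n. Rep_ell2 u n $ i / of_real (weight T n) * exp (\<i> * of_int n * z)) has_sum hardy_fun T u z $ i) UNIV"
    if "z \<in> strip T" unfolding hardy_fun_def vec_lambda_beta by (rule e(2)[OF that])
  have "fourier_coeff (\<lambda>z. hardy_fun T u z $ i) n = Rep_ell2 u n $ i / of_real (weight T n)" for i
    unfolding hardy_fun_def vec_lambda_beta by (rule e(3))
  thus "vcoef (hardy_fun T u) n = (1 / weight T n) *\<^sub>R Rep_ell2 u n"
    unfolding vcoef_def by (simp add: vec_eq_iff complex_eq_iff)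
qed

lemma hardy_fun_add:
  assumes "T > 0" "z \<in> strip T"
  shows "hardy_fun T (u + v) z = hardy_fun T u z + hardy_fun T v z"
proof -
  have "hardy_fun T (u + v) z $ i = hardy_fun T u z $ i + hardy_fun T v z $ i" for i
    using has_sum_add[OF hardy_fun_props(2)[OF assms, of u i] hardy_fun_props(2)[OF assms, of v i]]
      hardy_fun_props(2)[OF assms, of "u + v" i]
    by (simp add: plus_ell2.rep_eq add_divide_distrib distrib_right) (rule has_sum_unique)
  thus ?thesis by (simp add: vec_eq_iff)
qed

lemma hardy_fun_scale:
  assumes "T > 0" "z \<in> strip T"
  shows "hardy_fun T (scaleC c u) z = c *s hardy_fun T u z"
proof -
  have "hardy_fun T (scaleC c u) z $ i = c * hardy_fun T u z $ i" for i
    using has_sum_cmult_right[OF hardy_fun_props(2)[OF assms, of u i], of c]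
      hardy_fun_props(2)[OF assms, of "scaleC c u" i]
    by (simp add: scaleC.rep_eq mult.assoc) (rule has_sum_unique)
  thus ?thesis by (simp add: vec_eq_iff)
qed

lemma hardy_fun_diff:
  assumes "T > 0" "z \<in> strip T"
  shows "hardy_fun T (u - v) z = hardy_fun T u z - hardy_fun T v z"
  using hardy_fun_add[OF assms, of "u - v" v] by simp

lemma vcoef_cong: "(\<And>x. f (of_real x) = g (of_real x)) \<Longrightarrow> vcoef f n = vcoef g n"
  unfolding vcoef_def by (simp add: vec_eq_iff fourier_coeff_def)

lemma of_real_in_strip: "T > 0 \<Longrightarrow> of_real x \<in> strip T"
  by (simp add: strip_def)

lemma hardy_fun_eqI:
  assumes T: "T > 0" and eq: "\<And>z. z \<in> strip T \<Longrightarrow> hardy_fun T u z = hardy_fun T v z"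
  shows "u = v"
proof -
  have "(1 / weight T n) *\<^sub>R Rep_ell2 u n = (1 / weight T n) *\<^sub>R Rep_ell2 v n" for n
    unfolding hardy_fun_props(3)[OF T, symmetric] by (rule vcoef_cong) (rule eq[OF of_real_in_strip[OF T]])
  hence "Rep_ell2 u n = Rep_ell2 v n" for n
    using weight_pos[of T n] by (metis divide_eq_0_iff less_irrefl scaleR_cancel_left zero_neq_one)
  thus ?thesis by (metis Rep_ell2_inject ext)
qed

lemma line_energy_hardy_fun:
  assumes \<tau>: "\<bar>\<tau>\<bar> < T" shows "line_energy \<tau> (hardy_fun T u) \<le> 4 * pi * (norm u)\<^sup>2"
proof -
  have T: "T > 0" using \<tau> by linarith
  have "line_energy \<tau> (hardy_fun T u) / (2 * pi) \<le> 2 * (norm u)\<^sup>2"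
  proof (rule has_sum_mono[OF parseval_line_vec[OF hardy_fun_props(1)[OF T] \<tau>]])
    show "((\<lambda>n. 2 * (norm (Rep_ell2 u n))\<^sup>2) has_sum 2 * (norm u)\<^sup>2) UNIV"
      unfolding norm_ell2_square by (intro has_sum_cmult_right has_sum_infsum ell2_summable)
    fix n
    have "(norm (vcoef (hardy_fun T u) n))\<^sup>2 * exp (- 2 * of_int n * \<tau>)
        \<le> (norm (vcoef (hardy_fun T u) n))\<^sup>2 * (2 * (weight T n)\<^sup>2)"
      by (intro mult_left_mono exp_line_le_weight \<tau>) auto
    also have "\<dots> = 2 * (norm (Rep_ell2 u n))\<^sup>2"
      using weight_pos[of T n] by (simp add: hardy_fun_props(3)[OF T] power_mult_distrib power_divide)
    finally show "(norm (vcoef (hardy_fun T u) n))\<^sup>2 * exp (- 2 * of_int n * \<tau>) \<le> 2 * (norm (Rep_ell2 u n))\<^sup>2" .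
  qed
  thus ?thesis by (simp add: field_simps)
qed

text \<open>The mean of the Parseval identities on the lines \<open>\<tau>\<close> and \<open>- \<tau>\<close> has the weight \<open>cosh (2 n \<tau>)\<close>; for a
  finite set of indices one can let \<open>\<tau>\<close> tend to \<open>T\<close>.\<close>

lemma bounded_line_energy_coeffs:
  assumes T: "T > 0" and w: "vper_hol T w" and M: "\<And>\<tau>. \<bar>\<tau>\<bar> < T \<Longrightarrow> line_energy \<tau> w \<le> M" and F: "finite F"
  shows "(\<Sum>n\<in>F. (weight T n)\<^sup>2 * (norm (vcoef w n))\<^sup>2) \<le> M / (2 * pi)"
proof -
  have le: "(\<Sum>n\<in>F. (norm (vcoef w n))\<^sup>2 * cosh (2 * of_int n * \<tau>)) \<le> M / (2 * pi)"
    if \<tau>: "\<bar>\<tau>\<bar> < T" for \<tau>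
  proof -
    have half: "(\<Sum>n\<in>F. (norm (vcoef w n))\<^sup>2 * exp (- 2 * of_int n * \<sigma>)) \<le> M / (2 * pi)" if "\<bar>\<sigma>\<bar> < T" for \<sigma>
    proof -
      have "(\<Sum>n\<in>F. (norm (vcoef w n))\<^sup>2 * exp (- 2 * of_int n * \<sigma>)) \<le> line_energy \<sigma> w / (2 * pi)"
        by (rule finite_sum_le_has_sum[OF parseval_line_vec[OF w that] F]) auto
      also have "\<dots> \<le> M / (2 * pi)" using M[OF that] by (simp add: divide_right_mono)
      finally show ?thesis .
    qed
    have "2 * (\<Sum>n\<in>F. (norm (vcoef w n))\<^sup>2 * cosh (2 * of_int n * \<tau>)) =
       (\<Sum>n\<in>F. (norm (vcoef w n))\<^sup>2 * exp (- 2 * of_int n * \<tau>)) +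
       (\<Sum>n\<in>F. (norm (vcoef w n))\<^sup>2 * exp (- 2 * of_int n * (- \<tau>)))"
      unfolding sum_distrib_left sum.distrib[symmetric]
      by (intro sum.cong refl) (simp add: cosh_def algebra_simps)
    thus ?thesis using half[of \<tau>] half[of "-\<tau>"] \<tau> by simp
  qed
  have "((\<lambda>\<tau>. \<Sum>n\<in>F. (norm (vcoef w n))\<^sup>2 * cosh (2 * of_int n * \<tau>)) \<longlongrightarrow>
      (\<Sum>n\<in>F. (norm (vcoef w n))\<^sup>2 * cosh (2 * of_int n * T))) (at_left T)"
    by (intro tendsto_intros)
  moreover have "eventually (\<lambda>\<tau>. (\<Sum>n\<in>F. (norm (vcoef w n))\<^sup>2 * cosh (2 * of_int n * \<tau>)) \<le> M / (2 * pi)) (at_left T)"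
    using eventually_at_left_real[OF T] by eventually_elim (use le in auto)
  ultimately have "(\<Sum>n\<in>F. (norm (vcoef w n))\<^sup>2 * cosh (2 * of_int n * T)) \<le> M / (2 * pi)"
    by (rule tendsto_upperbound) auto
  thus ?thesis by (simp add: weight_square mult.commute)
qed

text \<open>The converse of \<open>line_energy_hardy_fun\<close>: periodic holomorphic functions with bounded energies on all
  lines belong to the Hardy space. This is how functions obtained from estimates are recognized as
  elements of the space.\<close>

lemma hardy_fun_exists:
  assumes T: "T > 0" and w: "vper_hol T w" and M: "\<And>\<tau>. \<bar>\<tau>\<bar> < T \<Longrightarrow> line_energy \<tau> w \<le> M"
  obtains u where "\<And>z. z \<in> strip T \<Longrightarrow> hardy_fun T u z = w z" "(norm u)\<^sup>2 \<le> M / (2 * pi)"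
proof -
  define a where "a = (\<lambda>n. weight T n *\<^sub>R vcoef w n)"
  have fin: "(\<Sum>n\<in>F. (norm (a n))\<^sup>2) \<le> M / (2 * pi)" if "finite F" for F
    using bounded_line_energy_coeffs[OF T w M that] by (simp add: a_def power_mult_distrib)
  have "(\<lambda>n. (norm (a n))\<^sup>2) summable_on UNIV" by (rule square_summable_bound(1)[OF _ fin]) auto
  then obtain u where u: "Rep_ell2 u = a" using Abs_ell2_inverse[of a] by auto
  have "(norm u)\<^sup>2 \<le> M / (2 * pi)" unfolding norm_ell2_square u
    by (rule square_summable_bound(2)[OF _ fin]) auto
  moreover have "hardy_fun T u z = w z" if z: "z \<in> strip T" for z
  proof -
    have "hardy_fun T u z $ i = w z $ i" for i
    proof (rule has_sum_unique[OF hardy_fun_props(2)[OF T z]])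
      have "((\<lambda>n. fourier_coeff (\<lambda>z. w z $ i) n * exp (\<i> * of_int n * z)) has_sum w z $ i) UNIV"
        by (rule fourier_series_converges[OF _ z]) (use w in \<open>simp add: vper_hol_def\<close>)
      moreover have "Rep_ell2 u n $ i / of_real (weight T n) = fourier_coeff (\<lambda>z. w z $ i) n" for n
        using weight_pos[of T n] by (simp add: u a_def vcoef_def complex_eq_iff)
      ultimately show "((\<lambda>n. Rep_ell2 u n $ i / of_real (weight T n) * exp (\<i> * of_int n * z)) has_sum w z $ i) UNIV"
        by simp
    qed
    thus ?thesis by (simp add: vec_eq_iff)
  qed
  ultimately show ?thesis using that by blast
qed

text \<open>Point evaluations are bounded uniformly on smaller strips, because the weights grow like
  \<open>exp (\<bar>n\<bar> T)\<close>; convergence in norm is therefore locally uniform convergence.\<close>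

lemma hardy_fun_eval_bound:
  assumes T: "T > 0" and y: "y < T"
  obtains K where "K \<ge> 0" "\<And>u :: (complex ^ 'k) ell2. \<And>z i. \<bar>Im z\<bar> \<le> y \<Longrightarrow> cmod (hardy_fun T u z $ i) \<le> K * norm u"
proof
  define B where "B = (\<Sum>\<^sub>\<infinity>n::int. exp (- \<bar>of_int n\<bar> * (T - y)))"
  have B: "((\<lambda>n::int. exp (- \<bar>of_int n\<bar> * (T - y))) has_sum B) UNIV"
    unfolding B_def by (rule has_sum_infsum[OF summable_exp_int]) (use y in simp)
  show "sqrt 2 * B \<ge> 0" unfolding B_def by (simp add: infsum_nonneg)
  fix u :: "(complex ^ 'k) ell2" and z i assume z: "\<bar>Im z\<bar> \<le> y"
  have "z \<in> strip T" using z y by (auto simp: strip_def)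
  hence hs: "((\<lambda>n. Rep_ell2 u n $ i / of_real (weight T n) * exp (\<i> * of_int n * z)) has_sum hardy_fun T u z $ i) UNIV"
    by (rule hardy_fun_props(2)[OF T])
  have le: "cmod (Rep_ell2 u n $ i / of_real (weight T n) * exp (\<i> * of_int n * z))
      \<le> sqrt 2 * norm u * exp (- \<bar>of_int n\<bar> * (T - y))" for n
    by (rule exp_term_bound[OF hardy_coeff_bound z]) (use T in simp)
  have maj: "((\<lambda>n::int. sqrt 2 * norm u * exp (- \<bar>of_int n\<bar> * (T - y))) has_sum sqrt 2 * norm u * B) UNIV"
    by (rule has_sum_cmult_right[OF B])
  have summ: "(\<lambda>n. cmod (Rep_ell2 u n $ i / of_real (weight T n) * exp (\<i> * of_int n * z))) summable_on UNIV"
    by (rule summable_on_comparison_test[OF has_sum_imp_summable[OF maj] le]) auto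
  have "cmod (hardy_fun T u z $ i) \<le>
      (\<Sum>\<^sub>\<infinity>n. cmod (Rep_ell2 u n $ i / of_real (weight T n) * exp (\<i> * of_int n * z)))"
    by (rule norm_has_sum_bound[OF has_sum_infsum[OF summ] hs])
  also have "\<dots> \<le> sqrt 2 * norm u * B"
    by (rule has_sum_mono[OF has_sum_infsum[OF summ] maj le])
  finally have "cmod (hardy_fun T u z $ i) \<le> sqrt 2 * norm u * B" .
  thus "cmod (hardy_fun T u z $ i) \<le> sqrt 2 * B * norm u" by (simp add: mult_ac)
qed

lemma hardy_fun_in_H2:
  assumes T: "T > 0" and f: "\<And>z. z \<in> strip T \<Longrightarrow> f z = hardy_fun T u z"
  shows "f \<in> H2_vec T" "H2_vec_norm T f = norm u"
proof -
  have fc: "fourier_coeff (\<lambda>z. f z $ i) n = (1 / weight T n) *\<^sub>R Rep_ell2 u n $ i" for i n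
  proof -
    have "vcoef f n $ i = vcoef (hardy_fun T u) n $ i"
      using vcoef_cong[of f "hardy_fun T u" n] f[OF of_real_in_strip[OF T]] by simp
    thus ?thesis unfolding hardy_fun_props(3)[OF T] by (simp add: vcoef_def)
  qed
  hence sq: "(cmod (fourier_coeff (\<lambda>z. f z $ i) n))\<^sup>2 * cosh (2 * of_int n * T) = (cmod (Rep_ell2 u n $ i))\<^sup>2" for i n
    using weight_pos[of T n] by (simp add: fc power_mult_distrib power_divide flip: weight_square)
  have summ: "(\<lambda>n. (cmod (Rep_ell2 u n $ i))\<^sup>2) summable_on UNIV" for i
    by (rule summable_on_comparison_test[OF ell2_summable[of u]])
       (auto intro!: power_mono Finite_Cartesian_Product.norm_nth_le)
  have per: "per_hol T (\<lambda>z. f z $ i)" for i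
  proof -
    have h: "per_hol T (\<lambda>z. hardy_fun T u z $ i)" using hardy_fun_props(1)[OF T, of u] by (simp add: vper_hol_def)
    thus ?thesis unfolding per_hol_def
      using f strip_shift holomorphic_transform[of _ "strip T" "\<lambda>z. f z $ i"] by auto
  qed
  show "f \<in> H2_vec T" unfolding H2_vec_def H2_def
    using per fourier_series_converges[OF per] summ sq by (auto simp: per_hol_def)
  have "(\<Sum>i\<in>UNIV. (H2_norm T (\<lambda>z. f z $ i))\<^sup>2) = (\<Sum>i\<in>UNIV. \<Sum>\<^sub>\<infinity>n. (cmod (Rep_ell2 u n $ i))\<^sup>2)"
    unfolding H2_norm_def sq by (simp add: infsum_nonneg)
  also have "\<dots> = (norm u)\<^sup>2"
  proof -
    have "((\<lambda>n. \<Sum>i\<in>UNIV. (cmod (Rep_ell2 u n $ i))\<^sup>2) has_sum (\<Sum>i\<in>UNIV. \<Sum>\<^sub>\<infinity>n. (cmod (Rep_ell2 u n $ i))\<^sup>2)) UNIV"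
      by (intro has_sum_finite_sum has_sum_infsum summ)
    thus ?thesis unfolding norm_ell2_square norm_vec_square by (rule infsumI[symmetric])
  qed
  finally show "H2_vec_norm T f = norm u" by (simp add: H2_vec_norm_def)
qed

lemma H2_vec_hardy_fun:
  fixes f :: "complex \<Rightarrow> complex ^ 'k"
  assumes T: "T > 0" and f: "f \<in> H2_vec T"
  obtains u where "\<And>z. z \<in> strip T \<Longrightarrow> hardy_fun T u z = f z"
proof -
  define a where "a = (\<lambda>n. weight T n *\<^sub>R vcoef f n)"
  have "(\<lambda>n. \<Sum>i\<in>UNIV. (cmod (fourier_coeff (\<lambda>z. f z $ i) n))\<^sup>2 * cosh (2 * of_int n * T)) summable_on UNIV"
    by (rule has_sum_imp_summable[OF has_sum_finite_sum[OF has_sum_infsum]])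
       (use f in \<open>auto simp: H2_vec_def H2_def\<close>)
  moreover have "(norm (a n))\<^sup>2 = (\<Sum>i\<in>UNIV. (cmod (fourier_coeff (\<lambda>z. f z $ i) n))\<^sup>2 * cosh (2 * of_int n * T))" for n
    by (simp add: a_def power_mult_distrib weight_square norm_vec_square vcoef_def mult.commute sum_distrib_left)
  ultimately obtain u where u: "Rep_ell2 u = a" using Abs_ell2_inverse[of a] by auto
  have "hardy_fun T u z = f z" if z: "z \<in> strip T" for z
  proof -
    have "hardy_fun T u z $ i = f z $ i" for i
    proof (rule has_sum_unique[OF hardy_fun_props(2)[OF T z]])
      have "((\<lambda>n. fourier_coeff (\<lambda>z. f z $ i) n * exp (\<i> * of_int n * z)) has_sum f z $ i) UNIV"
        using f z by (auto simp: H2_vec_def H2_def)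
      moreover have "Rep_ell2 u n $ i / of_real (weight T n) = fourier_coeff (\<lambda>z. f z $ i) n" for n
        using weight_pos[of T n] by (simp add: u a_def vcoef_def complex_eq_iff)
      ultimately show "((\<lambda>n. Rep_ell2 u n $ i / of_real (weight T n) * exp (\<i> * of_int n * z)) has_sum f z $ i) UNIV"
        by simp
    qed
    thus ?thesis by (simp add: vec_eq_iff)
  qed
  thus ?thesis using that by blast
qed

section \<open>Energy estimates on horizontal lines\<close>

lemma hdot_add_right: "hdot V (W + W') = hdot V W + hdot V W'"
  and hdot_diff_right: "hdot V (W - W') = hdot V W - hdot V W'"
  and hdot_minus_right: "hdot V (- W) = - hdot V W"
  and hdot_scale_right: "hdot V (c *s W) = c * hdot V W"
  and hdot_cnj: "cnj (hdot V W) = hdot W V"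
  by (simp_all add: hdot_def sum.distrib sum_subtractf sum_negf sum_distrib_left algebra_simps)

lemma hdot_self: "hdot V V = of_real ((norm V)\<^sup>2)"
  by (simp add: hdot_def norm_vec_square complex_norm_square mult.commute flip: of_real_power)

lemma hdot_le: "cmod (hdot V W) \<le> norm V * norm W"
proof -
  have "cmod (hdot V W) \<le> (\<Sum>i\<in>UNIV. \<bar>cmod (V $ i)\<bar> * \<bar>cmod (W $ i)\<bar>)"
    unfolding hdot_def by (rule order_trans[OF norm_sum]) (simp add: norm_mult)
  also have "\<dots> \<le> norm V * norm W" unfolding norm_vec_def by (rule L2_set_mult_ineq)
  finally show ?thesis .
qed

definition mat_per_hol :: "real \<Rightarrow> (complex \<Rightarrow> complex ^ 'k ^ 'k) \<Rightarrow> bool" where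
  "mat_per_hol T P \<longleftrightarrow> (\<forall>i j. per_hol T (\<lambda>z. P z $ i $ j))"

definition mat_deriv :: "(complex \<Rightarrow> complex ^ 'k ^ 'k) \<Rightarrow> complex \<Rightarrow> complex ^ 'k ^ 'k" where
  "mat_deriv P z = (\<chi> i j. deriv (\<lambda>w. P w $ i $ j) z)"

lemma vper_hol_vec_deriv: "vper_hol T w \<Longrightarrow> vper_hol T (vec_deriv w)"
  unfolding vper_hol_def vec_deriv_def vec_lambda_beta using per_hol_deriv by blast

lemma vper_hol_mult: "mat_per_hol T P \<Longrightarrow> vper_hol T w \<Longrightarrow> vper_hol T (\<lambda>z. P z *v w z)"
  by (simp add: vper_hol_def mat_per_hol_def matrix_vector_mult_def per_hol_sum per_hol_mult)

lemma vper_hol_add: "vper_hol T v \<Longrightarrow> vper_hol T w \<Longrightarrow> vper_hol T (\<lambda>z. v z + w z)"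
  and vper_hol_minus: "vper_hol T v \<Longrightarrow> vper_hol T (\<lambda>z. - v z)"
  and vper_hol_scale: "vper_hol T v \<Longrightarrow> vper_hol T (\<lambda>z. c *s v z)"
  by (simp_all add: vper_hol_def per_hol_add per_hol_diff per_hol_minus per_hol_mult per_hol_const)

lemma vper_hol_comp_deriv:
  assumes "vper_hol T w" "z \<in> strip T"
  shows "((\<lambda>z. w z $ i) has_field_derivative vec_deriv w z $ i) (at z)"
  using assms unfolding vec_deriv_def vec_lambda_beta vper_hol_def per_hol_def
  by (intro holomorphic_derivI[OF _ open_strip]) auto

lemma vec_deriv_add:
  assumes "vper_hol T v" "vper_hol T w" "z \<in> strip T"
  shows "vec_deriv (\<lambda>z. v z + w z) z = vec_deriv v z + vec_deriv w z"
  using DERIV_add[OF vper_hol_comp_deriv[OF assms(1,3)] vper_hol_comp_deriv[OF assms(2,3)]]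
  by (simp add: vec_eq_iff vec_deriv_def[of "\<lambda>z. v z + w z"] DERIV_imp_deriv)

lemma vec_deriv_scale:
  assumes "vper_hol T v" "z \<in> strip T"
  shows "vec_deriv (\<lambda>z. c *s v z) z = c *s vec_deriv v z"
  using DERIV_cmult[OF vper_hol_comp_deriv[OF assms]]
  by (simp add: vec_eq_iff vec_deriv_def[of "\<lambda>z. c *s v z"] DERIV_imp_deriv)

lemma vec_deriv_mult:
  assumes P: "mat_per_hol T P" and w: "vper_hol T w" and z: "z \<in> strip T"
  shows "vec_deriv (\<lambda>z. P z *v w z) z = mat_deriv P z *v w z + P z *v vec_deriv w z"
proof -
  have der: "((\<lambda>z. \<Sum>j\<in>UNIV. P z $ i $ j * w z $ j) has_field_derivative
      (\<Sum>j\<in>UNIV. P z $ i $ j * vec_deriv w z $ j + mat_deriv P z $ i $ j * w z $ j)) (at z)" for i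
  proof (rule DERIV_sum)
    fix j
    have "((\<lambda>z. P z $ i $ j) has_field_derivative mat_deriv P z $ i $ j) (at z)"
      using P z unfolding mat_deriv_def vec_lambda_beta mat_per_hol_def per_hol_def
      by (intro holomorphic_derivI[OF _ open_strip]) auto
    from DERIV_mult[OF this vper_hol_comp_deriv[OF w z]]
    show "((\<lambda>z. P z $ i $ j * w z $ j) has_field_derivative
      P z $ i $ j * vec_deriv w z $ j + mat_deriv P z $ i $ j * w z $ j) (at z)"
      by (simp add: add.commute mult.commute)
  qed
  have "vec_deriv (\<lambda>z. P z *v w z) z $ i = (mat_deriv P z *v w z + P z *v vec_deriv w z) $ i" for i
    unfolding vec_deriv_def[of "\<lambda>z. P z *v w z"] vec_lambda_beta
    by (simp add: matrix_vector_mult_def DERIV_imp_deriv[OF der] sum.distrib add.commute)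
  thus ?thesis by (simp add: vec_eq_iff)
qed

lemma hdot_horizontal:
  assumes "vper_hol T w" "vper_hol T v" "\<bar>\<tau>\<bar> < T"
  defines "z \<equiv> \<lambda>x. Complex x \<tau>"
  shows "((\<lambda>x. hdot (w (z x)) (v (z x))) has_vector_derivative
     (hdot (vec_deriv w (z x)) (v (z x)) + hdot (w (z x)) (vec_deriv v (z x)))) (at x)"
proof -
  have zs: "z x \<in> strip T" using assms by simp
  have "((\<lambda>x. \<Sum>i\<in>UNIV. cnj (w (z x) $ i) * v (z x) $ i) has_vector_derivative
    (\<Sum>i\<in>UNIV. cnj (w (z x) $ i) * vec_deriv v (z x) $ i + cnj (vec_deriv w (z x) $ i) * v (z x) $ i)) (at x)"
    unfolding z_def
    by (intro has_vector_derivative_sum has_vector_derivative_mult has_vector_derivative_cnj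
        has_vector_derivative_horizontal vper_hol_comp_deriv[OF assms(1)] vper_hol_comp_deriv[OF assms(2)]
        zs[unfolded z_def])
  thus ?thesis by (simp add: hdot_def sum.distrib add.commute)
qed

lemma hdot_by_parts:
  fixes w v :: "complex \<Rightarrow> complex ^ 'k"
  assumes "vper_hol T w" "vper_hol T v" "\<bar>\<tau>\<bar> < T"
  shows "((\<lambda>x. hdot (vec_deriv w (Complex x \<tau>)) (v (Complex x \<tau>))
      + hdot (w (Complex x \<tau>)) (vec_deriv v (Complex x \<tau>))) has_integral 0) {0..2*pi}"
proof -
  have per: "u (Complex (2*pi) \<tau>) = u (Complex 0 \<tau>)" if "vper_hol T u" for u :: "complex \<Rightarrow> complex ^ 'k"
  proof -
    have "Complex (2*pi) \<tau> = Complex 0 \<tau> + 2 * of_real pi" by (simp add: complex_eq_iff)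
    thus ?thesis using that assms(3) by (simp add: vec_eq_iff vper_hol_def per_hol_def)
  qed
  have "((\<lambda>x. hdot (vec_deriv w (Complex x \<tau>)) (v (Complex x \<tau>))
      + hdot (w (Complex x \<tau>)) (vec_deriv v (Complex x \<tau>))) has_integral
      (hdot (w (Complex (2*pi) \<tau>)) (v (Complex (2*pi) \<tau>)) - hdot (w (Complex 0 \<tau>)) (v (Complex 0 \<tau>)))) {0..2*pi}"
    by (rule fundamental_theorem_of_calculus)
       (auto intro!: has_vector_derivative_at_within hdot_horizontal[OF assms])
  thus ?thesis using per[OF assms(1)] per[OF assms(2)] by simp
qed

lemma continuous_on_hdot:
  assumes "vper_hol T w" "vper_hol T v" "\<bar>\<tau>\<bar> < T"
  shows "continuous_on A (\<lambda>x. hdot (w (Complex x \<tau>)) (v (Complex x \<tau>)))"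
  unfolding hdot_def by (intro continuous_intros continuous_on_line_vec[OF assms(1,3)] continuous_on_line_vec[OF assms(2,3)])

text \<open>For holomorphic \<open>w\<close> the derivative in the vertical direction is \<open>\<i> w'\<close>.\<close>

lemma norm_square_vertical:
  assumes "vper_hol T w" "\<bar>\<tau>\<bar> < T"
  shows "((\<lambda>\<tau>. (norm (w (Complex x \<tau>)))\<^sup>2) has_real_derivative
    - 2 * Im (hdot (w (Complex x \<tau>)) (vec_deriv w (Complex x \<tau>)))) (at \<tau>)"
proof -
  let ?z = "Complex x \<tau>"
  have "((\<lambda>\<tau>. \<Sum>i\<in>UNIV. cnj (w (Complex x \<tau>) $ i) * w (Complex x \<tau>) $ i) has_vector_derivative
    (\<Sum>i\<in>UNIV. cnj (w ?z $ i) * (\<i> * vec_deriv w ?z $ i) + cnj (\<i> * vec_deriv w ?z $ i) * w ?z $ i)) (at \<tau>)"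
    by (intro has_vector_derivative_sum has_vector_derivative_mult has_vector_derivative_cnj
        has_vector_derivative_vertical vper_hol_comp_deriv[OF assms(1)]) (use assms(2) in simp_all)
  moreover have "(\<Sum>i\<in>UNIV. cnj (w ?z $ i) * (\<i> * vec_deriv w ?z $ i) + cnj (\<i> * vec_deriv w ?z $ i) * w ?z $ i)
      = of_real (- 2 * Im (hdot (w ?z) (vec_deriv w ?z)))"
  proof -
    have "(\<Sum>i\<in>UNIV. cnj (w ?z $ i) * (\<i> * vec_deriv w ?z $ i) + cnj (\<i> * vec_deriv w ?z $ i) * w ?z $ i)
       = \<i> * (hdot (w ?z) (vec_deriv w ?z) - cnj (hdot (w ?z) (vec_deriv w ?z)))"
      unfolding hdot_cnj by (simp add: hdot_def sum.distrib sum_distrib_left sum_subtractf algebra_simps sum_negf)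
    thus ?thesis by (simp add: complex_eq_iff)
  qed
  ultimately have "((\<lambda>\<tau>. hdot (w (Complex x \<tau>)) (w (Complex x \<tau>))) has_vector_derivative
     of_real (- 2 * Im (hdot (w ?z) (vec_deriv w ?z)))) (at \<tau>)" by (simp only: hdot_def)
  from bounded_linear.has_vector_derivative[OF bounded_linear_Re this]
  show ?thesis by (simp add: hdot_self has_real_derivative_iff_has_vector_derivative flip: of_real_power)
qed

text \<open>Gronwall's inequality started at \<open>0\<close> in both directions; the crude factor \<open>\<bar>\<tau>\<bar>\<close> on \<open>b\<close> avoids a
  case distinction at \<open>a = 0\<close>.\<close>

lemma gronwall_two_sided:
  fixes \<phi> :: "real \<Rightarrow> real"
  assumes d: "\<And>s. \<bar>s\<bar> < T \<Longrightarrow> (\<phi> has_real_derivative \<phi>' s) (at s)"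
    and le: "\<And>s. \<bar>s\<bar> < T \<Longrightarrow> \<bar>\<phi>' s\<bar> \<le> a * \<phi> s + b" and ab: "a \<ge> 0" "b \<ge> 0" and \<tau>: "\<bar>\<tau>\<bar> < T"
  shows "\<phi> \<tau> \<le> exp (a * \<bar>\<tau>\<bar>) * (\<phi> 0 + b * \<bar>\<tau>\<bar>)"
proof -
  have one: "g t \<le> exp (a * t) * (g 0 + b * t)"
    if t: "0 \<le> t" "t < T" and g: "\<And>s. \<bar>s\<bar> < T \<Longrightarrow> (g has_real_derivative g' s) (at s)"
      "\<And>s. \<bar>s\<bar> < T \<Longrightarrow> g' s \<le> a * g s + b" for g g' t
  proof -
    define \<psi> where "\<psi> = (\<lambda>s. g s * exp (- a * s) - b * s)"
    have "\<psi> t \<le> \<psi> 0"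
    proof (rule DERIV_nonpos_imp_nonincreasing[OF t(1)])
      fix s assume s: "0 \<le> s" "s \<le> t"
      have sT: "\<bar>s\<bar> < T" using s t by simp
      have "(\<psi> has_real_derivative (g' s * exp (- a * s) + g s * (exp (- a * s) * (- a)) - b)) (at s)"
        unfolding \<psi>_def by (auto intro!: derivative_eq_intros g(1)[OF sT])
      moreover have "g' s * exp (- a * s) + g s * (exp (- a * s) * (- a)) - b \<le> 0"
      proof -
        have "(g' s - a * g s) * exp (- a * s) \<le> b * exp (- a * s)"
          using g(2)[OF sT] by (intro mult_right_mono) auto
        also have "\<dots> \<le> b * 1" using ab s by (intro mult_left_mono) auto
        finally show ?thesis by (simp add: algebra_simps)
      qed
      ultimately show "\<exists>y. (\<psi> has_real_derivative y) (at s) \<and> y \<le> 0" by blast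
    qed
    hence "g t * exp (- a * t) \<le> g 0 + b * t" by (simp add: \<psi>_def)
    hence "exp (a * t) * (g t * exp (- a * t)) \<le> exp (a * t) * (g 0 + b * t)" by (intro mult_left_mono) auto
    thus ?thesis by (simp add: exp_minus field_simps)
  qed
  show ?thesis
  proof (cases "\<tau> \<ge> 0")
    case True
    have "\<phi> \<tau> \<le> exp (a * \<tau>) * (\<phi> 0 + b * \<tau>)"
      by (rule one[OF True _ d]) (use \<tau> le True in \<open>auto simp: abs_le_iff\<close>)
    thus ?thesis using True by simp
  next
    case False
    have "(\<lambda>s. \<phi> (- s)) (- \<tau>) \<le> exp (a * (- \<tau>)) * ((\<lambda>s. \<phi> (- s)) 0 + b * (- \<tau>))"
    proof (rule one[where g' = "\<lambda>s. - \<phi>' (- s)"])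
      fix s assume s: "\<bar>s\<bar> < T"
      show "((\<lambda>s. \<phi> (- s)) has_real_derivative - \<phi>' (- s)) (at s)"
      proof -
        have "((\<lambda>s. \<phi> (- s)) has_real_derivative \<phi>' (- s) * (- 1)) (at s)"
          by (rule DERIV_chain2[of \<phi> _ uminus]) (use d[of "- s"] s in \<open>auto intro!: derivative_eq_intros\<close>)
        thus ?thesis by simp
      qed
      show "- \<phi>' (- s) \<le> a * \<phi> (- s) + b" using le[of "- s"] s by (auto simp: abs_le_iff)
    qed (use False \<tau> in auto)
    thus ?thesis using False by simp
  qed
qed

text \<open>What is needed of the coefficients: uniform bounds on the open strip, including the derivative of the
  leading coefficient, and uniform coercivity. The operators of the deformation to the Laplacian are instances as well.\<close>

locale elliptic =
  fixes T c0 B :: real and P2 P1 P0 :: "complex \<Rightarrow> complex ^ 'k ^ 'k"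
  assumes T: "T > 0" and c0: "c0 > 0" and B: "B \<ge> 0"
    and hol2: "mat_per_hol T P2" and hol1: "mat_per_hol T P1" and hol0: "mat_per_hol T P0"
    and bound2: "z \<in> strip T \<Longrightarrow> norm (P2 z *v V) \<le> B * norm V"
    and bound2': "z \<in> strip T \<Longrightarrow> norm (mat_deriv P2 z *v V) \<le> B * norm V"
    and bound1: "z \<in> strip T \<Longrightarrow> norm (P1 z *v V) \<le> B * norm V"
    and bound0: "z \<in> strip T \<Longrightarrow> norm (P0 z *v V) \<le> B * norm V"
    and coercive: "z \<in> strip T \<Longrightarrow> c0 * (norm V)\<^sup>2 \<le> Re (hdot V (P2 z *v V))"
begin

lemma vper_hol_L_op: "vper_hol T w \<Longrightarrow> vper_hol T (L_op P2 P1 P0 w)"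
  unfolding L_op_def[abs_def]
  by (intro vper_hol_add vper_hol_minus vper_hol_vec_deriv vper_hol_mult hol2 hol1 hol0)

lemma L_op_expand:
  assumes "vper_hol T w" "z \<in> strip T"
  shows "L_op P2 P1 P0 w z = - (mat_deriv P2 z *v vec_deriv w z + P2 z *v vec_deriv (vec_deriv w) z)
    + P1 z *v vec_deriv w z + P0 z *v w z"
  unfolding L_op_def vec_deriv_mult[OF hol2 vper_hol_vec_deriv[OF assms(1)] assms(2)] ..

end

text \<open>The constant in Garding's inequality: half of the coercivity absorbs the first order term at the
  expense of this multiple of \<open>norm w\<^sup>2\<close>.\<close>

definition lower_const :: "real \<Rightarrow> real \<Rightarrow> real" where
  "lower_const c0 B = B\<^sup>2 / (2 * c0) + B"

text \<open>Large enough for the resolvent estimate in the left half-plane; it collects the constants with which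
  the imaginary part of the form is controlled by its real part.\<close>

definition sector_const :: "real \<Rightarrow> real \<Rightarrow> real" where
  "sector_const c0 B = 2 + lower_const c0 B + 2 * B + (4 * B / c0) * (1 + lower_const c0 B)"

context elliptic begin

lemma lower_const_nonneg: "lower_const c0 B \<ge> 0"
  using c0 B by (simp add: lower_const_def)

lemma sector_const_ge: "sector_const c0 B \<ge> 2"
proof -
  have "(4 * B / c0) * (1 + lower_const c0 B) \<ge> 0" using lower_const_nonneg c0 B by simp
  thus ?thesis using lower_const_nonneg B unfolding sector_const_def by linarith
qed

text \<open>The integrand of the quadratic form, with \<open>V\<close> and \<open>V'\<close> in the roles of \<open>w z\<close> and \<open>w' z\<close>.\<close>

lemma form_pointwise:
  assumes z: "z \<in> strip T"
  shows "c0 / 2 * (norm V')\<^sup>2 - lower_const c0 B * (norm V)\<^sup>2 \<le> Re (hdot V' (P2 z *v V') + hdot V (P1 z *v V' + P0 z *v V))"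
    and "cmod (hdot V' (P2 z *v V') + hdot V (P1 z *v V' + P0 z *v V)) \<le> 2 * B * ((norm V)\<^sup>2 + (norm V')\<^sup>2)"
proof -
  define a b where "a = norm V" and "b = norm V'"
  have ab: "a \<ge> 0" "b \<ge> 0" by (auto simp: a_def b_def)
  have "cmod (hdot V (P1 z *v V' + P0 z *v V)) \<le> a * norm (P1 z *v V' + P0 z *v V)"
    unfolding a_def by (rule hdot_le)
  also have "norm (P1 z *v V' + P0 z *v V) \<le> B * b + B * a"
    using norm_triangle_ineq[of "P1 z *v V'" "P0 z *v V"] bound1[OF z, of V'] bound0[OF z, of V]
    by (simp add: a_def b_def)
  finally have low: "cmod (hdot V (P1 z *v V' + P0 z *v V)) \<le> a * (B * b + B * a)"
    using ab by (simp add: mult_left_mono)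
  have main: "cmod (hdot V' (P2 z *v V')) \<le> b * (B * b)"
    using hdot_le[of V' "P2 z *v V'"] bound2[OF z, of V'] ab unfolding b_def
    by (meson mult_left_mono norm_ge_zero order_trans)
  have sq: "2 * (B * a * b) \<le> c0 * b\<^sup>2 + B\<^sup>2 / c0 * a\<^sup>2"
  proof -
    have "0 \<le> (c0 * b - B * a)\<^sup>2 / c0" using c0 by simp
    also have "\<dots> = c0 * b\<^sup>2 + B\<^sup>2 / c0 * a\<^sup>2 - 2 * (B * a * b)"
      using c0 by (simp add: power2_eq_square field_simps)
    finally show ?thesis by simp
  qed
  have "- (a * (B * b + B * a)) \<le> Re (hdot V (P1 z *v V' + P0 z *v V))"
    using low abs_Re_le_cmod[of "hdot V (P1 z *v V' + P0 z *v V)"] by linarith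
  hence "c0 * b\<^sup>2 - a * (B * b + B * a) \<le> Re (hdot V' (P2 z *v V') + hdot V (P1 z *v V' + P0 z *v V))"
    using coercive[OF z, of V'] by (simp add: b_def)
  moreover have "c0 / 2 * b\<^sup>2 - lower_const c0 B * a\<^sup>2 \<le> c0 * b\<^sup>2 - a * (B * b + B * a)"
  proof -
    define X Y Z U where "X = B\<^sup>2 / c0 * a\<^sup>2" and "Y = B * a * b" and "Z = c0 * b\<^sup>2" and "U = B * a\<^sup>2"
    have "lower_const c0 B * a\<^sup>2 = X / 2 + U" using c0 by (simp add: lower_const_def X_def U_def field_simps)
    moreover have "a * (B * b + B * a) = Y + U" by (simp add: Y_def U_def algebra_simps power2_eq_square)
    moreover have "2 * Y \<le> Z + X" using sq by (simp add: X_def Y_def Z_def)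
    moreover have "c0 / 2 * b\<^sup>2 = Z / 2" "c0 * b\<^sup>2 = Z" by (simp_all add: Z_def)
    ultimately show ?thesis by linarith
  qed
  ultimately show "c0 / 2 * (norm V')\<^sup>2 - lower_const c0 B * (norm V)\<^sup>2
      \<le> Re (hdot V' (P2 z *v V') + hdot V (P1 z *v V' + P0 z *v V))"
    unfolding a_def[symmetric] b_def[symmetric] by linarith
  have "cmod (hdot V' (P2 z *v V') + hdot V (P1 z *v V' + P0 z *v V)) \<le> b * (B * b) + a * (B * b + B * a)"
    using norm_triangle_ineq main low by (meson add_mono order_trans)
  also have "\<dots> \<le> 2 * B * (a\<^sup>2 + b\<^sup>2)"
  proof -
    have "B * (2 * a * b) \<le> B * (a\<^sup>2 + b\<^sup>2)" using sum_squares_bound[of a b] B by (intro mult_left_mono) auto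
    moreover have "0 \<le> B * (a\<^sup>2 + b\<^sup>2)" using B by simp
    moreover have "b * (B * b) + a * (B * b + B * a) = B * (a\<^sup>2 + b\<^sup>2) + B * (2 * a * b) / 2"
      by (simp add: power2_eq_square algebra_simps)
    ultimately show ?thesis by linarith
  qed
  finally show "cmod (hdot V' (P2 z *v V') + hdot V (P1 z *v V' + P0 z *v V)) \<le> 2 * B * ((norm V)\<^sup>2 + (norm V')\<^sup>2)"
    by (simp add: a_def b_def)
qed

lemma has_integral_line_energy:
  assumes "vper_hol T w" "\<bar>\<tau>\<bar> < T"
  shows "((\<lambda>x. (norm (w (Complex x \<tau>)))\<^sup>2) has_integral line_energy \<tau> w) {0..2*pi}"
  unfolding line_energy_def
  by (intro integrable_integral integrable_continuous_interval continuous_intros continuous_on_line_vec[OF assms])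

text \<open>Integration by parts along a horizontal line, without boundary terms by periodicity, turns
  \<open>\<langle>w, L w\<rangle>\<close> into the quadratic form, to which the pointwise bounds apply on every line.\<close>

lemma form_identity:
  fixes w :: "complex \<Rightarrow> complex ^ 'k"
  assumes w: "vper_hol T w" and \<tau>: "\<bar>\<tau>\<bar> < T"
  obtains q where "((\<lambda>x. hdot (w (Complex x \<tau>)) (L_op P2 P1 P0 w (Complex x \<tau>))) has_integral q) {0..2*pi}"
    and "c0 / 2 * line_energy \<tau> (vec_deriv w) - lower_const c0 B * line_energy \<tau> w \<le> Re q"
    and "cmod q \<le> 2 * B * (line_energy \<tau> w + line_energy \<tau> (vec_deriv w))"
proof -
  let ?w = "\<lambda>x. w (Complex x \<tau>)" and ?w' = "\<lambda>x. vec_deriv w (Complex x \<tau>)"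
  let ?Q = "\<lambda>x. hdot (?w' x) (P2 (Complex x \<tau>) *v ?w' x) + hdot (?w x) (P1 (Complex x \<tau>) *v ?w' x + P0 (Complex x \<tau>) *v ?w x)"
  define q where "q = integral {0..2*pi} ?Q"
  have w': "vper_hol T (vec_deriv w)" by (rule vper_hol_vec_deriv[OF w])
  have zs: "Complex x \<tau> \<in> strip T" for x using \<tau> by simp
  have contQ: "continuous_on {0..2*pi} ?Q"
    by (intro continuous_on_add continuous_on_hdot[OF _ _ \<tau>, of w' "\<lambda>z. P2 z *v vec_deriv w z" for w']
        continuous_on_hdot[OF w _ \<tau>, of "\<lambda>z. P1 z *v vec_deriv w z + P0 z *v w z"]
        continuous_on_hdot[OF w' vper_hol_mult[OF hol2 w'] \<tau>] vper_hol_add vper_hol_mult hol1 hol0 w w')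
  have Q: "(?Q has_integral q) {0..2*pi}"
    unfolding q_def by (intro integrable_integral integrable_continuous_interval contQ)
  have "((\<lambda>x. ?Q x - (hdot (?w' x) (P2 (Complex x \<tau>) *v ?w' x)
      + hdot (?w x) (vec_deriv (\<lambda>z. P2 z *v vec_deriv w z) (Complex x \<tau>)))) has_integral q - 0) {0..2*pi}"
    by (intro has_integral_diff Q hdot_by_parts[OF w vper_hol_mult[OF hol2 w'] \<tau>])
  moreover have "?Q x - (hdot (?w' x) (P2 (Complex x \<tau>) *v ?w' x)
      + hdot (?w x) (vec_deriv (\<lambda>z. P2 z *v vec_deriv w z) (Complex x \<tau>))) =
      hdot (?w x) (L_op P2 P1 P0 w (Complex x \<tau>))" for x
    by (simp add: L_op_def hdot_add_right hdot_minus_right hdot_diff_right)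
  ultimately have 1: "((\<lambda>x. hdot (?w x) (L_op P2 P1 P0 w (Complex x \<tau>))) has_integral q) {0..2*pi}" by simp
  note W0 = has_integral_line_energy[OF w \<tau>] and W1 = has_integral_line_energy[OF w' \<tau>]
  have re: "((\<lambda>x. Re (?Q x)) has_integral Re q) {0..2*pi}" by (rule has_integral_linear[OF Q bounded_linear_Re, unfolded o_def])
  have lower: "((\<lambda>x. c0 / 2 * (norm (?w' x))\<^sup>2 - lower_const c0 B * (norm (?w x))\<^sup>2) has_integral
     (c0 / 2 * line_energy \<tau> (vec_deriv w) - lower_const c0 B * line_energy \<tau> w)) {0..2*pi}"
    by (intro has_integral_diff has_integral_mult_right W0 W1)
  have 2: "c0 / 2 * line_energy \<tau> (vec_deriv w) - lower_const c0 B * line_energy \<tau> w \<le> Re q"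
    by (rule has_integral_le[OF lower re]) (rule form_pointwise(1)[OF zs])
  have upper: "((\<lambda>x. 2 * B * ((norm (?w x))\<^sup>2 + (norm (?w' x))\<^sup>2)) has_integral
      2 * B * (line_energy \<tau> w + line_energy \<tau> (vec_deriv w))) {0..2*pi}"
    by (intro has_integral_mult_right has_integral_add W0 W1)
  have 3: "cmod q \<le> 2 * B * (line_energy \<tau> w + line_energy \<tau> (vec_deriv w))"
    unfolding integral_unique[OF Q, symmetric] integral_unique[OF upper, symmetric]
    by (rule integral_norm_bound_integral[OF has_integral_integrable[OF Q] has_integral_integrable[OF upper]])
       (rule form_pointwise(2)[OF zs])
  show ?thesis by (rule that[OF 1 2 3])
qed

text \<open>Pairing \<open>L w - \<mu> w = f\<close> with \<open>w\<close> on one line; \<open>p\<close> is the contribution of \<open>f\<close>, bounded with a free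
  Young parameter \<open>\<eta>\<close>.\<close>

lemma energy_identity:
  fixes w f :: "complex \<Rightarrow> complex ^ 'k"
  assumes w: "vper_hol T w" and f: "vper_hol T f" and \<tau>: "\<bar>\<tau>\<bar> < T"
    and eq: "\<And>z. z \<in> strip T \<Longrightarrow> L_op P2 P1 P0 w z - \<mu> *s w z = f z"
  obtains p q where "q = p + \<mu> * of_real (line_energy \<tau> w)"
    and "c0 / 2 * line_energy \<tau> (vec_deriv w) - lower_const c0 B * line_energy \<tau> w \<le> Re q"
    and "cmod q \<le> 2 * B * (line_energy \<tau> w + line_energy \<tau> (vec_deriv w))"
    and "\<And>\<eta>. \<eta> > 0 \<Longrightarrow> cmod p \<le> \<eta> / 2 * line_energy \<tau> w + line_energy \<tau> f / (2 * \<eta>)"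
proof -
  let ?w = "\<lambda>x. w (Complex x \<tau>)" and ?f = "\<lambda>x. f (Complex x \<tau>)"
  obtain q where q: "((\<lambda>x. hdot (?w x) (L_op P2 P1 P0 w (Complex x \<tau>))) has_integral q) {0..2*pi}"
    "c0 / 2 * line_energy \<tau> (vec_deriv w) - lower_const c0 B * line_energy \<tau> w \<le> Re q"
    "cmod q \<le> 2 * B * (line_energy \<tau> w + line_energy \<tau> (vec_deriv w))"
    using form_identity[OF w \<tau>] by blast
  define p where "p = integral {0..2*pi} (\<lambda>x. hdot (?w x) (?f x))"
  have p: "((\<lambda>x. hdot (?w x) (?f x)) has_integral p) {0..2*pi}"
    unfolding p_def by (intro integrable_integral integrable_continuous_interval continuous_on_hdot[OF w f \<tau>])
  note W0 = has_integral_line_energy[OF w \<tau>] and F0 = has_integral_line_energy[OF f \<tau>]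
  have "((\<lambda>x. of_real ((norm (?w x))\<^sup>2)) has_integral of_real (line_energy \<tau> w)) {0..2*pi}"
    using has_integral_linear[OF W0 bounded_linear_of_real] by (simp add: o_def)
  hence "((\<lambda>x. hdot (?w x) (?f x) + \<mu> * of_real ((norm (?w x))\<^sup>2)) has_integral p + \<mu> * of_real (line_energy \<tau> w)) {0..2*pi}"
    by (intro has_integral_add p has_integral_mult_right)
  moreover have "hdot (?w x) (?f x) + \<mu> * of_real ((norm (?w x))\<^sup>2) = hdot (?w x) (L_op P2 P1 P0 w (Complex x \<tau>))" for x
    using eq[of "Complex x \<tau>", symmetric] \<tau> by (simp add: hdot_diff_right hdot_scale_right hdot_self)
  ultimately have "q = p + \<mu> * of_real (line_energy \<tau> w)" using has_integral_unique[OF q(1)] by simp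
  moreover have "cmod p \<le> \<eta> / 2 * line_energy \<tau> w + line_energy \<tau> f / (2 * \<eta>)" if \<eta>: "\<eta> > 0" for \<eta>
  proof -
    have "cmod (hdot (?w x) (?f x)) \<le> \<eta> / 2 * (norm (?w x))\<^sup>2 + 1 / (2 * \<eta>) * (norm (?f x))\<^sup>2" for x
    proof -
      have "cmod (hdot (?w x) (?f x)) \<le> norm (?w x) * norm (?f x)" by (rule hdot_le)
      also have "\<dots> \<le> \<eta> / 2 * (norm (?w x))\<^sup>2 + 1 / (2 * \<eta>) * (norm (?f x))\<^sup>2"
      proof -
        have "0 \<le> (\<eta> * norm (?w x) - norm (?f x))\<^sup>2 / (2 * \<eta>)" using \<eta> by simp
        also have "\<dots> = \<eta> / 2 * (norm (?w x))\<^sup>2 + 1 / (2 * \<eta>) * (norm (?f x))\<^sup>2 - norm (?w x) * norm (?f x)"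
          using \<eta> by (simp add: power2_eq_square field_simps)
        finally show ?thesis by simp
      qed
      finally show ?thesis .
    qed
    moreover have hi: "((\<lambda>x. \<eta> / 2 * (norm (?w x))\<^sup>2 + 1 / (2 * \<eta>) * (norm (?f x))\<^sup>2) has_integral
       \<eta> / 2 * line_energy \<tau> w + 1 / (2 * \<eta>) * line_energy \<tau> f) {0..2*pi}"
      by (intro has_integral_add has_integral_mult_right W0 F0)
    ultimately have "norm (integral {0..2*pi} (\<lambda>x. hdot (?w x) (?f x))) \<le>
        integral {0..2*pi} (\<lambda>x. \<eta> / 2 * (norm (?w x))\<^sup>2 + 1 / (2 * \<eta>) * (norm (?f x))\<^sup>2)"
      by (intro integral_norm_bound_integral[OF has_integral_integrable[OF p] has_integral_integrable[OF hi]])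
    thus ?thesis using integral_unique[OF hi] by (simp add: p_def)
  qed
  ultimately show ?thesis using that q(2,3) by blast
qed

lemma derivative_energy_bound:
  fixes w f :: "complex \<Rightarrow> complex ^ 'k"
  assumes w: "vper_hol T w" and f: "vper_hol T f" and \<tau>: "\<bar>\<tau>\<bar> < T"
    and eq: "\<And>z. z \<in> strip T \<Longrightarrow> L_op P2 P1 P0 w z - \<mu> *s w z = f z"
  shows "line_energy \<tau> (vec_deriv w) \<le> 2 / c0 * (line_energy \<tau> f + (1 + cmod \<mu> + lower_const c0 B) * line_energy \<tau> w)"
proof -
  obtain p q where pq: "q = p + \<mu> * of_real (line_energy \<tau> w)"
    "c0 / 2 * line_energy \<tau> (vec_deriv w) - lower_const c0 B * line_energy \<tau> w \<le> Re q"
    "\<And>\<eta>. \<eta> > 0 \<Longrightarrow> cmod p \<le> \<eta> / 2 * line_energy \<tau> w + line_energy \<tau> f / (2 * \<eta>)"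
    using energy_identity[OF w f \<tau> eq] by metis
  have p: "Re p \<le> line_energy \<tau> w + line_energy \<tau> f"
    using pq(3)[of 1] complex_Re_le_cmod[of p] line_energy_nonneg[of \<tau> w] line_energy_nonneg[of \<tau> f] by simp
  have m: "Re \<mu> * line_energy \<tau> w \<le> cmod \<mu> * line_energy \<tau> w"
    by (rule mult_right_mono[OF complex_Re_le_cmod line_energy_nonneg])
  have "c0 / 2 * line_energy \<tau> (vec_deriv w) \<le> line_energy \<tau> f + (1 + cmod \<mu> + lower_const c0 B) * line_energy \<tau> w"
    using pq(1,2) p m by (simp add: algebra_simps)
  thus ?thesis using c0 by (simp add: field_simps)
qed

text \<open>The numerical range lies in a sector around the positive axis, up to a translation. For
  \<open>Re \<mu> \<le> 0\<close> the real part of the energy identity bounds the energy of \<open>w'\<close> and \<open>\<bar>Re \<mu>\<bar>\<close> times that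
  of \<open>w\<close>; the imaginary part then bounds \<open>\<bar>Im \<mu>\<bar>\<close> times the energy of \<open>w\<close> through that of \<open>w'\<close>.\<close>

lemma sector_energy_bound:
  fixes w f :: "complex \<Rightarrow> complex ^ 'k"
  assumes w: "vper_hol T w" and f: "vper_hol T f" and \<tau>: "\<bar>\<tau>\<bar> < T"
    and eq: "\<And>z. z \<in> strip T \<Longrightarrow> L_op P2 P1 P0 w z - \<mu> *s w z = f z"
    and \<mu>: "Re \<mu> \<le> 0" "cmod \<mu> \<ge> 4 * sector_const c0 B"
  shows "(cmod \<mu>)\<^sup>2 * line_energy \<tau> w \<le> 2 * (sector_const c0 B)\<^sup>2 * line_energy \<tau> f"
proof -
  define W0 W1 F0 C C1 where "W0 = line_energy \<tau> w" and "W1 = line_energy \<tau> (vec_deriv w)"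
    and "F0 = line_energy \<tau> f" and "C = sector_const c0 B" and "C1 = lower_const c0 B"
  have nn: "W0 \<ge> 0" "W1 \<ge> 0" "F0 \<ge> 0" "C1 \<ge> 0" "C \<ge> 2"
    using lower_const_nonneg sector_const_ge by (auto simp: W0_def W1_def F0_def C_def C1_def line_energy_nonneg)
  obtain p q where q: "q = p + \<mu> * of_real W0"
    and lo: "c0 / 2 * W1 - C1 * W0 \<le> Re q" and up: "cmod q \<le> 2 * B * (W0 + W1)"
    and p: "\<And>\<eta>. \<eta> > 0 \<Longrightarrow> cmod p \<le> \<eta> / 2 * W0 + F0 / (2 * \<eta>)"
    using energy_identity[OF w f \<tau> eq] unfolding W0_def W1_def F0_def C1_def by metis
  have Req: "Re q = Re p + Re \<mu> * W0" and Imq: "Im q = Im p + Im \<mu> * W0" by (simp_all add: q)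
  have rp: "\<bar>Re p\<bar> \<le> cmod p" "\<bar>Im p\<bar> \<le> cmod p" "\<bar>Im q\<bar> \<le> cmod q"
    by (rule abs_Re_le_cmod abs_Im_le_cmod)+
  have r0: "Re \<mu> * W0 \<le> 0" using \<mu>(1) nn by (simp add: mult_nonpos_nonneg)
  have w1: "c0 / 2 * W1 \<le> cmod p + C1 * W0" using lo Req rp r0 by linarith
  hence W1: "W1 \<le> 2 / c0 * (cmod p + C1 * W0)" using c0 by (simp add: field_simps)
  have re: "- Re \<mu> * W0 \<le> cmod p + C1 * W0"
  proof -
    have "0 \<le> c0 / 2 * W1" using c0 nn by simp
    thus ?thesis using lo Req rp by simp
  qed
  have im: "\<bar>Im \<mu>\<bar> * W0 \<le> cmod p + 2 * B * (W0 + W1)"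
  proof -
    have "\<bar>Im \<mu> * W0\<bar> \<le> \<bar>Im q\<bar> + \<bar>Im p\<bar>" using Imq by linarith
    thus ?thesis using nn rp up by (simp add: abs_mult)
  qed
  have "cmod \<mu> * W0 \<le> (\<bar>Re \<mu>\<bar> + \<bar>Im \<mu>\<bar>) * W0" using cmod_le[of \<mu>] nn by (intro mult_right_mono) auto
  also have "\<dots> = - Re \<mu> * W0 + \<bar>Im \<mu>\<bar> * W0" using \<mu>(1) by (simp add: algebra_simps)
  also have "\<dots> \<le> 2 * cmod p + (C1 + 2 * B) * W0 + 2 * B * W1" using re im by (simp add: algebra_simps)
  also have "\<dots> \<le> 2 * cmod p + (C1 + 2 * B) * W0 + 2 * B * (2 / c0 * (cmod p + C1 * W0))"
    using mult_left_mono[OF W1, of "2 * B"] B by simp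
  also have "\<dots> \<le> C * (cmod p + W0)"
  proof -
    have "C * (cmod p + W0) - (2 * cmod p + (C1 + 2 * B) * W0 + 2 * B * (2 / c0 * (cmod p + C1 * W0)))
       = (C1 + 2 * B + (4 * B / c0) * C1) * cmod p + (2 + 4 * B / c0) * W0"
      using c0 by (simp add: C_def sector_const_def C1_def[symmetric] field_simps)
    also have "\<dots> \<ge> 0" using nn B c0 by simp
    finally show ?thesis by simp
  qed
  finally have main: "cmod \<mu> * W0 \<le> C * cmod p + C * W0" by (simp add: algebra_simps)
  have mpos: "cmod \<mu> > 0" "4 * C \<le> cmod \<mu>" using \<mu>(2) nn by (auto simp: C_def)
  \<comment> \<open>Young's inequality with a parameter for which half of the left-hand side is absorbed, one quarter
     here and one quarter from \<open>C * W0\<close>.\<close>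
  have "C * cmod p \<le> C * (cmod \<mu> / (2 * C) / 2 * W0 + F0 / (2 * (cmod \<mu> / (2 * C))))"
    using p[of "cmod \<mu> / (2 * C)"] mpos nn by (intro mult_left_mono) auto
  also have "\<dots> = cmod \<mu> * W0 / 4 + C\<^sup>2 * F0 / cmod \<mu>"
    using mpos nn by (simp add: field_simps power2_eq_square)
  finally have cp: "C * cmod p \<le> cmod \<mu> * W0 / 4 + C\<^sup>2 * F0 / cmod \<mu>" .
  have "C * W0 \<le> cmod \<mu> * W0 / 4" using mult_right_mono[OF mpos(2) nn(1)] by simp
  hence "cmod \<mu> * W0 \<le> 2 * (C\<^sup>2 * F0 / cmod \<mu>)" using main cp by linarith
  hence "cmod \<mu> * (cmod \<mu> * W0) \<le> cmod \<mu> * (2 * (C\<^sup>2 * F0 / cmod \<mu>))"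
    using mpos by (intro mult_left_mono) auto
  thus ?thesis using mpos by (simp add: power2_eq_square W0_def F0_def C_def mult.assoc)
qed

text \<open>Coercivity makes \<open>P2 z\<close> invertible with inverse of norm at most \<open>1 / c0\<close>, so the equation can be
  solved for the second derivative.\<close>

lemma second_derivative_pointwise:
  assumes w: "vper_hol T w" and z: "z \<in> strip T" and eq: "L_op P2 P1 P0 w z - \<mu> *s w z = f z"
  shows "c0 * norm (vec_deriv (vec_deriv w) z) \<le> norm (f z) + (cmod \<mu> + B) * norm (w z) + 2 * B * norm (vec_deriv w z)"
proof -
  let ?w2 = "vec_deriv (vec_deriv w) z"
  have "c0 * norm ?w2 * norm ?w2 \<le> norm (P2 z *v ?w2) * norm ?w2"
  proof -
    have "c0 * (norm ?w2)\<^sup>2 \<le> cmod (hdot ?w2 (P2 z *v ?w2))"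
      using coercive[OF z, of ?w2] complex_Re_le_cmod order_trans by blast
    also have "\<dots> \<le> norm ?w2 * norm (P2 z *v ?w2)" by (rule hdot_le)
    finally show ?thesis by (simp add: power2_eq_square mult_ac)
  qed
  hence 1: "c0 * norm ?w2 \<le> norm (P2 z *v ?w2)"
    by (cases "norm ?w2 = 0") (auto simp: mult_le_cancel_right)
  define a b c d where "a = P1 z *v vec_deriv w z" and "b = P0 z *v w z"
    and "c = mat_deriv P2 z *v vec_deriv w z" and "d = \<mu> *s w z"
  have e: "P2 z *v ?w2 = a + b - c - d - f z"
    unfolding eq[symmetric] L_op_expand[OF w z] a_def b_def c_def d_def by (simp add: algebra_simps)
  have "norm (P2 z *v ?w2) \<le> norm a + norm b + norm c + norm d + norm (f z)"
    unfolding e using norm_triangle_ineq4[of "a + b - c - d" "f z"] norm_triangle_ineq4[of "a + b - c" d]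
      norm_triangle_ineq4[of "a + b" c] norm_triangle_ineq[of a b] by linarith
  also have "\<dots> \<le> B * norm (vec_deriv w z) + B * norm (w z) + B * norm (vec_deriv w z) + cmod \<mu> * norm (w z) + norm (f z)"
    unfolding a_def b_def c_def d_def
    by (intro add_mono bound1 bound0 bound2' z order_refl) (simp add: norm_vector_scale)
  finally show ?thesis using 1 by (simp add: algebra_simps)
qed

end

section \<open>The operator on the Hardy space\<close>

lemma vec_deriv_cong:
  assumes "\<And>z. z \<in> strip T \<Longrightarrow> f z = g z" "z \<in> strip T"
  shows "vec_deriv f z = vec_deriv g z"
proof -
  have "eventually (\<lambda>w. w \<in> strip T) (nhds z)" using open_strip assms(2) by (rule eventually_nhds_in_open)
  hence "eventually (\<lambda>w. f w $ i = g w $ i) (nhds z)" for i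
    by eventually_elim (simp add: assms(1))
  hence "deriv (\<lambda>w. f w $ i) z = deriv (\<lambda>w. g w $ i) z" for i by (rule deriv_cong_ev) simp
  thus ?thesis by (simp add: vec_deriv_def)
qed

lemma L_op_cong:
  assumes "\<And>z. z \<in> strip T \<Longrightarrow> f z = g z" "z \<in> strip T"
  shows "L_op P2 P1 P0 f z = L_op P2 P1 P0 g z"
proof -
  have "vec_deriv f z = vec_deriv g z" if "z \<in> strip T" for z
    using assms(1) that by (rule vec_deriv_cong)
  thus ?thesis unfolding L_op_def using vec_deriv_cong[of T "\<lambda>w. P2 w *v vec_deriv f w" "\<lambda>w. P2 w *v vec_deriv g w" z] assms
    by simp
qed

lemma line_energy_mono:
  assumes f: "vper_hol T f" and \<tau>: "\<bar>\<tau>\<bar> < T" and g: "(g has_integral I) {0..2*pi}"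
    and le: "\<And>x. (norm (f (Complex x \<tau>)))\<^sup>2 \<le> g x"
  shows "line_energy \<tau> f \<le> I"
proof (rule has_integral_le[OF _ g])
  show "((\<lambda>x. (norm (f (Complex x \<tau>)))\<^sup>2) has_integral line_energy \<tau> f) {0..2*pi}"
    unfolding line_energy_def
    by (intro integrable_integral integrable_continuous_interval continuous_intros continuous_on_line_vec[OF f \<tau>])
qed (rule le)

lemma line_energy_cong:
  assumes "\<And>z. z \<in> strip T \<Longrightarrow> f z = g z" "\<bar>\<tau>\<bar> < T"
  shows "line_energy \<tau> f = line_energy \<tau> g"
  unfolding line_energy_def using assms by (intro integral_cong) simp

lemma fourier_coeff_deriv:
  assumes f: "per_hol T f" and T: "T > 0"
  shows "fourier_coeff (deriv f) n = \<i> * of_int n * fourier_coeff f n"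
proof -
  have hol: "f holomorphic_on strip T" using f by (simp add: per_hol_def)
  let ?e = "\<lambda>z. exp (- \<i> * of_int n * z)"
  define g where "g = (\<lambda>z. f z * ?e z)"
  have g: "per_hol T g" unfolding g_def by (rule per_hol_mult[OF f per_hol_exp_minus])
  have i1: "(\<lambda>x. deriv f (Complex x 0) * ?e (Complex x 0)) integrable_on {0..2*pi}"
    and i2: "(\<lambda>x. f (Complex x 0) * ?e (Complex x 0)) integrable_on {0..2*pi}"
    using per_hol_integrable[OF per_hol_mult[OF per_hol_deriv[OF f] per_hol_exp_minus], of 0 n]
      per_hol_integrable[OF per_hol_mult[OF f per_hol_exp_minus], of 0 n] T by auto
  have "((\<lambda>x. deriv f (Complex x 0) * ?e (Complex x 0) + (- \<i> * of_int n) * (f (Complex x 0) * ?e (Complex x 0)))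
      has_integral (g (Complex (2*pi) 0) - g (Complex 0 0))) {0..2*pi}"
  proof (rule fundamental_theorem_of_calculus)
    fix x :: real
    have "Complex x 0 \<in> strip T" using T by simp
    hence "(g has_field_derivative (deriv f (Complex x 0) * ?e (Complex x 0) + (?e (Complex x 0) * (- \<i> * of_int n)) * f (Complex x 0)))
        (at (Complex x 0))"
      unfolding g_def by (intro DERIV_mult holomorphic_derivI[OF hol open_strip]) (auto intro!: derivative_eq_intros)
    moreover have "deriv f (Complex x 0) * ?e (Complex x 0) + (?e (Complex x 0) * (- \<i> * of_int n)) * f (Complex x 0)
      = deriv f (Complex x 0) * ?e (Complex x 0) + (- \<i> * of_int n) * (f (Complex x 0) * ?e (Complex x 0))"
      by (simp only: mult_ac)
    ultimately have "(g has_field_derivative (deriv f (Complex x 0) * ?e (Complex x 0) +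
        (- \<i> * of_int n) * (f (Complex x 0) * ?e (Complex x 0)))) (at (Complex x 0))" by (simp only:)
    thus "((\<lambda>x. g (Complex x 0)) has_vector_derivative
      (deriv f (Complex x 0) * ?e (Complex x 0) + (- \<i> * of_int n) * (f (Complex x 0) * ?e (Complex x 0))))
      (at x within {0..2*pi})"
      by (rule has_vector_derivative_at_within[OF has_vector_derivative_horizontal])
  qed auto
  moreover have "g (Complex (2*pi) 0) = g (Complex 0 0)"
  proof -
    have "Complex (2*pi) 0 = Complex 0 0 + 2 * of_real pi" by (simp add: complex_eq_iff)
    thus ?thesis using g T by (simp add: per_hol_def)
  qed
  ultimately have "integral {0..2*pi} (\<lambda>x. deriv f (Complex x 0) * ?e (Complex x 0)
      + (- \<i> * of_int n) * (f (Complex x 0) * ?e (Complex x 0))) = 0"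
    by (simp add: integral_unique)
  moreover have i3: "(\<lambda>x. (- \<i> * of_int n) * (f (Complex x 0) * ?e (Complex x 0))) integrable_on {0..2*pi}"
    using i2 by (rule integrable_on_mult_right)
  ultimately have "integral {0..2*pi} (\<lambda>x. deriv f (Complex x 0) * ?e (Complex x 0)) =
      \<i> * of_int n * integral {0..2*pi} (\<lambda>x. f (Complex x 0) * ?e (Complex x 0))"
    unfolding integral_add[OF i1 i3] integral_mult_right by (simp add: algebra_simps)
  moreover have "Complex x 0 = of_real x" for x by (simp add: complex_of_real_def)
  ultimately show ?thesis by (simp add: fourier_coeff_def)
qed

lemma vcoef_vec_deriv:
  assumes "vper_hol T w" "T > 0"
  shows "vcoef (vec_deriv w) n = (\<i> * of_int n) *s vcoef w n"
  using assms fourier_coeff_deriv[of T "\<lambda>z. w z $ _" n]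
  by (simp add: vec_eq_iff vcoef_def vec_deriv_def vper_hol_def)

lemma vper_hol_eqI:
  assumes "vper_hol T f" "vper_hol T g" "\<And>n. vcoef f n = vcoef g n" "z \<in> strip T"
  shows "f z = g z"
proof -
  have "f z $ i = g z $ i" for i
  proof (rule has_sum_unique)
    show "((\<lambda>n. vcoef f n $ i * exp (\<i> * of_int n * z)) has_sum f z $ i) UNIV"
      unfolding vcoef_def vec_lambda_beta
      by (rule fourier_series_converges[OF _ assms(4)]) (use assms(1) in \<open>simp add: vper_hol_def\<close>)
    show "((\<lambda>n. vcoef f n $ i * exp (\<i> * of_int n * z)) has_sum g z $ i) UNIV"
      unfolding assms(3) unfolding vcoef_def vec_lambda_beta
      by (rule fourier_series_converges[OF _ assms(4)]) (use assms(2) in \<open>simp add: vper_hol_def\<close>)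
  qed
  thus ?thesis by (simp add: vec_eq_iff)
qed

lemma hardy_fun_deriv:
  assumes T: "T > 0" and v: "\<And>n. Rep_ell2 v n = (\<i> * of_int n) *s Rep_ell2 u n" and z: "z \<in> strip T"
  shows "vec_deriv (hardy_fun T u) z = hardy_fun T v z"
proof (rule vper_hol_eqI[OF _ hardy_fun_props(1)[OF T] _ z])
  show "vper_hol T (vec_deriv (hardy_fun T u))" by (rule vper_hol_vec_deriv[OF hardy_fun_props(1)[OF T]])
  show "vcoef (vec_deriv (hardy_fun T u)) n = vcoef (hardy_fun T v) n" for n
    unfolding vcoef_vec_deriv[OF hardy_fun_props(1)[OF T] T] hardy_fun_props(3)[OF T] v
    by (simp add: vec_eq_iff complex_eq_iff algebra_simps)
qed

lemma norm_le_of_line_energy: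
  assumes T: "T > 0" and M: "\<And>\<tau>. \<bar>\<tau>\<bar> < T \<Longrightarrow> line_energy \<tau> (hardy_fun T u) \<le> M"
  shows "(norm u)\<^sup>2 \<le> M / (2 * pi)"
proof -
  obtain v where v: "\<And>z. z \<in> strip T \<Longrightarrow> hardy_fun T v z = hardy_fun T u z" "(norm v)\<^sup>2 \<le> M / (2 * pi)"
    using hardy_fun_exists[OF T hardy_fun_props(1)[OF T] M] by blast
  thus ?thesis using hardy_fun_eqI[OF T, of v u] by simp
qed

lemma norm_vec_le_sum: "norm (v :: complex ^ 'k) \<le> (\<Sum>i\<in>UNIV. cmod (v $ i))"
  unfolding norm_vec_def by (rule L2_set_le_sum) auto

lemma finite_support_bounded:
  fixes u :: "(complex ^ 'k) ell2"
  assumes T: "T > 0" and u: "u \<in> finite_support"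
  obtains \<beta> where "\<beta> \<ge> 0" "\<And>z. z \<in> strip T \<Longrightarrow> norm (hardy_fun T u z) \<le> \<beta>"
proof -
  define F where "F = {n. Rep_ell2 u n \<noteq> 0}"
  have F: "finite F" using u by (simp add: F_def finite_support_def)
  define b where "b = (\<lambda>i. \<Sum>n\<in>F. cmod (Rep_ell2 u n $ i / of_real (weight T n)) * exp (\<bar>of_int n\<bar> * T))"
  have comp: "cmod (hardy_fun T u z $ i) \<le> b i" if z: "z \<in> strip T" for z i
  proof -
    have "hardy_fun T u z $ i = (\<Sum>n\<in>F. Rep_ell2 u n $ i / of_real (weight T n) * exp (\<i> * of_int n * z))"
    proof -
      have "hardy_fun T u z $ i = infsum (\<lambda>n. Rep_ell2 u n $ i / of_real (weight T n) * exp (\<i> * of_int n * z)) F"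
        unfolding hardy_fun_def vec_lambda_beta by (rule infsum_cong_neutral) (auto simp: F_def)
      thus ?thesis using F by simp
    qed
    also have "cmod \<dots> \<le> b i" unfolding b_def
    proof (rule order_trans[OF norm_sum], rule sum_mono)
      fix n
      have "- (of_int n * Im z) \<le> \<bar>of_int n\<bar> * \<bar>Im z\<bar>" by (metis abs_ge_minus_self abs_mult)
      also have "\<dots> \<le> \<bar>of_int n\<bar> * T" using z by (intro mult_left_mono) (auto simp: strip_def)
      finally have "cmod (exp (\<i> * of_int n * z)) \<le> exp (\<bar>of_int n\<bar> * T)" by (simp add: norm_exp_eq_Re)
      thus "cmod (Rep_ell2 u n $ i / of_real (weight T n) * exp (\<i> * of_int n * z))
        \<le> cmod (Rep_ell2 u n $ i / of_real (weight T n)) * exp (\<bar>of_int n\<bar> * T)"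
        unfolding norm_mult by (intro mult_left_mono) auto
    qed
    finally show ?thesis .
  qed
  show ?thesis
  proof
    show "(\<Sum>i\<in>UNIV. b i) \<ge> 0" unfolding b_def by (intro sum_nonneg mult_nonneg_nonneg) auto
    show "norm (hardy_fun T u z) \<le> (\<Sum>i\<in>UNIV. b i)" if "z \<in> strip T" for z
      by (rule order_trans[OF norm_vec_le_sum sum_mono]) (rule comp[OF that])
  qed
qed

lemma finite_support_deriv:
  fixes u :: "(complex ^ 'k) ell2"
  assumes T: "T > 0" and u: "u \<in> finite_support"
  obtains v where "v \<in> finite_support" "\<And>z. z \<in> strip T \<Longrightarrow> vec_deriv (hardy_fun T u) z = hardy_fun T v z"
proof -
  define a where "a = (\<lambda>n. (\<i> * of_int n) *s Rep_ell2 u n)"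
  define F where "F = {n. Rep_ell2 u n \<noteq> 0}"
  have F: "finite F" using u by (simp add: F_def finite_support_def)
  have "((\<lambda>n. (norm (a n))\<^sup>2) has_sum (\<Sum>n\<in>F. (norm (a n))\<^sup>2)) UNIV"
    by (rule has_sum_finite_neutralI[OF F]) (auto simp: F_def a_def)
  then obtain v where v: "Rep_ell2 v = a" using Abs_ell2_inverse[of a] has_sum_imp_summable by auto
  have "{n. Rep_ell2 v n \<noteq> 0} \<subseteq> F" by (auto simp: v a_def F_def)
  hence "v \<in> finite_support" using F finite_subset by (auto simp: finite_support_def)
  moreover have "vec_deriv (hardy_fun T u) z = hardy_fun T v z" if "z \<in> strip T" for z
    by (rule hardy_fun_deriv[OF T _ that]) (simp add: v a_def)
  ultimately show ?thesis using that by blast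
qed

text \<open>The maximal domain: all elements of the Hardy space that the differential expression maps back into
  the Hardy space.\<close>

definition hardy_dom :: "real \<Rightarrow> (complex \<Rightarrow> complex ^ 'k ^ 'k) \<Rightarrow> (complex \<Rightarrow> complex ^ 'k ^ 'k)
       \<Rightarrow> (complex \<Rightarrow> complex ^ 'k ^ 'k) \<Rightarrow> (complex ^ 'k) ell2 set" where
  "hardy_dom T P2 P1 P0 = {u. \<exists>h. \<forall>z\<in>strip T. L_op P2 P1 P0 (hardy_fun T u) z = hardy_fun T h z}"

text \<open>The chosen \<open>h\<close> is unique, since \<open>hardy_fun\<close> is injective.\<close>

definition hardy_op :: "real \<Rightarrow> (complex \<Rightarrow> complex ^ 'k ^ 'k) \<Rightarrow> (complex \<Rightarrow> complex ^ 'k ^ 'k)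
       \<Rightarrow> (complex \<Rightarrow> complex ^ 'k ^ 'k) \<Rightarrow> (complex ^ 'k) ell2 \<Rightarrow> (complex ^ 'k) ell2" where
  "hardy_op T P2 P1 P0 u = (SOME h. \<forall>z\<in>strip T. L_op P2 P1 P0 (hardy_fun T u) z = hardy_fun T h z)"

lemma hardy_op:
  assumes "u \<in> hardy_dom T P2 P1 P0" "z \<in> strip T"
  shows "L_op P2 P1 P0 (hardy_fun T u) z = hardy_fun T (hardy_op T P2 P1 P0 u) z"
  using assms someI_ex[of "\<lambda>h. \<forall>z\<in>strip T. L_op P2 P1 P0 (hardy_fun T u) z = hardy_fun T h z"]
  unfolding hardy_dom_def hardy_op_def by blast

lemma hardy_opI:
  assumes T: "T > 0" and "\<And>z. z \<in> strip T \<Longrightarrow> L_op P2 P1 P0 (hardy_fun T u) z = hardy_fun T h z"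
  shows "u \<in> hardy_dom T P2 P1 P0" "hardy_op T P2 P1 P0 u = h"
proof -
  show d: "u \<in> hardy_dom T P2 P1 P0" using assms unfolding hardy_dom_def by blast
  show "hardy_op T P2 P1 P0 u = h"
    by (rule hardy_fun_eqI[OF T]) (use hardy_op[OF d] assms(2) in simp)
qed

context elliptic begin

lemma L_op_add:
  assumes "vper_hol T v" "vper_hol T w" "z \<in> strip T"
  shows "L_op P2 P1 P0 (\<lambda>z. v z + w z) z = L_op P2 P1 P0 v z + L_op P2 P1 P0 w z"
proof -
  have d: "vec_deriv (\<lambda>z. v z + w z) z = vec_deriv v z + vec_deriv w z" if "z \<in> strip T" for z
    by (rule vec_deriv_add[OF assms(1,2) that])
  have "vec_deriv (vec_deriv (\<lambda>z. v z + w z)) z = vec_deriv (\<lambda>z. vec_deriv v z + vec_deriv w z) z"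
    by (rule vec_deriv_cong[OF d assms(3)])
  also have "\<dots> = vec_deriv (vec_deriv v) z + vec_deriv (vec_deriv w) z"
    by (rule vec_deriv_add[OF vper_hol_vec_deriv[OF assms(1)] vper_hol_vec_deriv[OF assms(2)] assms(3)])
  finally show ?thesis
    by (simp add: L_op_expand[OF _ assms(3)] assms(1,2) vper_hol_add d[OF assms(3)] matrix_vector_right_distrib algebra_simps)
qed

lemma L_op_scale:
  assumes "vper_hol T w" "z \<in> strip T"
  shows "L_op P2 P1 P0 (\<lambda>z. c *s w z) z = c *s L_op P2 P1 P0 w z"
proof -
  have d: "vec_deriv (\<lambda>z. c *s w z) z = c *s vec_deriv w z" if "z \<in> strip T" for z
    by (rule vec_deriv_scale[OF assms(1) that])
  have "vec_deriv (vec_deriv (\<lambda>z. c *s w z)) z = vec_deriv (\<lambda>z. c *s vec_deriv w z) z"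
    by (rule vec_deriv_cong[OF d assms(2)])
  also have "\<dots> = c *s vec_deriv (vec_deriv w) z"
    by (rule vec_deriv_scale[OF vper_hol_vec_deriv[OF assms(1)] assms(2)])
  finally have d2: "vec_deriv (vec_deriv (\<lambda>z. c *s w z)) z = c *s vec_deriv (vec_deriv w) z" .
  show ?thesis
    unfolding L_op_expand[OF vper_hol_scale[OF assms(1)] assms(2)] L_op_expand[OF assms] d[OF assms(2)] d2
    by (simp add: vec_eq_iff vector_scalar_commute algebra_simps)
qed

abbreviation "\<Phi> \<equiv> hardy_fun T"
abbreviation "hdom \<equiv> hardy_dom T P2 P1 P0"
abbreviation "hop \<equiv> hardy_op T P2 P1 P0"

lemmas \<Phi>_per = hardy_fun_props(1)[OF T]

lemma dom_add: "u \<in> hdom \<Longrightarrow> v \<in> hdom \<Longrightarrow> u + v \<in> hdom \<and> hop (u + v) = hop u + hop v"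
  and dom_scale: "u \<in> hdom \<Longrightarrow> scaleC c u \<in> hdom \<and> hop (scaleC c u) = scaleC c (hop u)"
proof -
  show "u + v \<in> hdom \<and> hop (u + v) = hop u + hop v" if "u \<in> hdom" "v \<in> hdom"
  proof -
    have "L_op P2 P1 P0 (\<Phi> (u + v)) z = \<Phi> (hop u + hop v) z" if z: "z \<in> strip T" for z
    proof -
      have "L_op P2 P1 P0 (\<Phi> (u + v)) z = L_op P2 P1 P0 (\<lambda>z. \<Phi> u z + \<Phi> v z) z"
        by (rule L_op_cong[OF hardy_fun_add[OF T] z])
      thus ?thesis using hardy_op[OF \<open>u \<in> hdom\<close> z] hardy_op[OF \<open>v \<in> hdom\<close> z]
        by (simp add: L_op_add[OF \<Phi>_per \<Phi>_per z] hardy_fun_add[OF T z])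
    qed
    thus ?thesis using hardy_opI[OF T] by blast
  qed
  show "scaleC c u \<in> hdom \<and> hop (scaleC c u) = scaleC c (hop u)" if "u \<in> hdom"
  proof -
    have "L_op P2 P1 P0 (\<Phi> (scaleC c u)) z = \<Phi> (scaleC c (hop u)) z" if z: "z \<in> strip T" for z
    proof -
      have "L_op P2 P1 P0 (\<Phi> (scaleC c u)) z = L_op P2 P1 P0 (\<lambda>z. c *s \<Phi> u z) z"
        by (rule L_op_cong[OF hardy_fun_scale[OF T] z])
      thus ?thesis using hardy_op[OF \<open>u \<in> hdom\<close> z]
        by (simp add: L_op_scale[OF \<Phi>_per z] hardy_fun_scale[OF T z])
    qed
    thus ?thesis using hardy_opI[OF T] by blast
  qed
qed

lemma dom_equation:
  assumes "u \<in> hdom" "z \<in> strip T"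
  shows "L_op P2 P1 P0 (\<Phi> u) z - \<mu> *s \<Phi> u z = \<Phi> (hop u - scaleC \<mu> u) z"
  using hardy_op[OF assms] by (simp add: hardy_fun_diff[OF T assms(2)] hardy_fun_scale[OF T assms(2)])

lemma L_op_pointwise:
  assumes "vper_hol T w" "z \<in> strip T"
  shows "norm (L_op P2 P1 P0 w z) \<le> B * norm (w z) + 2 * B * norm (vec_deriv w z) + B * norm (vec_deriv (vec_deriv w) z)"
proof -
  define a b c d where "a = mat_deriv P2 z *v vec_deriv w z" and "b = P2 z *v vec_deriv (vec_deriv w) z"
    and "c = P1 z *v vec_deriv w z" and "d = P0 z *v w z"
  have "norm (L_op P2 P1 P0 w z) \<le> norm a + norm b + norm c + norm d"
    unfolding L_op_expand[OF assms] a_def[symmetric] b_def[symmetric] c_def[symmetric] d_def[symmetric]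
    using norm_triangle_ineq[of "- (a + b) + c" d] norm_triangle_ineq[of "- (a + b)" c] norm_triangle_ineq[of a b]
      norm_minus_cancel[of "a + b"] by linarith
  also have "\<dots> \<le> B * norm (vec_deriv w z) + B * norm (vec_deriv (vec_deriv w) z) + B * norm (vec_deriv w z) + B * norm (w z)"
    unfolding a_def b_def c_def d_def by (intro add_mono bound2 bound2' bound1 bound0 assms(2))
  finally show ?thesis by (simp add: algebra_simps)
qed

lemma sum3_square: "((a::real) + b + c)\<^sup>2 \<le> 3 * (a\<^sup>2 + b\<^sup>2 + c\<^sup>2)"
  using sum_squares_bound[of a b] sum_squares_bound[of a c] sum_squares_bound[of b c]
  by (simp add: power2_eq_square algebra_simps)

text \<open>A bounded energy of the first two derivatives on all lines puts \<open>u\<close> into the maximal domain.\<close>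

lemma domI:
  assumes "\<And>\<tau>. \<bar>\<tau>\<bar> < T \<Longrightarrow> line_energy \<tau> (vec_deriv (\<Phi> u)) \<le> M"
    and "\<And>\<tau>. \<bar>\<tau>\<bar> < T \<Longrightarrow> line_energy \<tau> (vec_deriv (vec_deriv (\<Phi> u))) \<le> M"
  shows "u \<in> hdom"
proof -
  let ?w = "\<Phi> u"
  define N where "N = 3 * (B\<^sup>2 * (4 * pi * (norm u)\<^sup>2) + (2 * B)\<^sup>2 * M + B\<^sup>2 * M)"
  have "line_energy \<tau> (L_op P2 P1 P0 ?w) \<le> N" if \<tau>: "\<bar>\<tau>\<bar> < T" for \<tau>
  proof -
    have zs: "Complex x \<tau> \<in> strip T" for x using \<tau> by simp
    have hi: "((\<lambda>x. 3 * (B\<^sup>2 * (norm (?w (Complex x \<tau>)))\<^sup>2 + (2 * B)\<^sup>2 * (norm (vec_deriv ?w (Complex x \<tau>)))\<^sup>2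
        + B\<^sup>2 * (norm (vec_deriv (vec_deriv ?w) (Complex x \<tau>)))\<^sup>2)) has_integral
       3 * (B\<^sup>2 * line_energy \<tau> ?w + (2 * B)\<^sup>2 * line_energy \<tau> (vec_deriv ?w) + B\<^sup>2 * line_energy \<tau> (vec_deriv (vec_deriv ?w)))) {0..2*pi}"
      by (intro has_integral_mult_right has_integral_add has_integral_line_energy \<tau> \<Phi>_per vper_hol_vec_deriv)
    have "line_energy \<tau> (L_op P2 P1 P0 ?w) \<le>
       3 * (B\<^sup>2 * line_energy \<tau> ?w + (2 * B)\<^sup>2 * line_energy \<tau> (vec_deriv ?w) + B\<^sup>2 * line_energy \<tau> (vec_deriv (vec_deriv ?w)))"
    proof (rule line_energy_mono[OF vper_hol_L_op[OF \<Phi>_per] \<tau> hi])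
      fix x
      have "(norm (L_op P2 P1 P0 ?w (Complex x \<tau>)))\<^sup>2 \<le> (B * norm (?w (Complex x \<tau>)) + 2 * B * norm (vec_deriv ?w (Complex x \<tau>))
          + B * norm (vec_deriv (vec_deriv ?w) (Complex x \<tau>)))\<^sup>2"
        by (rule power_mono[OF L_op_pointwise[OF \<Phi>_per zs]]) simp
      also have "\<dots> \<le> 3 * ((B * norm (?w (Complex x \<tau>)))\<^sup>2 + (2 * B * norm (vec_deriv ?w (Complex x \<tau>)))\<^sup>2
          + (B * norm (vec_deriv (vec_deriv ?w) (Complex x \<tau>)))\<^sup>2)" by (rule sum3_square)
      finally show "(norm (L_op P2 P1 P0 ?w (Complex x \<tau>)))\<^sup>2 \<le>
         3 * (B\<^sup>2 * (norm (?w (Complex x \<tau>)))\<^sup>2 + (2 * B)\<^sup>2 * (norm (vec_deriv ?w (Complex x \<tau>)))\<^sup>2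
        + B\<^sup>2 * (norm (vec_deriv (vec_deriv ?w) (Complex x \<tau>)))\<^sup>2)" by (simp only: power_mult_distrib)
    qed
    also have "\<dots> \<le> N" unfolding N_def
      by (intro mult_left_mono add_mono line_energy_hardy_fun assms \<tau>) auto
    finally show ?thesis .
  qed
  then obtain h where "\<And>z. z \<in> strip T \<Longrightarrow> \<Phi> h z = L_op P2 P1 P0 ?w z"
    using hardy_fun_exists[OF T vper_hol_L_op[OF \<Phi>_per]] by blast
  thus ?thesis using hardy_opI(1)[OF T] by metis
qed

lemma finite_support_dom: "finite_support \<subseteq> hdom"
proof
  fix u :: "(complex ^ 'k) ell2" assume "u \<in> finite_support"
  then obtain v where v: "v \<in> finite_support" "\<And>z. z \<in> strip T \<Longrightarrow> vec_deriv (\<Phi> u) z = \<Phi> v z"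
    using finite_support_deriv[OF T] by blast
  then obtain v' where v': "\<And>z. z \<in> strip T \<Longrightarrow> vec_deriv (\<Phi> v) z = \<Phi> v' z"
    using finite_support_deriv[OF T] by blast
  have 2: "vec_deriv (vec_deriv (\<Phi> u)) z = \<Phi> v' z" if "z \<in> strip T" for z
    using vec_deriv_cong[OF v(2) that] v'[OF that] by simp
  show "u \<in> hdom"
  proof (rule domI[where M = "max (4 * pi * (norm v)\<^sup>2) (4 * pi * (norm v')\<^sup>2)"])
    fix \<tau> assume \<tau>: "\<bar>\<tau>\<bar> < T"
    show "line_energy \<tau> (vec_deriv (\<Phi> u)) \<le> max (4 * pi * (norm v)\<^sup>2) (4 * pi * (norm v')\<^sup>2)"
      using line_energy_hardy_fun[OF \<tau>, of v] line_energy_cong[OF v(2) \<tau>] by simp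
    show "line_energy \<tau> (vec_deriv (vec_deriv (\<Phi> u))) \<le> max (4 * pi * (norm v)\<^sup>2) (4 * pi * (norm v')\<^sup>2)"
      using line_energy_hardy_fun[OF \<tau>, of v'] line_energy_cong[OF 2 \<tau>] by simp
  qed
qed

lemma op_left_half_plane:
  assumes u: "u \<in> hdom" and \<mu>: "Re \<mu> \<le> 0" "4 * sector_const c0 B \<le> cmod \<mu>"
  shows "cmod \<mu> * norm u \<le> 4 * sector_const c0 B * norm (hop u - scaleC \<mu> u)"
proof -
  let ?S = "sector_const c0 B" and ?g = "hop u - scaleC \<mu> u"
  have S: "?S \<ge> 2" by (rule sector_const_ge)
  have m: "cmod \<mu> > 0" using \<mu>(2) S by linarith
  have "(norm u)\<^sup>2 \<le> (8 * pi * ?S\<^sup>2 * (norm ?g)\<^sup>2 / (cmod \<mu>)\<^sup>2) / (2 * pi)"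
  proof (rule norm_le_of_line_energy[OF T])
    fix \<tau> assume \<tau>: "\<bar>\<tau>\<bar> < T"
    have "(cmod \<mu>)\<^sup>2 * line_energy \<tau> (\<Phi> u) \<le> 2 * ?S\<^sup>2 * line_energy \<tau> (\<Phi> ?g)"
      by (rule sector_energy_bound[OF \<Phi>_per \<Phi>_per \<tau> dom_equation[OF u] \<mu>])
    also have "\<dots> \<le> 2 * ?S\<^sup>2 * (4 * pi * (norm ?g)\<^sup>2)"
      by (intro mult_left_mono line_energy_hardy_fun \<tau>) auto
    finally show "line_energy \<tau> (\<Phi> u) \<le> 8 * pi * ?S\<^sup>2 * (norm ?g)\<^sup>2 / (cmod \<mu>)\<^sup>2"
      using m by (simp add: field_simps)
  qed
  hence "(cmod \<mu> * norm u)\<^sup>2 \<le> (2 * ?S * norm ?g)\<^sup>2"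
    using m by (simp add: field_simps power_mult_distrib)
  hence "cmod \<mu> * norm u \<le> 2 * ?S * norm ?g" by (rule power2_le_imp_le) (use S in simp)
  also have "\<dots> \<le> 4 * ?S * norm ?g" using S by (intro mult_right_mono) auto
  finally show ?thesis .
qed

text \<open>Convergence in norm is locally uniform, so all derivatives converge pointwise and the differential
  equation passes to the limit.\<close>

lemma op_closed:
  assumes U: "\<And>n. U n \<in> hdom" and u: "U \<longlonglongrightarrow> u" and h: "(\<lambda>n. hop (U n)) \<longlonglongrightarrow> h"
  shows "u \<in> hdom \<and> hop u = h"
proof -
  have ptw: "\<Phi> (X n) z $ i - \<Phi> x z $ i = \<Phi> (X n - x) z $ i" if "z \<in> strip T" for X :: "nat \<Rightarrow> (complex ^ 'k) ell2" and x z n i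
    by (simp add: hardy_fun_diff[OF T that])
  have ul: "uniform_limit {z. \<bar>Im z\<bar> < y} (\<lambda>n z. \<Phi> (X n) z $ i) (\<lambda>z. \<Phi> x z $ i) sequentially"
    if X: "X \<longlonglongrightarrow> x" and y: "y < T" for X :: "nat \<Rightarrow> (complex ^ 'k) ell2" and x y i
  proof (rule uniform_limitI)
    fix e :: real assume e: "e > 0"
    obtain K where K: "K \<ge> 0" "\<And>u :: (complex ^ 'k) ell2. \<And>z i. \<bar>Im z\<bar> \<le> y \<Longrightarrow> cmod (\<Phi> u z $ i) \<le> K * norm u"
      using hardy_fun_eval_bound[OF T y] by metis
    have "(\<lambda>n. X n - x) \<longlonglongrightarrow> 0" using X by (simp add: LIM_zero)
    hence "(\<lambda>n. K * norm (X n - x)) \<longlonglongrightarrow> 0" by (intro tendsto_mult_right_zero tendsto_norm_zero)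
    hence "eventually (\<lambda>n. K * norm (X n - x) < e) sequentially" using e by (rule order_tendstoD(2))
    thus "eventually (\<lambda>n. \<forall>z\<in>{z. \<bar>Im z\<bar> < y}. dist (\<Phi> (X n) z $ i) (\<Phi> x z $ i) < e) sequentially"
    proof eventually_elim
      case (elim n)
      show ?case
      proof
        fix z assume "z \<in> {z. \<bar>Im z\<bar> < y}"
        hence z: "z \<in> strip T" "\<bar>Im z\<bar> \<le> y" using y by (auto simp: strip_def)
        show "dist (\<Phi> (X n) z $ i) (\<Phi> x z $ i) < e"
          unfolding dist_norm ptw[OF z(1)] using K(2)[OF z(2), of "X n - x" i] elim by linarith
      qed
    qed
  qed
  have "L_op P2 P1 P0 (\<Phi> u) z = \<Phi> h z" if z: "z \<in> strip T" for z
  proof -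
    define y where "y = (\<bar>Im z\<bar> + T) / 2"
    have y: "\<bar>Im z\<bar> < y" "y < T" using z by (auto simp: y_def strip_def abs_if)
    define S where "S = {z. \<bar>Im z\<bar> < y}"
    have "S = strip y" by (auto simp: S_def strip_def)
    hence S: "open S" "z \<in> S" using open_strip y by (auto simp: S_def)
    have sub: "S \<subseteq> strip T" using y by (auto simp: S_def strip_def)
    have hol: "(\<lambda>z. \<Phi> x z $ i) holomorphic_on S" for x :: "(complex ^ 'k) ell2" and i
      using \<Phi>_per[of x] holomorphic_on_subset[OF _ sub] by (simp add: vper_hol_def per_hol_def)
    have d: "(\<lambda>n. (deriv ^^ m) (\<lambda>z. \<Phi> (U n) z $ i) z) \<longlonglongrightarrow> (deriv ^^ m) (\<lambda>z. \<Phi> u z $ i) z" for m i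
      by (rule higher_deriv_complex_uniform_limit[OF ul[OF u y(2), folded S_def] _ _ S]) (auto simp: hol)
    have "vec_deriv (vec_deriv w) z $ i = (deriv ^^ 2) (\<lambda>z. w z $ i) z" for w :: "complex \<Rightarrow> complex ^ 'k" and i
      by (simp add: vec_deriv_def numeral_2_eq_2)
    hence d2: "(\<lambda>n. vec_deriv (vec_deriv (\<Phi> (U n))) z) \<longlonglongrightarrow> vec_deriv (vec_deriv (\<Phi> u)) z"
      using d[of 2] by (intro vec_tendstoI) simp
    have d1: "(\<lambda>n. vec_deriv (\<Phi> (U n)) z) \<longlonglongrightarrow> vec_deriv (\<Phi> u) z"
      using d[of 1] by (intro vec_tendstoI) (simp add: vec_deriv_def)
    have d0: "(\<lambda>n. \<Phi> (U n) z) \<longlonglongrightarrow> \<Phi> u z" using d[of 0] by (intro vec_tendstoI) simp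
    have mv: "((\<lambda>n. P *v x n) \<longlonglongrightarrow> P *v l)" if "x \<longlonglongrightarrow> l" for P :: "complex ^ 'k ^ 'k" and x l
      unfolding matrix_vector_mult_def
      by (intro vec_tendstoI) (simp, intro tendsto_intros that)
    have "(\<lambda>n. L_op P2 P1 P0 (\<Phi> (U n)) z) \<longlonglongrightarrow> L_op P2 P1 P0 (\<Phi> u) z"
      unfolding L_op_expand[OF \<Phi>_per z] by (intro tendsto_add tendsto_minus mv d0 d1 d2)
    hence 1: "(\<lambda>n. \<Phi> (hop (U n)) z) \<longlonglongrightarrow> L_op P2 P1 P0 (\<Phi> u) z" by (simp add: hardy_op[OF U z])
    have "(\<lambda>n. \<Phi> (hop (U n)) z) \<longlonglongrightarrow> \<Phi> h z"
      by (intro vec_tendstoI tendsto_uniform_limitI[OF ul[OF h y(2), folded S_def] S(2)])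
    thus ?thesis using 1 LIMSEQ_unique by blast
  qed
  thus ?thesis using hardy_opI[OF T] by blast
qed

text \<open>The energy inequality bounds the first derivative on all lines, which provides the weight \<open>n\<^sup>2\<close>
  needed for the compact embedding.\<close>

lemma op_compact:
  fixes U :: "nat \<Rightarrow> (complex ^ 'k) ell2"
  assumes U: "\<And>n. U n \<in> hdom" and bU: "bounded (range U)" and bA: "bounded (range (\<lambda>n. hop (U n)))"
  shows "\<exists>r u. strict_mono r \<and> (\<lambda>n. U (r n)) \<longlonglongrightarrow> u"
proof -
  obtain M where M: "\<And>n. norm (U n) \<le> M" using bU by (auto simp: bounded_iff)
  obtain M' where M': "\<And>n. norm (hop (U n)) \<le> M'" using bA by (auto simp: bounded_iff)
  define N where "N = 2 / c0 * (4 * pi * M'\<^sup>2 + (1 + lower_const c0 B) * (4 * pi * M\<^sup>2))"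
  have le1: "line_energy \<tau> (vec_deriv (\<Phi> (U n))) \<le> N" if \<tau>: "\<bar>\<tau>\<bar> < T" for \<tau> n
  proof -
    have "line_energy \<tau> (vec_deriv (\<Phi> (U n))) \<le>
        2 / c0 * (line_energy \<tau> (\<Phi> (hop (U n))) + (1 + cmod 0 + lower_const c0 B) * line_energy \<tau> (\<Phi> (U n)))"
      by (rule derivative_energy_bound[OF \<Phi>_per \<Phi>_per \<tau>]) (simp add: hardy_op[OF U])
    also have "\<dots> \<le> 2 / c0 * (4 * pi * M'\<^sup>2 + (1 + lower_const c0 B) * (4 * pi * M\<^sup>2))"
    proof -
      have "line_energy \<tau> (\<Phi> (hop (U n))) \<le> 4 * pi * M'\<^sup>2"
        by (rule order_trans[OF line_energy_hardy_fun[OF \<tau>]]) (auto intro!: power_mono M')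
      moreover have "line_energy \<tau> (\<Phi> (U n)) \<le> 4 * pi * M\<^sup>2"
        by (rule order_trans[OF line_energy_hardy_fun[OF \<tau>]]) (auto intro!: power_mono M)
      ultimately show ?thesis
        using c0 lower_const_nonneg by (intro mult_left_mono add_mono) auto
    qed
    finally show ?thesis by (simp add: N_def)
  qed
  show ?thesis
  proof (rule ell2_compact_embedding)
    fix k and F :: "int set" assume F: "finite F"
    have eq: "(weight T n)\<^sup>2 * (norm (vcoef (vec_deriv (\<Phi> (U k))) n))\<^sup>2 = (of_int n)\<^sup>2 * (norm (Rep_ell2 (U k) n))\<^sup>2" for n
      using weight_pos[of T n]
      by (simp add: vcoef_vec_deriv[OF \<Phi>_per T] hardy_fun_props(3)[OF T] norm_vector_scale norm_mult power_mult_distrib power_divide)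
    have "(\<Sum>n\<in>F. (of_int n)\<^sup>2 * (norm (Rep_ell2 (U k) n))\<^sup>2) \<le> N / (2 * pi)"
      unfolding eq[symmetric] by (rule bounded_line_energy_coeffs[OF T vper_hol_vec_deriv[OF \<Phi>_per] le1 F])
    moreover have "(\<Sum>n\<in>F. (norm (Rep_ell2 (U k) n))\<^sup>2) \<le> M\<^sup>2"
      by (rule order_trans[OF ell2_sum_le[OF F]]) (auto intro!: power_mono M)
    ultimately show "(\<Sum>n\<in>F. (1 + (of_int n)\<^sup>2) * (norm (Rep_ell2 (U k) n))\<^sup>2) \<le> M\<^sup>2 + N / (2 * pi)"
      by (simp add: distrib_right sum.distrib)
  qed
qed

end

section \<open>Growth of solutions in the vertical direction\<close>

context elliptic begin

text \<open>Along the vertical line through \<open>x\<close> the equation is a second order system with frequency of size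
  \<open>sqrt (cmod \<mu>)\<close>. In the scaled energy \<open>\<kappa>\<^sup>2 norm w\<^sup>2 + norm w'\<^sup>2\<close> with \<open>\<kappa>\<^sup>2 = 1 + cmod \<mu>\<close> the factor
  \<open>\<mu>\<close> costs only one power of \<open>\<kappa>\<close>, so Gronwall gives growth \<open>exp (M \<kappa> \<bar>\<tau>\<bar>)\<close>: order \<open>1/2\<close> in \<open>\<mu>\<close>.\<close>

lemma vertical_growth:
  assumes w: "vper_hol T w" and eq: "\<And>z. z \<in> strip T \<Longrightarrow> L_op P2 P1 P0 w z - \<mu> *s w z = f z"
    and \<beta>: "\<And>z. z \<in> strip T \<Longrightarrow> norm (f z) \<le> \<beta>" and \<tau>: "\<bar>\<tau>\<bar> < T"
  defines "\<kappa> \<equiv> sqrt (1 + cmod \<mu>)" and "M \<equiv> 2 + (1 + 5 * B) / c0"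
  shows "\<kappa>\<^sup>2 * (norm (w (Complex x \<tau>)))\<^sup>2 + (norm (vec_deriv w (Complex x \<tau>)))\<^sup>2 \<le>
    exp (M * \<kappa> * \<bar>\<tau>\<bar>) * (\<kappa>\<^sup>2 * (norm (w (Complex x 0)))\<^sup>2 + (norm (vec_deriv w (Complex x 0)))\<^sup>2 + (\<beta> / c0)\<^sup>2 * \<bar>\<tau>\<bar>)"
proof -
  note w' = vper_hol_vec_deriv[OF w]
  have \<kappa>2: "\<kappa>\<^sup>2 = 1 + cmod \<mu>" by (simp add: \<kappa>_def)
  have \<kappa>1: "\<kappa> \<ge> 1" by (simp add: \<kappa>_def)
  have M0: "M \<ge> 0" using c0 B by (simp add: M_def)
  show ?thesis
  proof (rule gronwall_two_sided[where \<phi> = "\<lambda>\<tau>. \<kappa>\<^sup>2 * (norm (w (Complex x \<tau>)))\<^sup>2 + (norm (vec_deriv w (Complex x \<tau>)))\<^sup>2"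
        and \<phi>' = "\<lambda>\<tau>. \<kappa>\<^sup>2 * (- 2 * Im (hdot (w (Complex x \<tau>)) (vec_deriv w (Complex x \<tau>))))
          + (- 2 * Im (hdot (vec_deriv w (Complex x \<tau>)) (vec_deriv (vec_deriv w) (Complex x \<tau>))))"])
    fix s assume s: "\<bar>s\<bar> < T"
    show "((\<lambda>\<tau>. \<kappa>\<^sup>2 * (norm (w (Complex x \<tau>)))\<^sup>2 + (norm (vec_deriv w (Complex x \<tau>)))\<^sup>2) has_real_derivative
      \<kappa>\<^sup>2 * (- 2 * Im (hdot (w (Complex x s)) (vec_deriv w (Complex x s))))
          + (- 2 * Im (hdot (vec_deriv w (Complex x s)) (vec_deriv (vec_deriv w) (Complex x s))))) (at s)"
      by (intro DERIV_add DERIV_cmult norm_square_vertical[OF w s] norm_square_vertical[OF w' s])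
    have zs: "Complex x s \<in> strip T" using s by simp
    define a b b2 where "a = norm (w (Complex x s))" and "b = norm (vec_deriv w (Complex x s))"
      and "b2 = norm (vec_deriv (vec_deriv w) (Complex x s))"
    have nn: "a \<ge> 0" "b \<ge> 0" "b2 \<ge> 0" by (auto simp: a_def b_def b2_def)
    define A where "A = \<kappa> * a"
    define Q where "Q = \<kappa> * (A\<^sup>2 + b\<^sup>2)"
    have AQ: "\<kappa>\<^sup>2 * a\<^sup>2 = A\<^sup>2" by (simp add: A_def power_mult_distrib)
    have cross: "\<kappa> * (2 * A * b) \<le> Q"
      unfolding Q_def using sum_squares_bound[of A b] \<kappa>1 by (intro mult_left_mono) auto
    have bQ: "b\<^sup>2 \<le> Q"
    proof -
      have "b\<^sup>2 \<le> A\<^sup>2 + b\<^sup>2" by simp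
      also have "\<dots> \<le> Q" unfolding Q_def using \<kappa>1 mult_right_mono[of 1 \<kappa> "A\<^sup>2 + b\<^sup>2"] by simp
      finally show ?thesis .
    qed
    have b2: "b2 \<le> \<beta> / c0 + (1 + B) / c0 * (\<kappa> * A) + 2 * B / c0 * b"
    proof -
      have "c0 * b2 \<le> norm (f (Complex x s)) + (cmod \<mu> + B) * a + 2 * B * b"
        unfolding a_def b_def b2_def by (rule second_derivative_pointwise[OF w zs, of \<mu> f, OF eq[OF zs]])
      also have "\<dots> \<le> \<beta> + (1 + B) * (\<kappa> * A) + 2 * B * b"
      proof -
        have "cmod \<mu> + B \<le> (1 + B) * \<kappa>\<^sup>2" unfolding \<kappa>2 using B by (simp add: algebra_simps)
        hence "(cmod \<mu> + B) * a \<le> (1 + B) * \<kappa>\<^sup>2 * a" using nn by (intro mult_right_mono)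
        thus ?thesis using \<beta>[OF zs] by (simp add: A_def power2_eq_square mult_ac)
      qed
      finally show ?thesis using c0 by (simp add: field_simps)
    qed
    have "2 * b * b2 \<le> 2 * b * (\<beta> / c0 + (1 + B) / c0 * (\<kappa> * A) + 2 * B / c0 * b)"
      using b2 nn by (intro mult_left_mono) auto
    also have "\<dots> = 2 * b * (\<beta> / c0) + (1 + B) / c0 * (\<kappa> * (2 * A * b)) + 4 * B / c0 * b\<^sup>2"
      by (simp add: power2_eq_square algebra_simps)
    also have "\<dots> \<le> (b\<^sup>2 + (\<beta> / c0)\<^sup>2) + (1 + B) / c0 * Q + 4 * B / c0 * Q"
      using sum_squares_bound[of b "\<beta> / c0"] cross bQ B c0
      by (intro add_mono mult_left_mono) auto
    finally have 2: "2 * b * b2 \<le> Q + (\<beta> / c0)\<^sup>2 + (1 + B) / c0 * Q + 4 * B / c0 * Q" using bQ by linarith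
    have 1: "\<kappa>\<^sup>2 * (2 * (a * b)) \<le> Q" using cross by (simp add: A_def power2_eq_square mult_ac)
    have "\<bar>\<kappa>\<^sup>2 * (- 2 * Im (hdot (w (Complex x s)) (vec_deriv w (Complex x s))))
          + (- 2 * Im (hdot (vec_deriv w (Complex x s)) (vec_deriv (vec_deriv w) (Complex x s))))\<bar>
      \<le> \<kappa>\<^sup>2 * (2 * (a * b)) + 2 * b * b2"
    proof -
      have i1: "\<bar>Im (hdot (w (Complex x s)) (vec_deriv w (Complex x s)))\<bar> \<le> a * b"
        unfolding a_def b_def by (rule order_trans[OF abs_Im_le_cmod hdot_le])
      have i2: "\<bar>Im (hdot (vec_deriv w (Complex x s)) (vec_deriv (vec_deriv w) (Complex x s)))\<bar> \<le> b * b2"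
        unfolding b_def b2_def by (rule order_trans[OF abs_Im_le_cmod hdot_le])
      define J1 J2 where "J1 = Im (hdot (w (Complex x s)) (vec_deriv w (Complex x s)))"
        and "J2 = Im (hdot (vec_deriv w (Complex x s)) (vec_deriv (vec_deriv w) (Complex x s)))"
      have "\<bar>\<kappa>\<^sup>2 * (- 2 * J1) + (- 2 * J2)\<bar> \<le> \<bar>\<kappa>\<^sup>2 * (- 2 * J1)\<bar> + \<bar>- 2 * J2\<bar>" by (rule abs_triangle_ineq)
      also have "\<dots> = \<kappa>\<^sup>2 * (2 * \<bar>J1\<bar>) + 2 * \<bar>J2\<bar>" by (simp add: abs_mult)
      also have "\<dots> \<le> \<kappa>\<^sup>2 * (2 * (a * b)) + 2 * (b * b2)"
        using i1 i2 unfolding J1_def[symmetric] J2_def[symmetric] by (intro add_mono mult_left_mono) auto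
      finally show ?thesis unfolding J1_def J2_def by (simp only: mult.assoc)
    qed
    also have "\<dots> \<le> M * Q + (\<beta> / c0)\<^sup>2"
    proof -
      have "M * Q = Q + Q + (1 + B) / c0 * Q + 4 * B / c0 * Q"
        using c0 by (simp add: M_def field_simps)
      thus ?thesis using 1 2 by linarith
    qed
    also have "M * Q = M * \<kappa> * (\<kappa>\<^sup>2 * (norm (w (Complex x s)))\<^sup>2 + (norm (vec_deriv w (Complex x s)))\<^sup>2)"
      by (simp add: Q_def AQ[symmetric] a_def b_def)
    finally show "\<bar>\<kappa>\<^sup>2 * (- 2 * Im (hdot (w (Complex x s)) (vec_deriv w (Complex x s))))
          + (- 2 * Im (hdot (vec_deriv w (Complex x s)) (vec_deriv (vec_deriv w) (Complex x s))))\<bar>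
      \<le> M * \<kappa> * (\<kappa>\<^sup>2 * (norm (w (Complex x s)))\<^sup>2 + (norm (vec_deriv w (Complex x s)))\<^sup>2) + (\<beta> / c0)\<^sup>2" .
  qed (use M0 \<kappa>1 \<tau> in auto)
qed

lemma line_energy_growth:
  assumes w: "vper_hol T w" and eq: "\<And>z. z \<in> strip T \<Longrightarrow> L_op P2 P1 P0 w z - \<mu> *s w z = f z"
    and \<beta>: "\<And>z. z \<in> strip T \<Longrightarrow> norm (f z) \<le> \<beta>" and \<tau>: "\<bar>\<tau>\<bar> < T"
  defines "\<kappa> \<equiv> sqrt (1 + cmod \<mu>)" and "M \<equiv> 2 + (1 + 5 * B) / c0"
  shows "line_energy \<tau> w \<le> exp (M * T * \<kappa>) *
     (\<kappa>\<^sup>2 * line_energy 0 w + line_energy 0 (vec_deriv w) + 2 * pi * T * (\<beta> / c0)\<^sup>2)"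
proof -
  note w' = vper_hol_vec_deriv[OF w]
  have z0: "\<bar>0::real\<bar> < T" using T by simp
  have \<kappa>1: "\<kappa> \<ge> 1" by (simp add: \<kappa>_def)
  have M0: "M \<ge> 0" using c0 B by (simp add: M_def)
  have const: "((\<lambda>x. (\<beta> / c0)\<^sup>2 * T) has_integral (2 * pi - 0) *\<^sub>R ((\<beta> / c0)\<^sup>2 * T)) {0..2*pi}"
    using has_integral_const_real[of "(\<beta> / c0)\<^sup>2 * T" 0 "2*pi"] by simp
  have hi: "((\<lambda>x. exp (M * T * \<kappa>) * (\<kappa>\<^sup>2 * (norm (w (Complex x 0)))\<^sup>2 + (norm (vec_deriv w (Complex x 0)))\<^sup>2 + (\<beta> / c0)\<^sup>2 * T)) has_integral
     exp (M * T * \<kappa>) * (\<kappa>\<^sup>2 * line_energy 0 w + line_energy 0 (vec_deriv w) + (2 * pi - 0) *\<^sub>R ((\<beta> / c0)\<^sup>2 * T))) {0..2*pi}"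
    by (intro has_integral_mult_right has_integral_add has_integral_line_energy z0 w w' const)
  have "line_energy \<tau> w \<le> exp (M * T * \<kappa>) * (\<kappa>\<^sup>2 * line_energy 0 w + line_energy 0 (vec_deriv w) + (2 * pi - 0) *\<^sub>R ((\<beta> / c0)\<^sup>2 * T))"
  proof (rule line_energy_mono[OF w \<tau> hi])
    fix x
    let ?s = "\<kappa>\<^sup>2 * (norm (w (Complex x 0)))\<^sup>2 + (norm (vec_deriv w (Complex x 0)))\<^sup>2"
    have "(norm (w (Complex x \<tau>)))\<^sup>2 \<le> \<kappa>\<^sup>2 * (norm (w (Complex x \<tau>)))\<^sup>2"
      using \<kappa>1 by (simp add: mult_le_cancel_right1)
    also have "\<dots> \<le> \<kappa>\<^sup>2 * (norm (w (Complex x \<tau>)))\<^sup>2 + (norm (vec_deriv w (Complex x \<tau>)))\<^sup>2" by simp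
    also have "\<dots> \<le> exp (M * \<kappa> * \<bar>\<tau>\<bar>) * (?s + (\<beta> / c0)\<^sup>2 * \<bar>\<tau>\<bar>)"
      unfolding M_def \<kappa>_def by (rule vertical_growth[OF w eq \<beta> \<tau>])
    also have "\<dots> \<le> exp (M * T * \<kappa>) * (?s + (\<beta> / c0)\<^sup>2 * T)"
    proof (rule mult_mono)
      have "M * \<kappa> * \<bar>\<tau>\<bar> \<le> M * \<kappa> * T" using M0 \<kappa>1 \<tau> by (intro mult_left_mono) auto
      thus "exp (M * \<kappa> * \<bar>\<tau>\<bar>) \<le> exp (M * T * \<kappa>)" by (simp add: mult_ac)
      show "?s + (\<beta> / c0)\<^sup>2 * \<bar>\<tau>\<bar> \<le> ?s + (\<beta> / c0)\<^sup>2 * T" using \<tau> by (intro add_left_mono mult_left_mono) auto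
    qed auto
    finally show "(norm (w (Complex x \<tau>)))\<^sup>2 \<le> exp (M * T * \<kappa>) * (?s + (\<beta> / c0)\<^sup>2 * T)" .
  qed
  thus ?thesis by (simp add: mult_ac)
qed

text \<open>Eigenfunctions are only assumed holomorphic in the open strip; the vertical growth estimate with
  right-hand side \<open>0\<close> bounds their energies up to the boundary.\<close>

lemma eigenfunction_in_hardy:
  assumes w: "vper_hol T w" and eq: "\<And>z. z \<in> strip T \<Longrightarrow> L_op P2 P1 P0 w z = \<mu> *s w z"
  obtains u where "\<And>z. z \<in> strip T \<Longrightarrow> \<Phi> u z = w z"
proof -
  have "line_energy \<tau> w \<le> exp ((2 + (1 + 5 * B) / c0) * T * sqrt (1 + cmod \<mu>)) *
     ((sqrt (1 + cmod \<mu>))\<^sup>2 * line_energy 0 w + line_energy 0 (vec_deriv w) + 2 * pi * T * (0 / c0)\<^sup>2)"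
    if "\<bar>\<tau>\<bar> < T" for \<tau>
    by (rule line_energy_growth[OF w, of \<mu> "\<lambda>_. 0"]) (use eq that in auto)
  from hardy_fun_exists[OF T w this] show ?thesis using that by blast
qed

text \<open>For a trigonometric polynomial \<open>f\<close>, which is bounded on the strip, the norm of a solution in the Hardy
  space is bounded by its energy on the real line: the energy of \<open>w'\<close> there is controlled by that of
  \<open>w\<close>, and both propagate vertically. The polynomial factor \<open>\<kappa>\<^sup>2\<close> is absorbed into the exponential.\<close>

lemma op_growth:
  assumes f: "f \<in> finite_support"
  shows "\<exists>C>0. \<forall>u\<in>hdom. \<forall>\<mu>. hop u - scaleC \<mu> u = f \<longrightarrow>
     (norm u)\<^sup>2 \<le> C * exp (C * sqrt (cmod \<mu>)) * (line_energy 0 (\<Phi> u) / (2 * pi) + 1)"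
proof -
  obtain \<beta> where \<beta>: "\<beta> \<ge> 0" "\<And>z. z \<in> strip T \<Longrightarrow> norm (\<Phi> f z) \<le> \<beta>"
    using finite_support_bounded[OF T f] by blast
  have z0: "\<bar>0::real\<bar> < T" using T by simp
  define M where "M = 2 + (1 + 5 * B) / c0"
  have M0: "M \<ge> 0" using c0 B by (simp add: M_def)
  define Q where "Q = 1 + 2 / c0 * (1 + lower_const c0 B) + 2 / c0 * (4 * pi * (norm f)\<^sup>2) + 2 * pi * T * (\<beta> / c0)\<^sup>2"
  have Q1: "Q \<ge> 1" using c0 T lower_const_nonneg by (simp add: Q_def)
  define C where "C = max (2 * Q * exp (M * T + 1)) (M * T + 1)"
  have C0: "C > 0" using M0 T by (simp add: C_def less_max_iff_disj add_nonneg_pos)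
  have "(norm u)\<^sup>2 \<le> C * exp (C * sqrt (cmod \<mu>)) * (line_energy 0 (\<Phi> u) / (2 * pi) + 1)"
    if u: "u \<in> hdom" and eqf: "hop u - scaleC \<mu> u = f" for u \<mu>
  proof -
    define \<kappa> where "\<kappa> = sqrt (1 + cmod \<mu>)"
    have \<kappa>1: "\<kappa> \<ge> 1" by (simp add: \<kappa>_def)
    have \<kappa>2: "\<kappa>\<^sup>2 = 1 + cmod \<mu>" by (simp add: \<kappa>_def)
    have \<kappa>s: "\<kappa> \<le> 1 + sqrt (cmod \<mu>)"
      unfolding \<kappa>_def by (rule order_trans[OF sqrt_add_le_add_sqrt]) auto
    define W0 where "W0 = line_energy 0 (\<Phi> u)"
    have W0: "W0 \<ge> 0" by (simp add: W0_def line_energy_nonneg)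
    note eq = dom_equation[OF u, of _ \<mu>, unfolded eqf]
    have W1: "line_energy 0 (vec_deriv (\<Phi> u)) \<le> 2 / c0 * (4 * pi * (norm f)\<^sup>2 + (1 + lower_const c0 B) * (\<kappa>\<^sup>2 * W0))"
    proof -
      have "line_energy 0 (vec_deriv (\<Phi> u)) \<le> 2 / c0 * (line_energy 0 (\<Phi> f) + (1 + cmod \<mu> + lower_const c0 B) * W0)"
        unfolding W0_def by (rule derivative_energy_bound[OF \<Phi>_per \<Phi>_per z0 eq])
      also have "\<dots> \<le> 2 / c0 * (4 * pi * (norm f)\<^sup>2 + ((1 + lower_const c0 B) * \<kappa>\<^sup>2) * W0)"
      proof (intro mult_left_mono add_mono mult_right_mono line_energy_hardy_fun z0 W0)
        have "0 \<le> lower_const c0 B * cmod \<mu>" using lower_const_nonneg by simp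
        thus "1 + cmod \<mu> + lower_const c0 B \<le> (1 + lower_const c0 B) * \<kappa>\<^sup>2"
          unfolding \<kappa>2 by (simp add: algebra_simps)
      qed (use c0 in auto)
      finally show ?thesis by (simp add: mult.assoc)
    qed
    have "(norm u)\<^sup>2 \<le> (exp (M * T * \<kappa>) * (\<kappa>\<^sup>2 * W0 + line_energy 0 (vec_deriv (\<Phi> u)) + 2 * pi * T * (\<beta> / c0)\<^sup>2)) / (2 * pi)"
      unfolding W0_def M_def \<kappa>_def
      by (rule norm_le_of_line_energy[OF T line_energy_growth[OF \<Phi>_per eq \<beta>(2)]])
    hence "2 * pi * (norm u)\<^sup>2 \<le> exp (M * T * \<kappa>) * (\<kappa>\<^sup>2 * W0 + line_energy 0 (vec_deriv (\<Phi> u)) + 2 * pi * T * (\<beta> / c0)\<^sup>2)"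
      by (simp add: field_simps)
    also have "\<dots> \<le> exp (M * T * \<kappa>) * (Q * \<kappa>\<^sup>2 * (W0 + 1))"
    proof (rule mult_left_mono)
      define a b where "a = 2 / c0 * (4 * pi * (norm f)\<^sup>2)" and "b = 2 * pi * T * (\<beta> / c0)\<^sup>2"
      define d where "d = 2 / c0 * (1 + lower_const c0 B)"
      have nn: "a \<ge> 0" "b \<ge> 0" "d \<ge> 0" using c0 T lower_const_nonneg by (auto simp: a_def b_def d_def)
      have k1: "\<kappa>\<^sup>2 \<ge> 1" using \<kappa>1 by simp
      have kw: "\<kappa>\<^sup>2 * (W0 + 1) \<ge> 1" using mult_mono[of 1 "\<kappa>\<^sup>2" 1 "W0 + 1"] k1 W0 by simp
      have "\<kappa>\<^sup>2 * W0 + line_energy 0 (vec_deriv (\<Phi> u)) + b \<le> (1 + d) * (\<kappa>\<^sup>2 * W0) + (a + b)"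
        using W1 by (simp add: a_def d_def algebra_simps add_divide_distrib)
      also have "\<dots> \<le> (1 + d) * (\<kappa>\<^sup>2 * (W0 + 1)) + (a + b) * (\<kappa>\<^sup>2 * (W0 + 1))"
        using nn kw W0 mult_left_mono[of 1 "\<kappa>\<^sup>2 * (W0 + 1)" "a + b"]
        by (intro add_mono mult_left_mono) auto
      also have "\<dots> = Q * \<kappa>\<^sup>2 * (W0 + 1)" by (simp add: Q_def a_def b_def d_def algebra_simps)
      finally show "\<kappa>\<^sup>2 * W0 + line_energy 0 (vec_deriv (\<Phi> u)) + 2 * pi * T * (\<beta> / c0)\<^sup>2 \<le> Q * \<kappa>\<^sup>2 * (W0 + 1)"
        by (simp add: b_def)
    qed auto
    also have "\<dots> \<le> exp (M * T * \<kappa>) * (Q * (2 * exp \<kappa>) * (W0 + 1))"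
    proof -
      have "\<kappa>\<^sup>2 / 2 \<le> exp \<kappa>" using exp_lower_Taylor_quadratic[of \<kappa>] \<kappa>1 by simp
      thus ?thesis using Q1 W0 by (intro mult_left_mono mult_right_mono) auto
    qed
    also have "\<dots> = 2 * Q * exp ((M * T + 1) * \<kappa>) * (W0 + 1)"
    proof -
      have "exp ((M * T + 1) * \<kappa>) = exp (M * T * \<kappa>) * exp \<kappa>" by (simp add: exp_add[symmetric] distrib_right)
      thus ?thesis by (simp only: mult_ac)
    qed
    also have "\<dots> \<le> 2 * Q * exp ((M * T + 1) * (1 + sqrt (cmod \<mu>))) * (W0 + 1)"
      using \<kappa>s Q1 W0 M0 T by (intro mult_right_mono mult_left_mono) (auto intro!: mult_left_mono)
    also have "\<dots> = (2 * Q * exp (M * T + 1)) * exp ((M * T + 1) * sqrt (cmod \<mu>)) * (W0 + 1)"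
    proof -
      have "exp ((M * T + 1) * (1 + sqrt (cmod \<mu>))) = exp (M * T + 1) * exp ((M * T + 1) * sqrt (cmod \<mu>))"
        by (simp only: distrib_left exp_add mult_1_right)
      thus ?thesis by (simp only: mult_ac)
    qed
    also have "\<dots> \<le> C * exp (C * sqrt (cmod \<mu>)) * (W0 + 1)"
      using W0 C0 by (intro mult_right_mono mult_mono) (auto simp: C_def intro!: mult_right_mono)
    also have "\<dots> \<le> C * exp (C * sqrt (cmod \<mu>)) * (W0 + 2 * pi)"
      using C0 pi_gt3 by (intro mult_left_mono) auto
    also have "\<dots> = 2 * pi * (C * exp (C * sqrt (cmod \<mu>)) * (W0 / (2 * pi) + 1))"
      by (simp add: field_simps)
    finally show ?thesis by (simp add: W0_def)
  qed
  thus ?thesis using C0 by blast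
qed

lemma dom_diff: "u \<in> hdom \<Longrightarrow> v \<in> hdom \<Longrightarrow> u - v \<in> hdom \<and> hop (u - v) = hop u - hop v"
  using dom_add[of u "scaleC (-1) v"] dom_scale[of v "-1"] by simp

end

section \<open>Surjectivity by deformation to the Laplacian\<close>

text \<open>The coefficients of the deformation: with \<open>A\<close> the identity for the leading coefficient and \<open>0\<close> for the
  lower ones, \<open>\<theta> = 0\<close> is the operator \<open>- D\<^sup>2\<close> and \<open>\<theta> = 1\<close> the given one.\<close>

definition mat_homotopy :: "real \<Rightarrow> complex ^ 'k ^ 'k \<Rightarrow> complex ^ 'k ^ 'k \<Rightarrow> complex ^ 'k ^ 'k" where
  "mat_homotopy \<theta> A P = (\<chi> i j. of_real (1 - \<theta>) * A $ i $ j + of_real \<theta> * P $ i $ j)"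

lemma mat_homotopy_mult: "mat_homotopy \<theta> A P *v V = of_real (1 - \<theta>) *s (A *v V) + of_real \<theta> *s (P *v V)"
  by (simp add: mat_homotopy_def matrix_vector_mult_def vec_eq_iff sum_distrib_left sum.distrib[symmetric] algebra_simps)

lemma mat_per_hol_mat_homotopy: "mat_per_hol T P \<Longrightarrow> mat_per_hol T (\<lambda>z. mat_homotopy \<theta> A (P z))"
  unfolding mat_per_hol_def mat_homotopy_def by (simp add: per_hol_add per_hol_mult per_hol_const)

lemma mat_deriv_mat_homotopy:
  assumes "mat_per_hol T P" "z \<in> strip T"
  shows "mat_deriv (\<lambda>z. mat_homotopy \<theta> A (P z)) z = mat_homotopy \<theta> 0 (mat_deriv P z)"
proof -
  have "((\<lambda>z. of_real (1 - \<theta>) * A $ i $ j + of_real \<theta> * P z $ i $ j) has_field_derivative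
      0 + of_real \<theta> * deriv (\<lambda>z. P z $ i $ j) z) (at z)" for i j
    using assms unfolding mat_per_hol_def per_hol_def
    by (intro DERIV_add DERIV_const DERIV_cmult holomorphic_derivI[OF _ open_strip]) auto
  thus ?thesis by (simp add: mat_deriv_def mat_homotopy_def vec_eq_iff DERIV_imp_deriv)
qed

lemma norm_mat_homotopy:
  assumes \<theta>: "0 \<le> \<theta>" "\<theta> \<le> 1" and A: "norm (A *v V) \<le> norm V" and P: "norm (P *v V) \<le> B * norm V" and B: "B \<ge> 0"
  shows "norm (mat_homotopy \<theta> A P *v V) \<le> (B + 1) * norm V"
proof -
  have "norm (mat_homotopy \<theta> A P *v V) \<le> (1 - \<theta>) * norm (A *v V) + \<theta> * norm (P *v V)"
    unfolding mat_homotopy_mult using \<theta> norm_triangle_ineq[of "of_real (1 - \<theta>) *s (A *v V)" "of_real \<theta> *s (P *v V)"]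
    by (simp only: norm_vector_scale norm_of_real abs_of_nonneg diff_ge_0_iff_ge)
  also have "\<dots> \<le> 1 * norm V + 1 * (B * norm V)"
    using \<theta> A P B by (intro add_mono mult_mono) auto
  finally show ?thesis by (simp add: algebra_simps)
qed

lemma mat_deriv_const: "mat_deriv (\<lambda>_. A) z = 0"
  by (simp add: mat_deriv_def vec_eq_iff)

lemma elliptic_laplacian:
  assumes "T > 0" shows "elliptic T 1 1 (\<lambda>_. mat 1 :: complex ^ 'k ^ 'k) (\<lambda>_. 0) (\<lambda>_. 0)"
  by unfold_locales (use assms in \<open>auto simp: mat_per_hol_def per_hol_const mat_deriv_const hdot_self\<close>)

lemma L_op_laplacian: "L_op (\<lambda>_. mat 1) (\<lambda>_. 0) (\<lambda>_. 0) w z = - vec_deriv (vec_deriv w) z"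
  by (simp add: L_op_def)

text \<open>On the Fourier side \<open>- D\<^sup>2 + t\<close> is multiplication by \<open>n\<^sup>2 + t\<close>.\<close>

lemma laplacian_resolvent:
  fixes f :: "(complex ^ 'k) ell2"
  assumes T: "T > 0" and t: "t \<ge> 1"
  shows "\<exists>u\<in>hardy_dom T (\<lambda>_. mat 1) (\<lambda>_. 0) (\<lambda>_. 0). hardy_op T (\<lambda>_. mat 1) (\<lambda>_. 0) (\<lambda>_. 0) u + t *\<^sub>R u = f"
proof -
  define a where "a = (\<lambda>n. (1 / ((of_int n)\<^sup>2 + t)) *\<^sub>R Rep_ell2 f n)"
  have pos: "(of_int n)\<^sup>2 + t \<ge> 1" for n :: int using t by (simp add: add_increasing)
  have "(\<lambda>n. (norm (a n))\<^sup>2) summable_on UNIV"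
  proof (rule summable_on_comparison_test[OF ell2_summable[of f]])
    fix n
    have "norm (a n) = 1 / ((of_int n)\<^sup>2 + t) * norm (Rep_ell2 f n)" using pos[of n] by (simp add: a_def)
    also have "\<dots> \<le> 1 * norm (Rep_ell2 f n)" using pos[of n] by (intro mult_right_mono) auto
    finally show "(norm (a n))\<^sup>2 \<le> (norm (Rep_ell2 f n))\<^sup>2" by (intro power_mono) auto
  qed auto
  then obtain u where u: "Rep_ell2 u = a" using Abs_ell2_inverse[of a] by auto
  let ?w = "hardy_fun T u"
  note per = hardy_fun_props(1)[OF T, of u]
  have eq: "L_op (\<lambda>_. mat 1) (\<lambda>_. 0) (\<lambda>_. 0) ?w z = hardy_fun T (f - t *\<^sub>R u) z" if z: "z \<in> strip T" for z
    unfolding L_op_laplacian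
  proof (rule vper_hol_eqI[OF vper_hol_minus[OF vper_hol_vec_deriv[OF vper_hol_vec_deriv[OF per]]] hardy_fun_props(1)[OF T] _ z])
    fix n
    have "vcoef (\<lambda>z. - vec_deriv (vec_deriv ?w) z) n = - vcoef (vec_deriv (vec_deriv ?w)) n"
      using fourier_coeff_cmult[of "-1"] by (simp add: vcoef_def vec_eq_iff)
    also have "vcoef (vec_deriv (vec_deriv ?w)) n = (\<i> * of_int n) *s ((\<i> * of_int n) *s vcoef ?w n)"
      unfolding vcoef_vec_deriv[OF vper_hol_vec_deriv[OF per] T] vcoef_vec_deriv[OF per T] ..
    also have "\<dots> = - ((of_int n)\<^sup>2 *\<^sub>R vcoef ?w n)"
      by (simp add: vec_eq_iff complex_eq_iff power2_eq_square)
    finally have "vcoef (\<lambda>z. - vec_deriv (vec_deriv ?w) z) n = ((of_int n)\<^sup>2 / weight T n) *\<^sub>R a n"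
      by (simp add: hardy_fun_props(3)[OF T] u)
    moreover have "vcoef (hardy_fun T (f - t *\<^sub>R u)) n = (1 / weight T n) *\<^sub>R (((of_int n)\<^sup>2 + t) *\<^sub>R a n - t *\<^sub>R a n)"
      using pos[of n] by (simp add: hardy_fun_props(3)[OF T] minus_ell2.rep_eq scaleR_ell2.rep_eq u) (simp add: a_def)
    ultimately show "vcoef (\<lambda>z. - vec_deriv (vec_deriv ?w) z) n = vcoef (hardy_fun T (f - t *\<^sub>R u)) n"
      by (simp add: scaleR_add_left)
  qed
  show ?thesis using hardy_opI[OF T eq] by (intro bexI[of _ u]) auto
qed

context elliptic begin

text \<open>Coercivity and bounds are convex conditions, so they hold along the deformation with constants
  independent of \<open>\<theta>\<close>.\<close>

lemma elliptic_homotopy: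
  assumes \<theta>: "0 \<le> \<theta>" "\<theta> \<le> 1"
  shows "elliptic T (min c0 1) (B + 1) (\<lambda>z. mat_homotopy \<theta> (mat 1) (P2 z)) (\<lambda>z. mat_homotopy \<theta> 0 (P1 z)) (\<lambda>z. mat_homotopy \<theta> 0 (P0 z))"
proof
  show "T > 0" "min c0 1 > 0" "B + 1 \<ge> 0" using T c0 B by auto
  show "mat_per_hol T (\<lambda>z. mat_homotopy \<theta> (mat 1) (P2 z))" "mat_per_hol T (\<lambda>z. mat_homotopy \<theta> 0 (P1 z))" "mat_per_hol T (\<lambda>z. mat_homotopy \<theta> 0 (P0 z))"
    by (intro mat_per_hol_mat_homotopy hol2 hol1 hol0)+
  fix z V assume z: "z \<in> strip T"
  show "norm (mat_homotopy \<theta> (mat 1) (P2 z) *v V) \<le> (B + 1) * norm V"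
    by (rule norm_mat_homotopy[OF \<theta> _ bound2[OF z] B]) simp
  show "norm (mat_deriv (\<lambda>z. mat_homotopy \<theta> (mat 1) (P2 z)) z *v V) \<le> (B + 1) * norm V"
    unfolding mat_deriv_mat_homotopy[OF hol2 z] by (rule norm_mat_homotopy[OF \<theta> _ bound2'[OF z] B]) simp
  show "norm (mat_homotopy \<theta> 0 (P1 z) *v V) \<le> (B + 1) * norm V"
    by (rule norm_mat_homotopy[OF \<theta> _ bound1[OF z] B]) simp
  show "norm (mat_homotopy \<theta> 0 (P0 z) *v V) \<le> (B + 1) * norm V"
    by (rule norm_mat_homotopy[OF \<theta> _ bound0[OF z] B]) simp
  have "min c0 1 * (norm V)\<^sup>2 = (1 - \<theta>) * (min c0 1 * (norm V)\<^sup>2) + \<theta> * (min c0 1 * (norm V)\<^sup>2)"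
    by (simp add: algebra_simps)
  also have "\<dots> \<le> (1 - \<theta>) * (norm V)\<^sup>2 + \<theta> * Re (hdot V (P2 z *v V))"
  proof (intro add_mono mult_left_mono)
    show "min c0 1 * (norm V)\<^sup>2 \<le> (norm V)\<^sup>2" using mult_right_mono[of "min c0 1" 1 "(norm V)\<^sup>2"] by simp
    have "min c0 1 * (norm V)\<^sup>2 \<le> c0 * (norm V)\<^sup>2" by (intro mult_right_mono) auto
    thus "min c0 1 * (norm V)\<^sup>2 \<le> Re (hdot V (P2 z *v V))" using coercive[OF z, of V] by linarith
  qed (use \<theta> in auto)
  also have "\<dots> = Re (hdot V (mat_homotopy \<theta> (mat 1) (P2 z) *v V))"
    by (simp add: mat_homotopy_mult hdot_add_right hdot_diff_right hdot_scale_right hdot_self algebra_simps)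
  finally show "min c0 1 * (norm V)\<^sup>2 \<le> Re (hdot V (mat_homotopy \<theta> (mat 1) (P2 z) *v V))" .
qed

lemma L_op_homotopy:
  assumes \<theta>: "0 \<le> \<theta>" "\<theta> \<le> 1" and w: "vper_hol T w" and z: "z \<in> strip T"
  shows "L_op (\<lambda>z. mat_homotopy \<theta> (mat 1) (P2 z)) (\<lambda>z. mat_homotopy \<theta> 0 (P1 z)) (\<lambda>z. mat_homotopy \<theta> 0 (P0 z)) w z =
    of_real (1 - \<theta>) *s (- vec_deriv (vec_deriv w) z) + of_real \<theta> *s L_op P2 P1 P0 w z"
  unfolding elliptic.L_op_expand[OF elliptic_homotopy[OF \<theta>] w z] L_op_expand[OF w z] mat_deriv_mat_homotopy[OF hol2 z] mat_homotopy_mult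
  by (simp add: vec_eq_iff algebra_simps)

text \<open>The domain of \<open>- D\<^sup>2\<close> serves as the common domain of the deformation.\<close>

lemma laplacian_dom_subset:
  assumes "u \<in> hardy_dom T (\<lambda>_. mat 1) (\<lambda>_. 0) (\<lambda>_. 0)"
  shows "u \<in> hdom"
proof -
  interpret lap: elliptic T 1 1 "\<lambda>_. mat 1 :: complex ^ 'k ^ 'k" "\<lambda>_. 0" "\<lambda>_. 0"
    by (rule elliptic_laplacian[OF T])
  let ?h = "hardy_op T (\<lambda>_. mat 1) (\<lambda>_. 0) (\<lambda>_. 0) u"
  have h: "- vec_deriv (vec_deriv (\<Phi> u)) z = \<Phi> ?h z" if "z \<in> strip T" for z
    using hardy_op[OF assms that] by (simp add: L_op_laplacian)
  define N where "N = 2 / 1 * (4 * pi * (norm ?h)\<^sup>2 + (1 + cmod 0 + lower_const 1 1) * (4 * pi * (norm u)\<^sup>2))"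
  have 2: "line_energy \<tau> (vec_deriv (vec_deriv (\<Phi> u))) \<le> 4 * pi * (norm ?h)\<^sup>2" if \<tau>: "\<bar>\<tau>\<bar> < T" for \<tau>
  proof -
    have "line_energy \<tau> (vec_deriv (vec_deriv (\<Phi> u))) = line_energy \<tau> (\<lambda>z. - vec_deriv (vec_deriv (\<Phi> u)) z)"
      by (simp add: line_energy_def)
    also have "\<dots> = line_energy \<tau> (\<Phi> ?h)" by (rule line_energy_cong[OF h \<tau>])
    also have "\<dots> \<le> 4 * pi * (norm ?h)\<^sup>2" by (rule line_energy_hardy_fun[OF \<tau>])
    finally show ?thesis .
  qed
  have 1: "line_energy \<tau> (vec_deriv (\<Phi> u)) \<le> N" if \<tau>: "\<bar>\<tau>\<bar> < T" for \<tau>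
  proof -
    have "line_energy \<tau> (vec_deriv (\<Phi> u)) \<le> 2 / 1 * (line_energy \<tau> (\<Phi> ?h) + (1 + cmod 0 + lower_const 1 1) * line_energy \<tau> (\<Phi> u))"
      by (rule lap.derivative_energy_bound[OF \<Phi>_per \<Phi>_per \<tau>]) (simp add: hardy_op[OF assms])
    also have "\<dots> \<le> N" unfolding N_def
      using lap.lower_const_nonneg by (intro mult_left_mono add_mono line_energy_hardy_fun \<tau>) auto
    finally show ?thesis .
  qed
  show ?thesis
    by (rule domI[where M = "max N (4 * pi * (norm ?h)\<^sup>2)"]) (use 1 2 in \<open>auto simp: le_max_iff_disj\<close>)
qed

text \<open>Method of continuity from \<open>- D\<^sup>2 + t\<close> to \<open>L + t\<close>. The sectorial estimate at \<open>\<mu> = - t\<close> bounds \<open>w\<close> by the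
  right-hand side \<open>g\<close> at parameter \<open>\<theta>\<close>, the energy inequality then bounds \<open>w'\<close> and the equation itself
  \<open>w''\<close>; so the difference of the two endpoint operators is bounded by \<open>g\<close> uniformly in \<open>\<theta>\<close>.\<close>

lemma op_onto_far_left: "\<exists>m. \<forall>t\<ge>m. \<forall>f. \<exists>u\<in>hdom. hop u + t *\<^sub>R u = f"
proof -
  define c B' where "c = min c0 1" and "B' = B + 1"
  define S C1 where "S = sector_const c B'" and "C1 = lower_const c B'"
  define D0 where "D0 = hardy_dom T (\<lambda>_. mat 1 :: complex ^ 'k ^ 'k) (\<lambda>_. 0) (\<lambda>_. 0)"
  define A0 where "A0 = hardy_op T (\<lambda>_. mat 1 :: complex ^ 'k ^ 'k) (\<lambda>_. 0) (\<lambda>_. 0)"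
  have c: "c > 0" "B' \<ge> 0" using c0 B by (auto simp: c_def B'_def)
  interpret lap: elliptic T 1 1 "\<lambda>_. mat 1 :: complex ^ 'k ^ 'k" "\<lambda>_. 0" "\<lambda>_. 0"
    by (rule elliptic_laplacian[OF T])
  have "\<exists>u\<in>D0. hop u + t *\<^sub>R u = f" if t: "t \<ge> max 1 (4 * S)" for t f
  proof -
    define K1 where "K1 = 2 * B' + (B' / c) * (1 + t + 3 * B')"
    define G where "G = 1 + 2 * S\<^sup>2 / t\<^sup>2 + 2 / c * (1 + (1 + t + C1) * (2 * S\<^sup>2 / t\<^sup>2))"
    have t1: "t \<ge> 1" "t \<ge> 4 * S" using t by auto
    have K1: "K1 \<ge> 0" using c t1 by (simp add: K1_def)
    show ?thesis
    proof (rule method_of_continuity[where ?A0.0 = "\<lambda>u. A0 u + t *\<^sub>R u" and B = "sqrt (6 * K1\<^sup>2 * G)"])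
      show "u - v \<in> D0" "A0 (u - v) + t *\<^sub>R (u - v) = A0 u + t *\<^sub>R u - (A0 v + t *\<^sub>R v)"
        "hop (u - v) + t *\<^sub>R (u - v) = hop u + t *\<^sub>R u - (hop v + t *\<^sub>R v)"
        if "u \<in> D0" "v \<in> D0" for u v
        using lap.dom_diff[of u v] dom_diff[of u v] that laplacian_dom_subset
        by (auto simp: D0_def A0_def algebra_simps)
      show "\<exists>u\<in>D0. A0 u + t *\<^sub>R u = f" for f
        unfolding D0_def A0_def by (rule laplacian_resolvent[OF T t1(1)])
    next
      fix u and \<theta> :: real assume u: "u \<in> D0" and \<theta>: "0 \<le> \<theta>" "\<theta> \<le> 1"
      interpret th: elliptic T c B' "\<lambda>z. mat_homotopy \<theta> (mat 1) (P2 z)" "\<lambda>z. mat_homotopy \<theta> 0 (P1 z)" "\<lambda>z. mat_homotopy \<theta> 0 (P0 z)"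
        unfolding c_def B'_def by (rule elliptic_homotopy[OF \<theta>])
      have uh: "u \<in> hdom" using laplacian_dom_subset u by (simp add: D0_def)
      define g where "g = (1 - \<theta>) *\<^sub>R (A0 u + t *\<^sub>R u) + \<theta> *\<^sub>R (hop u + t *\<^sub>R u)"
      define v where "v = hop u - A0 u"
      let ?w = "\<Phi> u"
      have a0: "\<Phi> (A0 u) z = - vec_deriv (vec_deriv ?w) z" if "z \<in> strip T" for z
        using hardy_op[OF u[unfolded D0_def] that] by (simp add: L_op_laplacian A0_def)
      have a1: "\<Phi> (hop u) z = L_op P2 P1 P0 ?w z" if "z \<in> strip T" for z
        using hardy_op[OF uh that] by simp
      have "g = scaleC (of_real (1 - \<theta>)) (A0 u) + scaleC (of_real \<theta>) (hop u) + scaleC (of_real t) u"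
        unfolding g_def ell2.sc_of_real by (simp add: algebra_simps)
      hence eq: "L_op (\<lambda>z. mat_homotopy \<theta> (mat 1) (P2 z)) (\<lambda>z. mat_homotopy \<theta> 0 (P1 z)) (\<lambda>z. mat_homotopy \<theta> 0 (P0 z)) ?w z - (- of_real t) *s ?w z = \<Phi> g z"
        if z: "z \<in> strip T" for z
        unfolding L_op_homotopy[OF \<theta> \<Phi>_per z]
        by (simp add: hardy_fun_add[OF T z] hardy_fun_scale[OF T z] a0[OF z] a1[OF z] vec_eq_iff)
      have main: "line_energy \<tau> (\<Phi> v) \<le> 3 * K1\<^sup>2 * G * (4 * pi * (norm g)\<^sup>2)" if \<tau>: "\<bar>\<tau>\<bar> < T" for \<tau>
      proof -
        define W0 W1 F0 where "W0 = line_energy \<tau> ?w" and "W1 = line_energy \<tau> (vec_deriv ?w)" and "F0 = line_energy \<tau> (\<Phi> g)"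
        have F0: "F0 \<ge> 0" "F0 \<le> 4 * pi * (norm g)\<^sup>2"
          by (auto simp: F0_def line_energy_nonneg line_energy_hardy_fun[OF \<tau>])
        have "(cmod (- of_real t))\<^sup>2 * W0 \<le> 2 * S\<^sup>2 * F0"
          unfolding W0_def F0_def S_def
          by (rule th.sector_energy_bound[OF \<Phi>_per \<Phi>_per \<tau> eq]) (use t1 in \<open>auto simp: S_def\<close>)
        hence W0: "W0 \<le> 2 * S\<^sup>2 / t\<^sup>2 * F0" using t1 by (simp add: field_simps)
        have "W1 \<le> 2 / c * (F0 + (1 + cmod (- of_real t) + C1) * W0)"
          unfolding W0_def W1_def F0_def C1_def
          by (rule th.derivative_energy_bound[OF \<Phi>_per \<Phi>_per \<tau> eq])
        also have "\<dots> \<le> 2 / c * (F0 + (1 + t + C1) * (2 * S\<^sup>2 / t\<^sup>2 * F0))"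
        proof -
          have "(1 + cmod (- of_real t) + C1) * W0 \<le> (1 + t + C1) * (2 * S\<^sup>2 / t\<^sup>2 * F0)"
            using mult_left_mono[OF W0, of "1 + t + C1"] t1 th.lower_const_nonneg by (simp add: C1_def)
          thus ?thesis using c by (intro mult_left_mono add_left_mono) auto
        qed
        finally have W1: "W1 \<le> 2 / c * (F0 + (1 + t + C1) * (2 * S\<^sup>2 / t\<^sup>2 * F0))" .
        have hi: "((\<lambda>x. 3 * K1\<^sup>2 * ((norm (\<Phi> g (Complex x \<tau>)))\<^sup>2 + (norm (?w (Complex x \<tau>)))\<^sup>2 + (norm (vec_deriv ?w (Complex x \<tau>)))\<^sup>2))
            has_integral 3 * K1\<^sup>2 * (F0 + W0 + W1)) {0..2*pi}"
          unfolding F0_def W0_def W1_def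
          by (intro has_integral_mult_right has_integral_add has_integral_line_energy \<tau> \<Phi>_per vper_hol_vec_deriv)
        have "line_energy \<tau> (\<Phi> v) \<le> 3 * K1\<^sup>2 * (F0 + W0 + W1)"
        proof (rule line_energy_mono[OF \<Phi>_per \<tau> hi])
          fix x
          let ?z = "Complex x \<tau>"
          have z: "?z \<in> strip T" using \<tau> by simp
          define p a b b2 where "p = norm (\<Phi> g ?z)" and "a = norm (?w ?z)" and "b = norm (vec_deriv ?w ?z)"
            and "b2 = norm (vec_deriv (vec_deriv ?w) ?z)"
          have nn: "p \<ge> 0" "a \<ge> 0" "b \<ge> 0" "b2 \<ge> 0" by (auto simp: p_def a_def b_def b2_def)
          have "c * b2 \<le> p + (cmod (- of_real t) + B') * a + 2 * B' * b"
            unfolding p_def a_def b_def b2_def by (rule th.second_derivative_pointwise[OF \<Phi>_per z, of u "- of_real t" "\<Phi> g", OF eq[OF z]])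
          hence b2: "b2 \<le> (p + (t + B') * a + 2 * B' * b) / c" using c t1 by (simp add: field_simps)
          have "\<Phi> v ?z = L_op P2 P1 P0 ?w ?z + vec_deriv (vec_deriv ?w) ?z"
            by (simp add: v_def hardy_fun_diff[OF T z] a0[OF z] a1[OF z])
          hence "norm (\<Phi> v ?z) \<le> norm (L_op P2 P1 P0 ?w ?z) + b2"
            unfolding b2_def by (simp add: norm_triangle_ineq)
          also have "\<dots> \<le> B * a + 2 * B * b + B * b2 + b2"
            using L_op_pointwise[OF \<Phi>_per z, of u] by (simp add: a_def b_def b2_def)
          also have "\<dots> \<le> 2 * B' * a + 2 * B' * b + B' * b2"
            using nn B by (simp add: B'_def algebra_simps)
          also have "\<dots> \<le> 2 * B' * a + 2 * B' * b + B' * ((p + (t + B') * a + 2 * B' * b) / c)"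
            using b2 c by (intro add_left_mono mult_left_mono) auto
          also have "\<dots> \<le> K1 * (p + a + b)"
          proof -
            have "K1 * (p + a + b) - (2 * B' * a + 2 * B' * b + B' * ((p + (t + B') * a + 2 * B' * b) / c))
              = 2 * B' * p + (B' / c) * ((t + 3 * B') * p + (1 + 2 * B') * a + (1 + t + B') * b)"
              using c by (simp add: K1_def field_simps)
            also have "\<dots> \<ge> 0" using nn c t1 by simp
            finally show ?thesis by simp
          qed
          finally have "norm (\<Phi> v ?z) \<le> K1 * (p + a + b)" .
          hence "(norm (\<Phi> v ?z))\<^sup>2 \<le> (K1 * (p + a + b))\<^sup>2" by (intro power_mono) auto
          also have "\<dots> \<le> K1\<^sup>2 * (3 * (p\<^sup>2 + a\<^sup>2 + b\<^sup>2))"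
            unfolding power_mult_distrib by (intro mult_left_mono sum3_square) auto
          also have "\<dots> = 3 * K1\<^sup>2 * (p\<^sup>2 + a\<^sup>2 + b\<^sup>2)" by simp
          finally show "(norm (\<Phi> v ?z))\<^sup>2 \<le> 3 * K1\<^sup>2 * ((norm (\<Phi> g ?z))\<^sup>2 + (norm (?w ?z))\<^sup>2 + (norm (vec_deriv ?w ?z))\<^sup>2)"
            by (simp only: p_def a_def b_def)
        qed
        also have "\<dots> \<le> 3 * K1\<^sup>2 * (G * F0)"
        proof (intro mult_left_mono)
          have "G * F0 = F0 + 2 * S\<^sup>2 / t\<^sup>2 * F0 + 2 / c * (F0 + (1 + t + C1) * (2 * S\<^sup>2 / t\<^sup>2 * F0))"
            unfolding G_def by (simp add: algebra_simps)
          thus "F0 + W0 + W1 \<le> G * F0" using W0 W1 by linarith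
        qed simp
        also have "\<dots> \<le> 3 * K1\<^sup>2 * (G * (4 * pi * (norm g)\<^sup>2))"
        proof (intro mult_left_mono F0)
          show "G \<ge> 0" using c t1 th.lower_const_nonneg by (simp add: G_def C1_def)
        qed simp
        finally show ?thesis by (simp add: mult.assoc)
      qed
      have "(norm v)\<^sup>2 \<le> 3 * K1\<^sup>2 * G * (4 * pi * (norm g)\<^sup>2) / (2 * pi)"
        by (rule norm_le_of_line_energy[OF T main])
      also have "\<dots> = 6 * K1\<^sup>2 * G * (norm g)\<^sup>2" by simp
      also have "\<dots> = (sqrt (6 * K1\<^sup>2 * G) * norm g)\<^sup>2"
      proof -
        have "G \<ge> 0" using c t1 th.lower_const_nonneg by (simp add: G_def C1_def)
        thus ?thesis by (simp add: power_mult_distrib)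
      qed
      finally have "norm v \<le> sqrt (6 * K1\<^sup>2 * G) * norm g"
      proof (rule power2_le_imp_le)
        have "G \<ge> 0" using c t1 th.lower_const_nonneg by (simp add: G_def C1_def)
        thus "0 \<le> sqrt (6 * K1\<^sup>2 * G) * norm g" by simp
      qed
      thus "norm (hop u + t *\<^sub>R u - (A0 u + t *\<^sub>R u)) \<le> sqrt (6 * K1\<^sup>2 * G) *
          norm ((1 - \<theta>) *\<^sub>R (A0 u + t *\<^sub>R u) + \<theta> *\<^sub>R (hop u + t *\<^sub>R u))"
        by (simp add: v_def g_def)
    qed
  qed
  thus ?thesis using laplacian_dom_subset unfolding D0_def by blast
qed

end

section \<open>The theorem\<close>

text \<open>By periodicity all values are taken on a compact rectangle. The bound there comes from the
  continuous extension \<open>g\<close> to the closed strip.\<close>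

lemma bounded_on_strip:
  assumes g: "continuous_on (closed_strip T) g" and fg: "\<And>z. z \<in> strip T \<Longrightarrow> f z = g z"
    and per: "\<And>z. z \<in> strip T \<Longrightarrow> f (z + 2 * of_real pi) = f z"
  shows "\<exists>M. \<forall>z\<in>strip T. cmod (f z) \<le> M"
proof -
  let ?R = "cbox (Complex 0 (- T)) (Complex (2 * pi) T)"
  have "?R \<subseteq> closed_strip T" by (auto simp: in_cbox_complex_iff closed_strip_def)
  hence "compact (g ` ?R)" by (intro compact_continuous_image continuous_on_subset[OF g] compact_cbox)
  then obtain M where M: "\<And>z. z \<in> ?R \<Longrightarrow> cmod (g z) \<le> M" by (meson bounded_iff compact_imp_bounded imageI)
  have "cmod (f z) \<le> M" if z: "z \<in> strip T" for z
  proof -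
    define n where "n = - \<lfloor>Re z / (2 * pi)\<rfloor>"
    define w where "w = z + of_int n * (2 * of_real pi)"
    have w: "w \<in> strip T" using z by (simp add: w_def strip_def)
    have "of_int \<lfloor>Re z / (2 * pi)\<rfloor> * (2 * pi) \<le> Re z" "Re z \<le> (of_int \<lfloor>Re z / (2 * pi)\<rfloor> + 1) * (2 * pi)"
      using floor_divide_lower[of "2 * pi" "Re z"] floor_divide_upper[of "2 * pi" "Re z"] by simp_all
    hence "w \<in> ?R" using w by (auto simp: in_cbox_complex_iff strip_def w_def n_def algebra_simps)
    hence "cmod (f w) \<le> M" using M fg[OF w] by simp
    moreover have "f w = f z" unfolding w_def by (rule periodic_int[of T f]) (use per z in auto)
    ultimately show ?thesis by simp
  qed
  thus ?thesis by blast
qed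

lemma norm_matrix_vector_le:
  fixes P :: "complex ^ 'k ^ 'k"
  assumes "\<And>i j. cmod (P $ i $ j) \<le> b"
  shows "norm (P *v V) \<le> (\<Sum>i\<in>(UNIV::'k set). \<Sum>j\<in>(UNIV::'k set). b) * norm V"
proof -
  have b: "b \<ge> 0" using assms norm_ge_zero order_trans by blast
  have "norm (P *v V) \<le> (\<Sum>i\<in>UNIV. cmod ((P *v V) $ i))" by (rule norm_vec_le_sum)
  also have "\<dots> \<le> (\<Sum>i\<in>(UNIV::'k set). \<Sum>j\<in>(UNIV::'k set). b * norm V)"
  proof (rule sum_mono)
    fix i
    have "cmod ((P *v V) $ i) \<le> (\<Sum>j\<in>UNIV. cmod (P $ i $ j * V $ j))"
      unfolding matrix_vector_mult_def vec_lambda_beta by (rule norm_sum)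
    also have "\<dots> \<le> (\<Sum>j\<in>(UNIV::'k set). b * norm V)"
      unfolding norm_mult using b by (intro sum_mono mult_mono assms Finite_Cartesian_Product.norm_nth_le) auto
    finally show "cmod ((P *v V) $ i) \<le> (\<Sum>j\<in>(UNIV::'k set). b * norm V)" .
  qed
  also have "\<dots> = (\<Sum>i\<in>(UNIV::'k set). \<Sum>j\<in>(UNIV::'k set). b) * norm V" by (simp add: sum_distrib_right)
  finally show ?thesis .
qed

lemma matrix_bounded_on_strip:
  fixes P :: "complex \<Rightarrow> complex ^ 'k ^ 'k"
  assumes "\<And>i j. \<exists>M. \<forall>z\<in>strip T. cmod (P z $ i $ j) \<le> M"
  obtains B where "B \<ge> 0" "\<And>z V. z \<in> strip T \<Longrightarrow> norm (P z *v V) \<le> B * norm V"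
proof -
  obtain M where M: "\<And>i j z. z \<in> strip T \<Longrightarrow> cmod (P z $ i $ j) \<le> M i j" using assms by metis
  define b where "b = (\<Sum>i\<in>UNIV. \<Sum>j\<in>UNIV. \<bar>M i j\<bar>)"
  have le: "cmod (P z $ i $ j) \<le> b" if "z \<in> strip T" for z i j
  proof -
    have "cmod (P z $ i $ j) \<le> \<bar>M i j\<bar>" using M[OF that, of i j] by linarith
    also have "\<dots> \<le> (\<Sum>j\<in>UNIV. \<bar>M i j\<bar>)" by (rule member_le_sum) auto
    also have "\<dots> \<le> b" unfolding b_def by (rule member_le_sum) (auto intro: sum_nonneg)
    finally show ?thesis .
  qed
  have "b \<ge> 0" by (auto simp: b_def intro!: sum_nonneg)
  thus ?thesis using that norm_matrix_vector_le[OF le]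
    by (metis (no_types, lifting) sum_nonneg)
qed

lemma strip_subset: "strip T \<subseteq> closed_strip T"
  by (auto simp: strip_def closed_strip_def)

lemma derivative_in_strip:
  assumes "(f has_field_derivative d) (at z within closed_strip T)" "z \<in> strip T"
  shows "(f has_field_derivative d) (at z)"
  using DERIV_subset[OF assms(1) strip_subset] at_within_open[OF assms(2) open_strip] by simp

lemma C1_imp_continuous:
  assumes "continuously_differentiable_on (Suc j) S f" shows "continuous_on S f"
  using assms by (auto intro: DERIV_continuous_on)

text \<open>Continuity up to the boundary bounds the coefficients. For \<open>P1\<close> it is known only for \<open>P1 - P2'\<close>, and
  \<open>P2'\<close> agrees on the open strip with a derivative of \<open>P2\<close> that is continuous on the closed strip.\<close>

lemma regular_imp_elliptic:
  fixes P0 P1 P2 :: "complex \<Rightarrow> complex ^ 'k ^ 'k"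
  assumes T: "T > 0"
    and hol: "\<forall>P\<in>{P2, P1, P0}. \<forall>i j. (\<lambda>z. P z $ i $ j) holomorphic_on strip T"
    and per: "\<forall>P\<in>{P2, P1, P0}. \<forall>z\<in>closed_strip T. P (z + 2 * of_real pi) = P z"
    and reg: "regular_operator T P2 P1 P0" and C0: "C0 > 0"
    and coer: "\<forall>z\<in>closed_strip T. \<forall>V. Re (hdot V (P2 z *v V)) \<ge> C0 * (norm V)\<^sup>2"
  obtains B where "elliptic T C0 B P2 P1 P0"
proof -
  have ph: "mat_per_hol T P2" "mat_per_hol T P1" "mat_per_hol T P0"
    using hol per strip_subset[of T] by (auto simp: mat_per_hol_def per_hol_def subset_iff)
  obtain P2' where P2': "matrix_deriv_on (closed_strip T) P2 P2'"
    and A2: "\<And>i j. continuously_differentiable_on 2 (closed_strip T) (\<lambda>z. (- P2 z) $ i $ j)"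
    and A1: "\<And>i j. continuously_differentiable_on 1 (closed_strip T) (\<lambda>z. (P1 z - P2' z) $ i $ j)"
    and A0: "\<And>i j. continuously_differentiable_on 0 (closed_strip T) (\<lambda>z. P0 z $ i $ j)"
    using reg unfolding regular_operator_def matrix_continuously_differentiable_on_def Let_def by blast
  have per': "f (z + 2 * of_real pi) = f z" if "per_hol T f" "z \<in> strip T" for f z
    using that by (simp add: per_hol_def)
  have d2: "\<exists>g. continuous_on (closed_strip T) g \<and> (\<forall>z\<in>strip T. mat_deriv P2 z $ i $ j = g z \<and> P2' z $ i $ j = g z)" for i j
  proof -
    obtain g where g: "\<And>z. z \<in> closed_strip T \<Longrightarrow> ((\<lambda>z. (- P2 z) $ i $ j) has_field_derivative g z) (at z within closed_strip T)"
      "continuously_differentiable_on 1 (closed_strip T) g"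
      using A2[of i j] by (auto simp: numeral_2_eq_2)
    have "continuous_on (closed_strip T) g" using g(2) C1_imp_continuous[of 0] by simp
    moreover have "mat_deriv P2 z $ i $ j = - g z \<and> P2' z $ i $ j = - g z" if z: "z \<in> strip T" for z
    proof -
      have zc: "z \<in> closed_strip T" using z strip_subset by blast
      have "((\<lambda>z. (- P2 z) $ i $ j) has_field_derivative g z) (at z)" by (rule derivative_in_strip[OF g(1)[OF zc] z])
      hence 1: "((\<lambda>z. P2 z $ i $ j) has_field_derivative - g z) (at z)" using DERIV_minus by fastforce
      have "((\<lambda>z. P2 z $ i $ j) has_field_derivative P2' z $ i $ j) (at z)"
        using P2' zc by (intro derivative_in_strip[OF _ z]) (simp add: matrix_deriv_on_def)
      thus ?thesis using 1 DERIV_unique by (simp add: mat_deriv_def DERIV_imp_deriv) blast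
    qed
    ultimately show ?thesis by (intro exI[of _ "\<lambda>z. - g z"]) (auto intro: continuous_intros)
  qed
  have b2: "\<exists>M. \<forall>z\<in>strip T. cmod (P2 z $ i $ j) \<le> M" for i j
  proof -
    have "continuous_on (closed_strip T) (\<lambda>z. (- P2 z) $ i $ j)"
      using C1_imp_continuous A2[of i j] by (simp only: numeral_2_eq_2)
    hence "continuous_on (closed_strip T) (\<lambda>z. P2 z $ i $ j)" using continuous_on_minus by fastforce
    moreover have "per_hol T (\<lambda>z. P2 z $ i $ j)" using ph(1) by (simp add: mat_per_hol_def)
    ultimately show ?thesis
      using bounded_on_strip[where f = "\<lambda>z. P2 z $ i $ j" and g = "\<lambda>z. P2 z $ i $ j"] per' by blast
  qed
  have b2': "\<exists>M. \<forall>z\<in>strip T. cmod (mat_deriv P2 z $ i $ j) \<le> M" for i j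
  proof -
    obtain g where g: "continuous_on (closed_strip T) g" "\<And>z. z \<in> strip T \<Longrightarrow> mat_deriv P2 z $ i $ j = g z"
      using d2 by blast
    have p: "per_hol T (\<lambda>z. mat_deriv P2 z $ i $ j)" using per_hol_deriv ph(1) by (simp add: mat_per_hol_def mat_deriv_def)
    show ?thesis using bounded_on_strip[where f = "\<lambda>z. mat_deriv P2 z $ i $ j" and g = g] g per'[OF p] by blast
  qed
  have b1: "\<exists>M. \<forall>z\<in>strip T. cmod (P1 z $ i $ j) \<le> M" for i j
  proof -
    obtain g where g: "continuous_on (closed_strip T) g" "\<And>z. z \<in> strip T \<Longrightarrow> P2' z $ i $ j = g z"
      using d2 by blast
    have "continuous_on (closed_strip T) (\<lambda>z. (P1 z - P2' z) $ i $ j)"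
      using C1_imp_continuous[of 0] A1[of i j] by simp
    hence "continuous_on (closed_strip T) (\<lambda>z. (P1 z - P2' z) $ i $ j + g z)" using g(1) by (rule continuous_on_add)
    moreover have "per_hol T (\<lambda>z. P1 z $ i $ j)" using ph(2) by (simp add: mat_per_hol_def)
    moreover have "P1 z $ i $ j = (P1 z - P2' z) $ i $ j + g z" if "z \<in> strip T" for z using g(2)[OF that] by simp
    ultimately show ?thesis
      using bounded_on_strip[where f = "\<lambda>z. P1 z $ i $ j" and g = "\<lambda>z. (P1 z - P2' z) $ i $ j + g z"] per' by blast
  qed
  have b0: "\<exists>M. \<forall>z\<in>strip T. cmod (P0 z $ i $ j) \<le> M" for i j
  proof -
    have "per_hol T (\<lambda>z. P0 z $ i $ j)" using ph(3) by (simp add: mat_per_hol_def)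
    thus ?thesis using bounded_on_strip[where f = "\<lambda>z. P0 z $ i $ j" and g = "\<lambda>z. P0 z $ i $ j"] per' A0[of i j]
      by (simp only: continuously_differentiable_on.simps) blast
  qed
  obtain B2 where B2: "B2 \<ge> 0" "\<And>z V. z \<in> strip T \<Longrightarrow> norm (P2 z *v V) \<le> B2 * norm V"
    using matrix_bounded_on_strip[OF b2] by blast
  obtain B2' where B2': "B2' \<ge> 0" "\<And>z V. z \<in> strip T \<Longrightarrow> norm (mat_deriv P2 z *v V) \<le> B2' * norm V"
    using matrix_bounded_on_strip[OF b2'] by blast
  obtain B1 where B1: "B1 \<ge> 0" "\<And>z V. z \<in> strip T \<Longrightarrow> norm (P1 z *v V) \<le> B1 * norm V"
    using matrix_bounded_on_strip[OF b1] by blast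
  obtain B0 where B0: "B0 \<ge> 0" "\<And>z V. z \<in> strip T \<Longrightarrow> norm (P0 z *v V) \<le> B0 * norm V"
    using matrix_bounded_on_strip[OF b0] by blast
  define B where "B = B2 + B2' + B1 + B0"
  have up: "x \<le> B * norm V" if "x \<le> b * norm V" "b \<in> {B2, B2', B1, B0}" for x b and V :: "complex ^ 'k"
  proof -
    have "b \<le> B" using that(2) B2 B2' B1 B0 by (auto simp: B_def)
    thus ?thesis using that(1) mult_right_mono[of b B "norm V"] by simp
  qed
  have "elliptic T C0 B P2 P1 P0"
  proof
    show "B \<ge> 0" using B2 B2' B1 B0 by (simp add: B_def)
    fix z and V :: "complex ^ 'k" assume z: "z \<in> strip T"
    show "norm (P2 z *v V) \<le> B * norm V" by (rule up[OF B2(2)[OF z]]) simp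
    show "norm (mat_deriv P2 z *v V) \<le> B * norm V" by (rule up[OF B2'(2)[OF z]]) simp
    show "norm (P1 z *v V) \<le> B * norm V" by (rule up[OF B1(2)[OF z]]) simp
    show "norm (P0 z *v V) \<le> B * norm V" by (rule up[OF B0(2)[OF z]]) simp
    show "C0 * (norm V)\<^sup>2 \<le> Re (hdot V (P2 z *v V))" using coer z strip_subset by blast
  qed (use T C0 ph in auto)
  thus ?thesis by (rule that)
qed

lemma has_vector_derivative_vecI:
  fixes f :: "real \<Rightarrow> complex ^ 'k"
  assumes "\<And>i. ((\<lambda>x. f x $ i) has_vector_derivative d $ i) (at x within S)"
  shows "(f has_vector_derivative d) (at x within S)"
  unfolding has_vector_derivative_def
proof (subst has_derivative_componentwise_within, rule ballI)
  fix b :: "complex ^ 'k" assume "b \<in> Basis"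
  then obtain i e where b: "b = axis i e" by (auto simp: Basis_vec_def)
  have "((\<lambda>x. inner (f x $ i) e) has_derivative (\<lambda>h. inner (h *\<^sub>R (d $ i)) e)) (at x within S)"
    by (rule has_derivative_inner_left) (use assms[of i] in \<open>simp add: has_vector_derivative_def\<close>)
  thus "((\<lambda>x. inner (f x) b) has_derivative (\<lambda>x. inner (x *\<^sub>R d) b)) (at x within S)"
    by (simp add: b inner_axis)
qed

lemma of_real_conv_Complex: "of_real x = Complex x 0"
  by (simp add: complex_of_real_def)

lemma vper_hol_L2_per:
  fixes w :: "complex \<Rightarrow> complex ^ 'k"
  assumes T: "T > 0" and w: "vper_hol T w"
  shows "(\<lambda>x. w (of_real x)) \<in> L2_per"
proof -
  have cont: "continuous_on A (\<lambda>x. w (of_real x))" for A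
    unfolding of_real_conv_Complex by (rule continuous_on_line_vec[OF w]) (use T in simp)
  have "(\<lambda>x. w (of_real x)) \<in> borel_measurable borel" by (rule borel_measurable_continuous_onI[OF cont])
  hence "(\<lambda>x. w (of_real x)) \<in> borel_measurable lebesgue"
    by (intro measurable_completion) simp
  moreover have "w (of_real (x + 2 * pi)) = w (of_real x)" for x
    using w of_real_in_strip[OF T, of x] by (simp add: vec_eq_iff vper_hol_def per_hol_def)
  moreover have "set_integrable lebesgue {0..2*pi} (\<lambda>x. (norm (w (of_real x)))\<^sup>2)"
    by (intro absolutely_integrable_continuous_real continuous_intros cont)
  ultimately show ?thesis by (simp add: L2_per_def)
qed

lemma vper_hol_D_graph:
  fixes w :: "complex \<Rightarrow> complex ^ 'k"
  assumes T: "T > 0" and w: "vper_hol T w"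
  shows "((\<lambda>x. w (of_real x)), (\<lambda>x. vec_deriv w (of_real x))) \<in> D_graph"
proof -
  have "((\<lambda>x. vec_deriv w (of_real x)) has_integral (w (of_real y) - w (of_real x))) {x..y}" if "x \<le> y" for x y
    unfolding of_real_conv_Complex
  proof (rule fundamental_theorem_of_calculus[OF that], rule has_vector_derivative_vecI)
    fix s i
    have "Complex s 0 \<in> strip T" using T by simp
    from has_vector_derivative_horizontal[OF vper_hol_comp_deriv[OF w this]]
    show "((\<lambda>x. w (Complex x 0) $ i) has_vector_derivative vec_deriv w (Complex s 0) $ i) (at s within {x..y})"
      by (rule has_vector_derivative_at_within)
  qed
  thus ?thesis unfolding D_graph_def
    using vper_hol_L2_per[OF T w] vper_hol_L2_per[OF T vper_hol_vec_deriv[OF w]]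
    by (intro CollectI case_prodI conjI exI[of _ "\<lambda>x. w (of_real x)"]) auto
qed

context elliptic begin

text \<open>The \<open>L\<^sup>2\<close> inner product of the restrictions to the real line, the weaker inner product in which the
  operator is symmetric.\<close>

definition real_product :: "(complex ^ 'k) ell2 \<Rightarrow> (complex ^ 'k) ell2 \<Rightarrow> complex" where
  "real_product u v = 1 / (2 * of_real pi) * integral {0..2*pi} (\<lambda>x. hdot (\<Phi> v (Complex x 0)) (\<Phi> u (Complex x 0)))"

lemma zero_line: "\<bar>0::real\<bar> < T"
  using T by simp

lemma real_product_integrable: "(\<lambda>x. hdot (\<Phi> v (Complex x 0)) (\<Phi> u (Complex x 0))) integrable_on {0..2*pi}"
  by (intro integrable_continuous_interval continuous_on_hdot[OF \<Phi>_per \<Phi>_per zero_line])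

lemma real_product_L2_inner:
  "L2_inner (\<lambda>x. \<Phi> u (of_real x)) (\<lambda>x. \<Phi> v (of_real x)) = real_product u v"
proof -
  have "set_integrable lebesgue {0..2*pi} (\<lambda>x. hdot (\<Phi> v (Complex x 0)) (\<Phi> u (Complex x 0)))"
    by (intro absolutely_integrable_continuous_real continuous_on_hdot[OF \<Phi>_per \<Phi>_per zero_line])
  from set_lebesgue_integral_eq_integral(2)[OF this]
  show ?thesis by (simp add: L2_inner_def real_product_def of_real_conv_Complex)
qed

lemma real_product_add: "real_product (u + v) w = real_product u w + real_product v w"
proof -
  have "hdot (\<Phi> w (Complex x 0)) (\<Phi> (u + v) (Complex x 0)) =
     hdot (\<Phi> w (Complex x 0)) (\<Phi> u (Complex x 0)) + hdot (\<Phi> w (Complex x 0)) (\<Phi> v (Complex x 0))" for x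
    by (simp add: hdot_add_right hardy_fun_add[OF T, of "Complex x 0"] T)
  thus ?thesis unfolding real_product_def
    by (simp add: integral_add[OF real_product_integrable real_product_integrable] distrib_left)
qed

lemma real_product_scale: "real_product (scaleC c u) w = c * real_product u w"
proof -
  have "hdot (\<Phi> w (Complex x 0)) (\<Phi> (scaleC c u) (Complex x 0)) =
     c * hdot (\<Phi> w (Complex x 0)) (\<Phi> u (Complex x 0))" for x
    by (simp add: hdot_scale_right hardy_fun_scale[OF T, of "Complex x 0"] T)
  thus ?thesis unfolding real_product_def by simp
qed

lemma real_product_cnj: "real_product v u = cnj (real_product u v)"
proof -
  have "integral {0..2*pi} (\<lambda>x. hdot (\<Phi> u (Complex x 0)) (\<Phi> v (Complex x 0))) =
    integral {0..2*pi} (\<lambda>x. cnj (hdot (\<Phi> v (Complex x 0)) (\<Phi> u (Complex x 0))))" by (simp add: hdot_cnj)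
  also have "\<dots> = cnj (integral {0..2*pi} (\<lambda>x. hdot (\<Phi> v (Complex x 0)) (\<Phi> u (Complex x 0))))"
    by (rule integral_cnj[symmetric])
  finally show ?thesis by (simp add: real_product_def)
qed

lemma real_product_self: "real_product u u = of_real (line_energy 0 (\<Phi> u) / (2 * pi))"
proof -
  have "integral {0..2*pi} (\<lambda>x. complex_of_real ((norm (\<Phi> u (Complex x 0)))\<^sup>2)) = of_real (line_energy 0 (\<Phi> u))"
    using has_integral_linear[OF has_integral_line_energy[OF \<Phi>_per zero_line] bounded_linear_of_real]
    by (intro integral_unique) (simp add: o_def)
  thus ?thesis by (simp add: real_product_def hdot_self)
qed

text \<open>A nonzero element has a nonzero Fourier coefficient, and Parseval's identity on the real line sees it.\<close>

lemma real_product_pos: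
  assumes "u \<noteq> 0" shows "Re (real_product u u) > 0"
proof -
  obtain n where n: "Rep_ell2 u n \<noteq> 0"
  proof (rule ccontr)
    assume "\<not> thesis"
    hence "Rep_ell2 u n = Rep_ell2 0 n" for n using that by (auto simp: zero_ell2.rep_eq)
    hence "Rep_ell2 u = Rep_ell2 0" by (rule ext)
    thus False using assms by (simp add: Rep_ell2_inject)
  qed
  have "0 < (norm (vcoef (\<Phi> u) n))\<^sup>2" using n weight_pos[of T n] by (simp add: hardy_fun_props(3)[OF T])
  also have "\<dots> \<le> line_energy 0 (\<Phi> u) / (2 * pi)"
    using finite_sum_le_has_sum[OF parseval_line_vec[OF \<Phi>_per zero_line], of "{n}"] by simp
  finally show ?thesis by (simp add: real_product_self)
qed

lemma real_product_bounded: "\<exists>K\<ge>0. \<forall>u v. cmod (real_product u v) \<le> K * norm u * norm v"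
proof -
  obtain K where K: "K \<ge> 0" "\<And>u :: (complex ^ 'k) ell2. \<And>z i. \<bar>Im z\<bar> \<le> 0 \<Longrightarrow> cmod (\<Phi> u z $ i) \<le> K * norm u"
    using hardy_fun_eval_bound[OF T T] by metis
  define N where "N = real CARD('k) * K"
  have N: "norm (\<Phi> u (Complex x 0)) \<le> N * norm u" for u :: "(complex ^ 'k) ell2" and x
  proof -
    have "norm (\<Phi> u (Complex x 0)) \<le> (\<Sum>i\<in>(UNIV :: 'k set). K * norm u)"
      by (rule order_trans[OF norm_vec_le_sum sum_mono]) (rule K(2), simp)
    thus ?thesis by (simp add: N_def)
  qed
  have "cmod (real_product u v) \<le> N\<^sup>2 * norm u * norm v" for u v
  proof -
    have "norm (integral {0..2*pi} (\<lambda>x. hdot (\<Phi> v (Complex x 0)) (\<Phi> u (Complex x 0)))) \<le> N\<^sup>2 * norm u * norm v * (2 * pi - 0)"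
    proof (rule integral_bound)
      fix x
      have "cmod (hdot (\<Phi> v (Complex x 0)) (\<Phi> u (Complex x 0))) \<le> norm (\<Phi> v (Complex x 0)) * norm (\<Phi> u (Complex x 0))"
        by (rule hdot_le)
      also have "\<dots> \<le> (N * norm v) * (N * norm u)" using K(1) by (intro mult_mono N) (auto simp: N_def)
      finally show "norm (hdot (\<Phi> v (Complex x 0)) (\<Phi> u (Complex x 0))) \<le> N\<^sup>2 * norm u * norm v"
        by (simp add: power2_eq_square mult_ac)
    qed (auto intro: continuous_on_hdot[OF \<Phi>_per \<Phi>_per zero_line])
    thus ?thesis by (simp add: real_product_def norm_mult norm_divide field_simps)
  qed
  thus ?thesis by (intro exI[of _ "N\<^sup>2"]) auto
qed

text \<open>The link between the operator on the Hardy space and the operator on the real line, to which positivity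
  refers.\<close>

lemma hdom_L_graph:
  assumes u: "u \<in> hdom"
  shows "((\<lambda>x. \<Phi> u (of_real x)), (\<lambda>x. \<Phi> (hop u) (of_real x))) \<in> L_graph P2 P1 P0"
proof -
  have w': "vper_hol T (vec_deriv (\<Phi> u))" by (rule vper_hol_vec_deriv[OF \<Phi>_per])
  have "\<Phi> (hop u) (of_real x) = - vec_deriv (\<lambda>z. P2 z *v vec_deriv (\<Phi> u) z) (of_real x)
      + P1 (of_real x) *v vec_deriv (\<Phi> u) (of_real x) + P0 (of_real x) *v \<Phi> u (of_real x)" for x
    using hardy_op[OF u of_real_in_strip[OF T], of x] by (simp add: L_op_def)
  thus ?thesis unfolding L_graph_def
    using vper_hol_L2_per[OF T \<Phi>_per] vper_hol_D_graph[OF T \<Phi>_per[of u]] vper_hol_D_graph[OF T w']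
      vper_hol_D_graph[OF T vper_hol_mult[OF hol2 w']] by blast
qed

lemma hop_real:
  assumes pos: "positive_graph (L_graph P2 P1 P0)" and u: "u \<in> hdom"
  shows "Im (real_product (hop u) u) = 0"
proof (cases "u = 0")
  case True
  have "real_product 0 v = 0" for v using real_product_scale[of 0 0 v] by simp
  hence "real_product v 0 = 0" for v by (subst real_product_cnj) simp
  thus ?thesis using True by simp
next
  case False
  have "\<not> (AE x in lebesgue. \<Phi> u (of_real x) = 0)"
  proof
    assume ae: "AE x in lebesgue. \<Phi> u (of_real x) = 0"
    have "(LINT x:{0..2*pi}|lebesgue. hdot (\<Phi> u (of_real x)) (\<Phi> u (of_real x))) = 0"
      unfolding set_lebesgue_integral_def
      by (rule integral_eq_zero_AE) (use ae in eventually_elim, simp add: hdot_def)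
    hence "real_product u u = 0" unfolding real_product_L2_inner[symmetric] L2_inner_def by simp
    thus False using real_product_pos[OF False] by simp
  qed
  hence "L2_inner (\<lambda>x. \<Phi> (hop u) (of_real x)) (\<lambda>x. \<Phi> u (of_real x)) \<in> \<real>"
    using bspec[OF pos[unfolded positive_graph_def] hdom_L_graph[OF u]] by simp
  thus ?thesis by (simp add: real_product_L2_inner complex_is_Real_iff)
qed

text \<open>Positivity makes \<open>\<langle>L u, u\<rangle>\<close> real for all \<open>u\<close> in the domain; polarization with \<open>u + v\<close> and \<open>u + \<i> v\<close>
  gives symmetry.\<close>

lemma hop_symmetric:
  assumes pos: "positive_graph (L_graph P2 P1 P0)" and u: "u \<in> hdom" and v: "v \<in> hdom"
  shows "real_product (hop u) v = real_product u (hop v)"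
proof -
  define b where "b = (\<lambda>u v. real_product (hop u) v)"
  have right_add: "real_product x (y + z) = real_product x y + real_product x z" for x y z
    by (subst (1 2 3) real_product_cnj) (simp add: real_product_add)
  have right_scale: "real_product x (scaleC c y) = cnj c * real_product x y" for x y c
    by (subst (1 2) real_product_cnj) (simp add: real_product_scale)
  have quad: "b (u + w) (u + w) = b u u + b w w + (b u w + b w u)" if "w \<in> hdom" for w
    using dom_add[OF u that] by (simp add: b_def real_product_add right_add)
  have "Im (b u v + b v u) = 0"
    using quad[OF v] hop_real[OF pos u] hop_real[OF pos v] hop_real[OF pos, of "u + v"] dom_add[OF u v] by (simp add: b_def)
  moreover have "Im (b u (scaleC \<i> v) + b (scaleC \<i> v) u) = 0"
    using quad[of "scaleC \<i> v"] hop_real[OF pos u] hop_real[OF pos, of "scaleC \<i> v"] dom_scale[OF v, of \<i>]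
      hop_real[OF pos, of "u + scaleC \<i> v"] dom_add[OF u, of "scaleC \<i> v"] by (simp add: b_def)
  hence "Re (b v u) = Re (b u v)"
    using dom_scale[OF v, of \<i>] by (simp add: b_def real_product_scale right_scale)
  ultimately have "b u v = cnj (b v u)" by (simp add: complex_eq_iff)
  thus ?thesis unfolding b_def by (subst (2) real_product_cnj)
qed

lemma hop_symmetrizable:
  assumes pos: "positive_graph (L_graph P2 P1 P0)"
  shows "symmetrizable_operator scaleC hdom hop real_product finite_support"
proof
  show "\<exists>C>0. \<forall>u\<in>hdom. \<forall>z. Re z \<le> 0 \<longrightarrow> C \<le> cmod z \<longrightarrow> cmod z * norm u \<le> C * norm (hop u - scaleC z u)"
    using op_left_half_plane sector_const_ge by (intro exI[of _ "4 * sector_const c0 B"]) auto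
  show "\<exists>m. \<forall>t\<ge>m. \<forall>f. \<exists>u\<in>hdom. hop u + t *\<^sub>R u = f" by (rule op_onto_far_left)
  show "\<exists>C>0. \<forall>u\<in>hdom. \<forall>z. hop u - scaleC z u = f \<longrightarrow>
        (norm u)\<^sup>2 \<le> C * exp (C * sqrt (cmod z)) * (Re (real_product u u) + 1)" if "f \<in> finite_support" for f
    using op_growth[OF that] by (simp add: real_product_self)
  show "u + v \<in> hdom" "hop (u + v) = hop u + hop v" if "u \<in> hdom" "v \<in> hdom" for u v
    using dom_add that by blast+
  show "scaleC c u \<in> hdom" "hop (scaleC c u) = scaleC c (hop u)" if "u \<in> hdom" for c u
    using dom_scale that by blast+
  show "u \<in> hdom \<and> hop u = h"
    if "\<And>n. U n \<in> hdom" "U \<longlonglongrightarrow> u" "(\<lambda>n. hop (U n)) \<longlonglongrightarrow> h" for U u h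
    by (rule op_closed[OF that])
  show "\<exists>r u. strict_mono r \<and> (\<lambda>n. U (r n)) \<longlonglongrightarrow> u"
    if "\<And>n. U n \<in> hdom" "bounded (range U)" "bounded (range (\<lambda>n. hop (U n)))"
    for U :: "nat \<Rightarrow> (complex ^ 'k) ell2"
    by (rule op_compact[OF that])
  show "real_product (hop u) v = real_product u (hop v)" if "u \<in> hdom" "v \<in> hdom" for u v
    by (rule hop_symmetric[OF pos that])
  show "real_product (x + y) z = real_product x z + real_product y z" for x y z by (rule real_product_add)
  show "real_product (scaleC c x) z = c * real_product x z" for c x z by (rule real_product_scale)
  show "real_product y x = cnj (real_product x y)" for x y by (rule real_product_cnj)
  show "Re (real_product x x) > 0" if "x \<noteq> 0" for x by (rule real_product_pos[OF that])
  show "\<exists>K\<ge>0. \<forall>x y. cmod (real_product x y) \<le> K * norm x * norm y" by (rule real_product_bounded)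
  show "closure finite_support = (UNIV :: (complex ^ 'k) ell2 set)" by (rule finite_support_dense)
  show "finite_support \<subseteq> hdom" by (rule finite_support_dom)
qed

end

lemma complex_span_add:
  assumes "g \<in> complex_span E" "h \<in> complex_span E"
  shows "(\<lambda>z. g z + h z) \<in> complex_span E"
proof -
  obtain F c where g: "g = (\<lambda>z. \<Sum>\<psi>\<in>F. c \<psi> *s \<psi> z)" "finite F" "F \<subseteq> E" using assms(1) by (auto simp: complex_span_def)
  obtain G d where h: "h = (\<lambda>z. \<Sum>\<psi>\<in>G. d \<psi> *s \<psi> z)" "finite G" "G \<subseteq> E" using assms(2) by (auto simp: complex_span_def)
  define e where "e = (\<lambda>\<psi>. (if \<psi> \<in> F then c \<psi> else 0) + (if \<psi> \<in> G then d \<psi> else 0))"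
  have "(\<Sum>\<psi>\<in>F \<union> G. e \<psi> *s \<psi> z) = g z + h z" for z
  proof -
    have "(\<Sum>\<psi>\<in>F \<union> G. e \<psi> *s \<psi> z) = (\<Sum>\<psi>\<in>F \<union> G. (if \<psi> \<in> F then c \<psi> *s \<psi> z else 0))
       + (\<Sum>\<psi>\<in>F \<union> G. (if \<psi> \<in> G then d \<psi> *s \<psi> z else 0))"
      unfolding sum.distrib[symmetric] by (rule sum.cong) (auto simp: e_def vector_sadd_rdistrib)
    also have "(\<Sum>\<psi>\<in>F \<union> G. (if \<psi> \<in> F then c \<psi> *s \<psi> z else 0)) = g z"
      unfolding g(1) using g h by (intro sum.mono_neutral_cong_right) auto
    also have "(\<Sum>\<psi>\<in>F \<union> G. (if \<psi> \<in> G then d \<psi> *s \<psi> z else 0)) = h z"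
      unfolding h(1) using g h by (intro sum.mono_neutral_cong_right) auto
    finally show ?thesis .
  qed
  thus ?thesis using g h unfolding complex_span_def
    by (auto intro!: exI[of _ "F \<union> G"] exI[of _ e])
qed

lemma complex_span_scale:
  assumes "g \<in> complex_span E" shows "(\<lambda>z. a *s g z) \<in> complex_span E"
proof -
  obtain F c where g: "g = (\<lambda>z. \<Sum>\<psi>\<in>F. c \<psi> *s \<psi> z)" "finite F" "F \<subseteq> E" using assms by (auto simp: complex_span_def)
  have "(\<lambda>z. a *s g z) = (\<lambda>z. \<Sum>\<psi>\<in>F. (a * c \<psi>) *s \<psi> z)"
    unfolding g(1) by (simp add: fun_eq_iff vec_eq_iff sum_distrib_left mult.assoc)
  thus ?thesis using g unfolding complex_span_def by (auto intro!: exI[of _ F] exI[of _ "\<lambda>\<psi>. a * c \<psi>"])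
qed

lemma complex_span_zero: "(\<lambda>_. 0) \<in> complex_span E"
  unfolding complex_span_def by (auto intro!: exI[of _ "{}"])

lemma complex_span_base: "\<psi> \<in> E \<Longrightarrow> \<psi> \<in> complex_span E"
  unfolding complex_span_def by (auto intro!: exI[of _ "{\<psi>}"] exI[of _ "\<lambda>_. 1"])

theorem theorem4p6:
  fixes T C0 :: real
    and P0 P1 P2 :: "complex \<Rightarrow> complex ^ 'k ^ 'k"
  assumes "T > 0"
    and "\<forall>P\<in>{P2, P1, P0}. \<forall>i j. (\<lambda>z. P z $ i $ j) holomorphic_on strip T"
    and "\<forall>P\<in>{P2, P1, P0}. \<forall>z\<in>closed_strip T. P (z + 2 * of_real pi) = P z"
    and "regular_operator T P2 P1 P0"
    and "self_adjoint_graph (L_graph P2 P1 P0)"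
    and "positive_graph (L_graph P2 P1 P0)"
    and "C0 > 0"
    and "\<forall>z\<in>closed_strip T. \<forall>V. Re (hdot V (P2 z *v V)) \<ge> C0 * (norm V)\<^sup>2"
  shows "dense_in_H2_vec T (complex_span (periodic_eigenfunctions T P2 P1 P0))"
proof -
  let ?E = "periodic_eigenfunctions T P2 P1 P0"
  obtain B where "elliptic T C0 B P2 P1 P0"
    using regular_imp_elliptic[OF assms(1-4,7,8)] by blast
  then interpret elliptic T C0 B P2 P1 P0 .
  interpret S: symmetrizable_operator scaleC hdom hop real_product finite_support
    by (rule hop_symmetrizable[OF assms(6)])
  have eig: "\<exists>u. \<forall>z\<in>strip T. \<psi> z = \<Phi> u z" if \<psi>: "\<psi> \<in> ?E" for \<psi>
  proof -
    have "vper_hol T \<psi>" using \<psi> by (auto simp: periodic_eigenfunctions_def vper_hol_def per_hol_def)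
    moreover obtain \<mu> where "\<And>z. z \<in> strip T \<Longrightarrow> L_op P2 P1 P0 \<psi> z = \<mu> *s \<psi> z"
      using \<psi> by (auto simp: periodic_eigenfunctions_def)
    ultimately show ?thesis using eigenfunction_in_hardy by metis
  qed
  have zero: "\<Phi> (0 :: (complex ^ 'k) ell2) z = 0" if "z \<in> strip T" for z using hardy_fun_scale[OF T that, of 0 0] by simp
  have sub: "complex_span ?E \<subseteq> H2_vec T"
  proof
    fix g assume "g \<in> complex_span ?E"
    then obtain F c where g: "g = (\<lambda>z. \<Sum>\<psi>\<in>F. c \<psi> *s \<psi> z)" "finite F" "F \<subseteq> ?E" by (auto simp: complex_span_def)
    have "\<exists>u. \<forall>z\<in>strip T. (\<Sum>\<psi>\<in>F. c \<psi> *s \<psi> z) = \<Phi> u z" using g(2,3)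
    proof (induction F)
      case empty
      thus ?case using zero by (intro exI[of _ 0]) simp
    next
      case (insert \<psi> F)
      obtain u where u: "\<And>z. z \<in> strip T \<Longrightarrow> (\<Sum>\<psi>\<in>F. c \<psi> *s \<psi> z) = \<Phi> u z" using insert by auto
      obtain v where v: "\<And>z. z \<in> strip T \<Longrightarrow> \<psi> z = \<Phi> v z" using eig insert.prems by blast
      show ?case using insert.hyps
        by (intro exI[of _ "scaleC (c \<psi>) v + u"]) (simp add: u v hardy_fun_add[OF T] hardy_fun_scale[OF T])
    qed
    then obtain u where "\<And>z. z \<in> strip T \<Longrightarrow> g z = \<Phi> u z" unfolding g(1) by blast
    thus "g \<in> H2_vec T" by (rule hardy_fun_in_H2(1)[OF T])
  qed
  \<comment> \<open>Agreement is required on the strip only, because \<open>hardy_fun\<close> is linear only there.\<close>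
  define V where "V = {s. \<exists>g\<in>complex_span ?E. \<forall>z\<in>strip T. g z = \<Phi> s z}"
  have V0: "0 \<in> V"
    unfolding V_def by (intro CollectI bexI[OF _ complex_span_zero] ballI) (simp add: zero)
  have "module.subspace scaleC V"
  proof (rule ell2.subspaceI)
    show "0 \<in> V" by (rule V0)
    fix s t assume "s \<in> V" "t \<in> V"
    then obtain g h where g: "g \<in> complex_span ?E" "\<And>z. z \<in> strip T \<Longrightarrow> g z = \<Phi> s z"
      and h: "h \<in> complex_span ?E" "\<And>z. z \<in> strip T \<Longrightarrow> h z = \<Phi> t z" by (auto simp: V_def)
    show "s + t \<in> V" unfolding V_def
      by (intro CollectI bexI[OF _ complex_span_add[OF g(1) h(1)]] ballI) (simp add: g(2) h(2) hardy_fun_add[OF T])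
  next
    fix c s assume "s \<in> V"
    then obtain g where g: "g \<in> complex_span ?E" "\<And>z. z \<in> strip T \<Longrightarrow> g z = \<Phi> s z" by (auto simp: V_def)
    show "scaleC c s \<in> V" unfolding V_def
      by (intro CollectI bexI[OF _ complex_span_scale[OF g(1), of c]] ballI) (simp add: g(2) hardy_fun_scale[OF T])
  qed
  moreover have "{u \<in> hdom. \<exists>z. hop u = scaleC z u} \<subseteq> V"
  proof
    fix u assume "u \<in> {u \<in> hdom. \<exists>z. hop u = scaleC z u}"
    then obtain \<mu> where u: "u \<in> hdom" "hop u = scaleC \<mu> u" by blast
    show "u \<in> V"
    proof (cases "u = 0")
      case True
      thus ?thesis using V0 by simp
    next
      case False
      have "\<exists>z\<in>strip T. \<Phi> u z \<noteq> 0" using hardy_fun_eqI[OF T, of u 0] zero False by auto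
      moreover have "L_op P2 P1 P0 (\<Phi> u) z = \<mu> *s \<Phi> u z" if "z \<in> strip T" for z
        using hardy_op[OF u(1) that] by (simp add: u(2) hardy_fun_scale[OF T that])
      ultimately have "\<Phi> u \<in> ?E"
        using \<Phi>_per[of u] by (auto simp: periodic_eigenfunctions_def vper_hol_def per_hol_def vec_eq_iff)
      hence "\<Phi> u \<in> complex_span ?E" by (rule complex_span_base)
      thus ?thesis unfolding V_def by blast
    qed
  qed
  ultimately have span: "module.span scaleC {u \<in> hdom. \<exists>z. hop u = scaleC z u} \<subseteq> V" by (intro ell2.span_minimal)
  have "\<exists>g\<in>complex_span ?E. H2_vec_norm T (\<lambda>z. f z - g z) < e" if f: "f \<in> H2_vec T" and e: "e > 0" for f e
  proof -
    obtain u where u: "\<And>z. z \<in> strip T \<Longrightarrow> \<Phi> u z = f z" using H2_vec_hardy_fun[OF T f] by blast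
    have "u \<in> closure (module.span scaleC {u \<in> hdom. \<exists>z. hop u = scaleC z u})" by (simp add: S.eigenvectors_complete)
    then obtain s where s: "s \<in> V" "dist s u < e" using e span unfolding closure_approachable by blast
    obtain g where g: "g \<in> complex_span ?E" "\<And>z. z \<in> strip T \<Longrightarrow> g z = \<Phi> s z" using s(1) by (auto simp: V_def)
    have "H2_vec_norm T (\<lambda>z. f z - g z) = norm (u - s)"
      by (rule hardy_fun_in_H2(2)[OF T]) (simp add: hardy_fun_diff[OF T] u g(2))
    thus ?thesis using g(1) s(2) by (intro bexI[of _ g]) (auto simp: dist_norm norm_minus_commute)
  qed
  thus ?thesis using sub unfolding dense_in_H2_vec_def by blast
qed


end
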